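(* Let $X$ be a radiant toric variety, let $U\subseteq U_{\max}$ be a regular unipotent subgroup, $\mathfrak M=\mathfrak R(U)$, and let $l$ be the length of the longest path in $\Gamma(\mathfrak M)$. Then the lower (resp. upper) central series of $U$ consists of the subgroups $U(\mathfrak M^{\uparrow k})$ (resp. $U(\mathfrak M^{\downarrow k})$) for $0\le k\le l+1$, in this order.
   Context: $\mathbb K$ is an algebraically closed field of characteristic zero. $X$ is a complete toric variety of dimension $n$ with acting torus $T$; $N\cong\mathbb Z^n$ is the lattice of one-parameter subgroups of $T$, $M=\mathrm{Hom}(N,\mathbb Z)$, $\langle\cdot,\cdot\rangle$ is the pairing, $\Sigma$ is the fan of $X$, with rays having primitive generators $p_1,\dots,p_m$. $\mathrm{Aut}(X)$ is a linear algebraic group with maximal torus $T$. $X$ is radiant if a maximal unipotent subgroup of $\mathrm{Aut}(X)$ acts on $X$ with an open orbit; it is known that this holds iff $\Sigma$ is bilateral, i.e. up to renumbering $p_1,\dots,p_n$ is a basis of $N$ and $p_k=-\sum_{j=1}^n a_{kj}p_j$ with $a_{kj}\in\mathbb Z_{\ge0}$ for $n<k\le m$. Fix such a numbering; $q_1,\dots,q_n$ is the dual basis of $M$ and $C=\{1,\dots,n\}$. Demazure roots: $\mathfrak R_i=\{e\in M:\langle e,p_i\rangle=-1,\ \langle e,p_s\rangle\ge0\ \forall s\ne i\}$, $\mathfrak R=\bigsqcup_{i=1}^m\mathfrak R_i$; $\mathfrak S=\mathfrak R\cap(-\mathfrak R)$, $\mathfrak U=\mathfrak R\setminus\mathfrak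 S$. Root subgroups: the Cox ring of $X$ is $\mathbb K[x_1,\dots,x_m]$, graded by $\mathrm{Cl}(X)$ with $\deg x_l=[D_l]$, the class of the $T$-invariant prime divisor of the $l$-th ray. For $e\in\mathfrak R_i$ let $\partial_e=\big(\prod_{s\ne i}x_s^{\langle e,p_s\rangle}\big)\frac{\partial}{\partial x_i}$, a homogeneous locally nilpotent derivation; the graded automorphisms $\exp(\alpha\partial_e)$, $\alpha\in\mathbb K$, descend to a one-parameter unipotent subgroup $U_e\subseteq\mathrm{Aut}(X)$ through the Cox quotient construction of $X$. An algebraic subgroup of $\mathrm{Aut}(X)$ is regular if it is normalized by $T$. For a regular unipotent subgroup $U$, $\mathfrak R(U)=\{e\in\mathfrak R:U_e\subseteq U\}$. For a set of roots $\mathfrak M$ whose root subgroups generate a unipotent group, $U(\mathfrak M)$ denotes the group generated by $U_e$, $e\in\mathfrak M$. Preorder on $C$: $i\succeq j$ iff $a_{ki}\ge a_{kj}$ for all $n<k\le m$; $i\asymp j$ iff equality holds for all such $k$. The numbering is chosen so that the $\asymp$-classes $C_1,\dots,C_r$ satisfy: $C_l\succ C_s$ implies $l<s$, and $C_s=\{c_{s-1}+1,\dots,c_s\}$ for some $0=c_0<c_1<\dots<c_r=n$. Fix $v\in N$ with $\langle q_1,v\rangle<\dots<\langle q_n,v\rangle<0$; put $\mathfrak R^+=\{e\in\mathfrak S:\langle e,v\rangle>0\}\sqcup\mathfrak U$ and let $U_{\max}=U(\mathfrak R^+)$; it is a maximal unipotent subgroup of $\mathrm{Aut}(X)$ and $\mathfrak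 R(U_{\max})=\mathfrak R^+$. For a regular unipotent subgroup $U\subseteq U_{\max}$ with $\mathfrak M=\mathfrak R(U)$, $\Gamma(\mathfrak M)$ is the directed graph with vertex set $\mathfrak M$ and an arrow from $a$ to $b$ iff $b=a+e$ for some $e\in\mathfrak M$. For $k\ge0$, $\mathfrak M^{\uparrow k}$ is the set of $b\in\mathfrak M$ such that some path of length $k$ in $\Gamma(\mathfrak M)$ ends in $b$; $\mathfrak M^{\downarrow k}$ is the set of $a\in\mathfrak M$ such that every path in $\Gamma(\mathfrak M)$ starting in $a$ has length less than $k$. (The graph is acyclic; length is the number of arrows.) The terms of the series are indexed from $0$: the lower central series starts with $U$ at $k=0$, with $(k+1)$-st term $[U,\,k\text{-th term}]$; the upper central series starts with $\{\mathrm{id}\}$ at $k=0$. *)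

theory Defs
  imports
    "HOL-Analysis.Analysis"
    "HOL-Computational_Algebra.Polynomial"
    "HOL-Library.Poly_Mapping"
    "HOL-Algebra.Bij"
    "HOL-Algebra.Generated_Groups"
begin

section \<open>Fans\<close>

text \<open>Both \<open>N\<close> and its dual \<open>M\<close> are \<open>int ^ 'n\<close>, with \<open>M = Hom(N, \<int>)\<close> via the standard pairing;
  \<open>N\<close> sits inside the real vector space \<open>real ^ 'n\<close>.\<close>

definition pairing :: "int ^ 'n \<Rightarrow> int ^ 'n \<Rightarrow> int" where
  "pairing u w = (\<Sum>i\<in>UNIV. u $ i * w $ i)"

definition real_vec :: "int ^ 'n \<Rightarrow> real ^ 'n" where
  "real_vec w = (\<chi> i. of_int (w $ i))"

definition rational_cone :: "(real ^ 'n) set \<Rightarrow> bool" where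
  "rational_cone \<sigma> \<longleftrightarrow>
     (\<exists>G. finite G \<and> \<sigma> = convex_cone hull (real_vec ` G)) \<and> \<sigma> \<inter> uminus ` \<sigma> = {0}"

text \<open>In the library the empty set is a face of every convex set; it is not a cone.\<close>

definition is_fan :: "(real ^ 'n) set set \<Rightarrow> bool" where
  "is_fan \<Sigma> \<longleftrightarrow> finite \<Sigma> \<and> \<Sigma> \<noteq> {} \<and> (\<forall>\<sigma>\<in>\<Sigma>. rational_cone \<sigma>) \<and>
     (\<forall>\<sigma>\<in>\<Sigma>. \<forall>\<tau>. \<tau> face_of \<sigma> \<and> \<tau> \<noteq> {} \<longrightarrow> \<tau> \<in> \<Sigma>) \<and>
     (\<forall>\<sigma>\<in>\<Sigma>. \<forall>\<tau>\<in>\<Sigma>. (\<sigma> \<inter> \<tau>) face_of \<sigma> \<and> (\<sigma> \<inter> \<tau>) face_of \<tau>)"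

definition complete_fan :: "(real ^ 'n) set set \<Rightarrow> bool" where
  "complete_fan \<Sigma> \<longleftrightarrow> is_fan \<Sigma> \<and> \<Union>\<Sigma> = UNIV"

definition primitive :: "int ^ 'n \<Rightarrow> bool" where
  "primitive w \<longleftrightarrow> (\<forall>(k::int) w'. w = k *s w' \<longrightarrow> \<bar>k\<bar> = 1)"

definition ray_generators :: "(real ^ 'n) set set \<Rightarrow> (int ^ 'n) set" where
  "ray_generators \<Sigma> = {w. primitive w \<and> convex_cone hull {real_vec w} \<in> \<Sigma>}"

section \<open>Varieties in the classical sense\<close>

text \<open>A variety over an algebraically closed field is given by an atlas of affine charts: a chart
  is a set of points with its algebra of regular functions. Only the values of these functions
  on the chart matter.\<close>

type_synonym ('a, 'k) atlas = "('a set \<times> ('a \<Rightarrow> 'k) set) set"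

definition points :: "('a, 'k) atlas \<Rightarrow> 'a set" where
  "points \<A> = (\<Union>(P, A)\<in>\<A>. P)"

definition zariski_open :: "('a, 'k::field) atlas \<Rightarrow> 'a set \<Rightarrow> bool" where
  "zariski_open \<A> V \<longleftrightarrow> V \<subseteq> points \<A> \<and>
     (\<forall>x\<in>V. \<exists>(P, A)\<in>\<A>. x \<in> P \<and> (\<exists>h\<in>A. h x \<noteq> 0 \<and> {y\<in>P. h y \<noteq> 0} \<subseteq> V))"

definition regular_on :: "('a, 'k::field) atlas \<Rightarrow> 'a set \<Rightarrow> ('a \<Rightarrow> 'k) \<Rightarrow> bool" where
  "regular_on \<A> V f \<longleftrightarrow>
     (\<forall>x\<in>V. \<exists>(P, A)\<in>\<A>. x \<in> P \<and>
        (\<exists>g\<in>A. \<exists>h\<in>A. h x \<noteq> 0 \<and> (\<forall>y\<in>V \<inter> P. h y \<noteq> 0 \<longrightarrow> f y = g y / h y)))"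

definition morphism :: "('a, 'k::field) atlas \<Rightarrow> ('b, 'k) atlas \<Rightarrow> ('a \<Rightarrow> 'b) \<Rightarrow> bool" where
  "morphism \<A> \<B> \<phi> \<longleftrightarrow> \<phi> ` points \<A> \<subseteq> points \<B> \<and>
     (\<forall>V. zariski_open \<B> V \<longrightarrow>
        zariski_open \<A> (points \<A> \<inter> \<phi> -` V) \<and>
        (\<forall>f. regular_on \<B> V f \<longrightarrow> regular_on \<A> (points \<A> \<inter> \<phi> -` V) (\<lambda>x. f (\<phi> x))))"

definition prod_atlas :: "('a, 'k::field) atlas \<Rightarrow> ('b, 'k) atlas \<Rightarrow> ('a \<times> 'b, 'k) atlas" where
  "prod_atlas \<A> \<B> =
     {(P \<times> Q, {h. \<exists>(r::nat) a b. (\<forall>j<r. a j \<in> A \<and> b j \<in> B) \<and>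
                      h = (\<lambda>(s, x). \<Sum>j<r. a j s * b j x)}) | P A Q B.
        (P, A) \<in> \<A> \<and> (Q, B) \<in> \<B>}"

type_synonym 'k polynomials = "(nat \<Rightarrow>\<^sub>0 nat) \<Rightarrow>\<^sub>0 'k"

definition peval :: "'k::comm_ring_1 polynomials \<Rightarrow> (nat \<Rightarrow> 'k) \<Rightarrow> 'k" where
  "peval f x = (\<Sum>t\<in>Poly_Mapping.keys f. Poly_Mapping.lookup f t *
     (\<Prod>s\<in>Poly_Mapping.keys t. x s ^ Poly_Mapping.lookup t s))"

definition algebraic_set :: "(nat \<Rightarrow> 'k::field) set \<Rightarrow> bool" where
  "algebraic_set S \<longleftrightarrow>
     (\<exists>d F. S = {x. (\<forall>i\<ge>d. x i = 0) \<and> (\<forall>f\<in>F. peval f x = 0)})"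

definition affine_atlas :: "(nat \<Rightarrow> 'k::field) set \<Rightarrow> (nat \<Rightarrow> 'k, 'k) atlas" where
  "affine_atlas S = {(S, range peval)}"

section \<open>The toric variety of a fan\<close>

text \<open>A point of the torus orbit of a cone \<open>\<tau>\<close> is represented by \<open>\<tau>\<close> together with the function
  sending \<open>u\<close> to the value at the point of the character \<open>\<chi>\<^sup>u\<close>, for all \<open>u\<close> in the semigroup
  \<open>\<tau>\<^sup>\<or> \<inter> M\<close> of characters regular at the point; the value is set to \<open>0\<close> for all other \<open>u\<close>. It is a
  semigroup homomorphism to \<open>(K, \<cdot>)\<close> which is nonzero precisely on \<open>\<tau>\<^sup>\<bottom> \<inter> M\<close>.\<close>

type_synonym ('n, 'k) toric_point = "(real ^ 'n) set \<times> (int ^ 'n \<Rightarrow> 'k)"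

definition dual_semigroup :: "(real ^ 'n) set \<Rightarrow> (int ^ 'n) set" where
  "dual_semigroup \<tau> = {u. \<forall>w\<in>\<tau>. 0 \<le> real_vec u \<bullet> w}"

definition perp :: "(real ^ 'n) set \<Rightarrow> (int ^ 'n) set" where
  "perp \<tau> = {u. \<forall>w\<in>\<tau>. real_vec u \<bullet> w = 0}"

definition orbit :: "(real ^ 'n) set \<Rightarrow> ('n, 'k::field) toric_point set" where
  "orbit \<tau> = {(\<tau>, x) | x. x 0 = 1 \<and>
     (\<forall>u\<in>dual_semigroup \<tau>. \<forall>u'\<in>dual_semigroup \<tau>. x (u + u') = x u * x u') \<and>
     (\<forall>u. x u \<noteq> 0 \<longleftrightarrow> u \<in> perp \<tau>)}"

definition toric_chart :: "(real ^ 'n) set set \<Rightarrow> (real ^ 'n) set \<Rightarrow>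
    ('n, 'k::field) toric_point set \<times> (('n, 'k) toric_point \<Rightarrow> 'k) set" where
  "toric_chart \<Sigma> \<sigma> =
     (\<Union>\<tau>\<in>{\<tau>\<in>\<Sigma>. \<tau> \<subseteq> \<sigma>}. orbit \<tau>,
      {f. \<exists>A c. finite A \<and> A \<subseteq> dual_semigroup \<sigma> \<and> f = (\<lambda>(\<tau>, x). \<Sum>u\<in>A. c u * x u)})"

definition toric_atlas :: "(real ^ 'n) set set \<Rightarrow> (('n, 'k::field) toric_point, 'k) atlas" where
  "toric_atlas \<Sigma> = toric_chart \<Sigma> ` \<Sigma>"

abbreviation toric_variety :: "(real ^ 'n) set set \<Rightarrow> ('n, 'k::field) toric_point set" where
  "toric_variety \<Sigma> \<equiv> points (toric_atlas \<Sigma> :: (('n, 'k) toric_point, 'k) atlas)"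

section \<open>The automorphism group\<close>

type_synonym ('n, 'k) toric_map = "('n, 'k) toric_point \<Rightarrow> ('n, 'k) toric_point"

definition Aut :: "(real ^ 'n) set set \<Rightarrow> ('n, 'k::field) toric_map monoid" where
  "Aut \<Sigma> = (BijGroup (toric_variety \<Sigma>))
     \<lparr>carrier := {\<phi> \<in> Bij (toric_variety \<Sigma>). morphism (toric_atlas \<Sigma>) (toric_atlas \<Sigma>) \<phi> \<and>
        morphism (toric_atlas \<Sigma>) (toric_atlas \<Sigma>) (inv_into (toric_variety \<Sigma>) \<phi>)}\<rparr>"

text \<open>The acting torus \<open>T = Hom(M, K\<^sup>*)\<close> as a group of automorphisms.\<close>

definition torus :: "(real ^ 'n) set set \<Rightarrow> ('n, 'k::field) toric_map set" where
  "torus \<Sigma> = {(\<lambda>(\<tau>, x)\<in>toric_variety \<Sigma>. (\<tau>, \<lambda>u. t u * x u)) | t.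
     (\<forall>u u'. t (u + u') = t u * t u') \<and> (\<forall>u. t u \<noteq> 0)}"

text \<open>The algebraic group structure. An algebraic family of automorphisms of \<open>X\<close> over an affine
  variety \<open>S\<close> is an automorphism of \<open>S \<times> X\<close> over \<open>S\<close>. The linear algebraic group \<open>Aut(X)\<close> carries the
  universal such family, i.e. the algebraic families over \<open>S\<close> are the morphisms from \<open>S\<close> to
  \<open>Aut(X)\<close>. Hence the regular functions on \<open>Aut(X)\<close> are the functions whose pullback along every
  algebraic family is regular, and the closed subsets are the zero sets of regular functions.\<close>

definition algebraic_family ::
    "(real ^ 'n) set set \<Rightarrow> (nat \<Rightarrow> 'k::field) set \<Rightarrow> ((nat \<Rightarrow> 'k) \<Rightarrow> ('n, 'k) toric_map) \<Rightarrow> bool" where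
  "algebraic_family \<Sigma> S \<phi> \<longleftrightarrow> algebraic_set S \<and> (\<forall>s\<in>S. \<phi> s \<in> carrier (Aut \<Sigma>)) \<and>
     morphism (prod_atlas (affine_atlas S) (toric_atlas \<Sigma>)) (toric_atlas \<Sigma>) (\<lambda>(s, x). \<phi> s x) \<and>
     morphism (prod_atlas (affine_atlas S) (toric_atlas \<Sigma>)) (toric_atlas \<Sigma>)
       (\<lambda>(s, x). (inv\<^bsub>Aut \<Sigma>\<^esub> (\<phi> s)) x)"

definition regular_functions_Aut ::
    "(real ^ 'n) set set \<Rightarrow> (('n, 'k::field) toric_map \<Rightarrow> 'k) set" where
  "regular_functions_Aut \<Sigma> =
     {f. \<forall>S \<phi>. algebraic_family \<Sigma> S \<phi> \<longrightarrow> (\<exists>P. \<forall>s\<in>S. f (\<phi> s) = peval P s)}"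

definition closed_in_Aut :: "(real ^ 'n) set set \<Rightarrow> ('n, 'k::field) toric_map set \<Rightarrow> bool" where
  "closed_in_Aut \<Sigma> H \<longleftrightarrow> (\<exists>F\<subseteq>regular_functions_Aut \<Sigma>.
     H = {g \<in> carrier (Aut \<Sigma>). \<forall>f\<in>F. f g = 0})"

definition algebraic_subgroup :: "(real ^ 'n) set set \<Rightarrow> ('n, 'k::field) toric_map set \<Rightarrow> bool" where
  "algebraic_subgroup \<Sigma> H \<longleftrightarrow> subgroup H (Aut \<Sigma>) \<and> closed_in_Aut \<Sigma> H"

text \<open>An element of a linear algebraic group is unipotent iff right translation by it is a locally
  unipotent operator on the coordinate algebra.\<close>

definition unipotent_element :: "(real ^ 'n) set set \<Rightarrow> ('n, 'k::field) toric_map \<Rightarrow> bool" where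
  "unipotent_element \<Sigma> g \<longleftrightarrow> g \<in> carrier (Aut \<Sigma>) \<and>
     (\<forall>f\<in>regular_functions_Aut \<Sigma>. \<exists>k. \<forall>h\<in>carrier (Aut \<Sigma>).
        ((\<lambda>F h. F (h \<otimes>\<^bsub>Aut \<Sigma>\<^esub> g) - F h) ^^ k) f h = 0)"

definition unipotent_subgroup :: "(real ^ 'n) set set \<Rightarrow> ('n, 'k::field) toric_map set \<Rightarrow> bool" where
  "unipotent_subgroup \<Sigma> H \<longleftrightarrow> algebraic_subgroup \<Sigma> H \<and> (\<forall>g\<in>H. unipotent_element \<Sigma> g)"

definition maximal_unipotent_subgroup ::
    "(real ^ 'n) set set \<Rightarrow> ('n, 'k::field) toric_map set \<Rightarrow> bool" where
  "maximal_unipotent_subgroup \<Sigma> H \<longleftrightarrow> unipotent_subgroup \<Sigma> H \<and>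
     (\<forall>H'. unipotent_subgroup \<Sigma> H' \<and> H \<subseteq> H' \<longrightarrow> H' = H)"

definition regular_subgroup :: "(real ^ 'n) set set \<Rightarrow> ('n, 'k::field) toric_map set \<Rightarrow> bool" where
  "regular_subgroup \<Sigma> H \<longleftrightarrow> algebraic_subgroup \<Sigma> H \<and>
     (\<forall>t\<in>torus \<Sigma>. (\<lambda>g. t \<otimes>\<^bsub>Aut \<Sigma>\<^esub> g \<otimes>\<^bsub>Aut \<Sigma>\<^esub> inv\<^bsub>Aut \<Sigma>\<^esub> t) ` H = H)"

definition radiant :: "'k::field itself \<Rightarrow> (real ^ 'n) set set \<Rightarrow> bool" where
  "radiant _ \<Sigma> \<longleftrightarrow> (\<exists>H :: ('n, 'k) toric_map set. maximal_unipotent_subgroup \<Sigma> H \<and>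
     (\<exists>x\<in>toric_variety \<Sigma>. zariski_open (toric_atlas \<Sigma>) {\<phi> x | \<phi>. \<phi> \<in> H}))"

section \<open>Demazure roots and root subgroups\<close>

text \<open>The primitive ray generators are numbered \<open>p 1, \<dots>, p m\<close>.\<close>

definition roots_at :: "nat \<Rightarrow> (nat \<Rightarrow> int ^ 'n) \<Rightarrow> nat \<Rightarrow> (int ^ 'n) set" where
  "roots_at m p i = {e. pairing e (p i) = -1 \<and> (\<forall>s\<in>{1..m} - {i}. pairing e (p s) \<ge> 0)}"

definition roots :: "nat \<Rightarrow> (nat \<Rightarrow> int ^ 'n) \<Rightarrow> (int ^ 'n) set" where
  "roots m p = (\<Union>i\<in>{1..m}. roots_at m p i)"

definition semisimple_roots :: "nat \<Rightarrow> (nat \<Rightarrow> int ^ 'n) \<Rightarrow> (int ^ 'n) set" where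
  "semisimple_roots m p = roots m p \<inter> uminus ` roots m p"

definition unipotent_roots :: "nat \<Rightarrow> (nat \<Rightarrow> int ^ 'n) \<Rightarrow> (int ^ 'n) set" where
  "unipotent_roots m p = roots m p - semisimple_roots m p"

text \<open>The Cox ring is the subring of \<open>'k polynomials\<close> in the variables with indices \<open>1, \<dots>, m\<close>.\<close>

definition Var :: "nat \<Rightarrow> 'k::field polynomials" where
  "Var s = Poly_Mapping.single (Poly_Mapping.single s 1) 1"

definition partial_deriv :: "nat \<Rightarrow> 'k::field polynomials \<Rightarrow> 'k polynomials" where
  "partial_deriv i f = (\<Sum>t\<in>Poly_Mapping.keys f. Poly_Mapping.single (t - Poly_Mapping.single i 1)
     (of_nat (Poly_Mapping.lookup t i) * Poly_Mapping.lookup f t))"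

definition root_derivation ::
    "nat \<Rightarrow> (nat \<Rightarrow> int ^ 'n) \<Rightarrow> nat \<Rightarrow> int ^ 'n \<Rightarrow> 'k::field polynomials \<Rightarrow> 'k polynomials" where
  "root_derivation m p i e f =
     (\<Prod>s\<in>{1..m} - {i}. Var s ^ nat (pairing e (p s))) * partial_deriv i f"

definition exp_derivation ::
    "'k::field_char_0 \<Rightarrow> ('k polynomials \<Rightarrow> 'k polynomials) \<Rightarrow> 'k polynomials \<Rightarrow> 'k polynomials" where
  "exp_derivation \<alpha> D f =
     (\<Sum>k | (D ^^ k) f \<noteq> 0. Poly_Mapping.single 0 (\<alpha> ^ k / fact k) * (D ^^ k) f)"

text \<open>The self-map of affine \<open>m\<close>-space with comorphism \<open>exp (\<alpha> \<partial>\<^sub>e)\<close>.\<close>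

definition root_action :: "nat \<Rightarrow> (nat \<Rightarrow> int ^ 'n) \<Rightarrow> nat \<Rightarrow> int ^ 'n \<Rightarrow> 'k::field_char_0 \<Rightarrow>
    (nat \<Rightarrow> 'k) \<Rightarrow> nat \<Rightarrow> 'k" where
  "root_action m p i e \<alpha> x = (\<lambda>s. peval (exp_derivation \<alpha> (root_derivation m p i e) (Var s)) x)"

text \<open>The complement in affine \<open>m\<close>-space of the zero set of the irrelevant ideal, which is generated
  by the monomials \<open>\<Prod>s | p s \<notin> \<sigma>. x s\<close> for \<open>\<sigma>\<close> in the fan.\<close>

definition cox_space ::
    "(real ^ 'n) set set \<Rightarrow> nat \<Rightarrow> (nat \<Rightarrow> int ^ 'n) \<Rightarrow> (nat \<Rightarrow> 'k::field) set" where
  "cox_space \<Sigma> m p = {x. (\<forall>s. s \<notin> {1..m} \<longrightarrow> x s = 0) \<and>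
     (\<exists>\<sigma>\<in>\<Sigma>. \<forall>s\<in>{1..m}. x s = 0 \<longrightarrow> real_vec (p s) \<in> \<sigma>)}"

text \<open>The Cox quotient morphism, given on characters by \<open>\<chi>\<^sup>u \<mapsto> \<Prod>s. x s powi \<langle>u, p s\<rangle>\<close>. The point
  \<open>x\<close> is sent to the orbit of the smallest cone containing all \<open>p s\<close> with \<open>x s = 0\<close>; note that
  \<open>0 powi 0 = 1\<close>, and that a negative exponent of \<open>x s = 0\<close> does not occur for \<open>u\<close> in the dual
  semigroup of that cone.\<close>

definition cox_quotient :: "(real ^ 'n) set set \<Rightarrow> nat \<Rightarrow> (nat \<Rightarrow> int ^ 'n) \<Rightarrow>
    (nat \<Rightarrow> 'k::field) \<Rightarrow> ('n, 'k) toric_point" where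
  "cox_quotient \<Sigma> m p x =
     (let \<tau> = \<Inter>{\<sigma>\<in>\<Sigma>. \<forall>s\<in>{1..m}. x s = 0 \<longrightarrow> real_vec (p s) \<in> \<sigma>}
      in (\<tau>, \<lambda>u. if u \<in> dual_semigroup \<tau> then \<Prod>s\<in>{1..m}. x s powi pairing u (p s) else 0))"

definition root_subgroup :: "(real ^ 'n) set set \<Rightarrow> nat \<Rightarrow> (nat \<Rightarrow> int ^ 'n) \<Rightarrow> int ^ 'n \<Rightarrow>
    ('n, 'k::field_char_0) toric_map set" where
  "root_subgroup \<Sigma> m p e = {\<phi> \<in> carrier (Aut \<Sigma>). \<exists>i\<in>{1..m}. e \<in> roots_at m p i \<and>
     (\<exists>\<alpha>. \<forall>x\<in>cox_space \<Sigma> m p.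
        \<phi> (cox_quotient \<Sigma> m p x) = cox_quotient \<Sigma> m p (root_action m p i e \<alpha> x))}"

definition generated_by_roots :: "(real ^ 'n) set set \<Rightarrow> nat \<Rightarrow> (nat \<Rightarrow> int ^ 'n) \<Rightarrow>
    (int ^ 'n) set \<Rightarrow> ('n, 'k::field_char_0) toric_map set" where
  "generated_by_roots \<Sigma> m p E = generate (Aut \<Sigma>) (\<Union>e\<in>E. root_subgroup \<Sigma> m p e)"

definition roots_of_subgroup :: "(real ^ 'n) set set \<Rightarrow> nat \<Rightarrow> (nat \<Rightarrow> int ^ 'n) \<Rightarrow>
    ('n, 'k::field_char_0) toric_map set \<Rightarrow> (int ^ 'n) set" where
  "roots_of_subgroup \<Sigma> m p U = {e \<in> roots m p. root_subgroup \<Sigma> m p e \<subseteq> U}"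

section \<open>Bilateral fans and the maximal unipotent subgroup\<close>

definition lattice_basis :: "nat \<Rightarrow> (nat \<Rightarrow> int ^ 'n) \<Rightarrow> bool" where
  "lattice_basis n p \<longleftrightarrow>
     bij_betw (\<lambda>c :: nat \<Rightarrow> int. \<Sum>j=1..n. c j *s p j) ({1..n} \<rightarrow>\<^sub>E UNIV) UNIV"

definition dual_basis :: "nat \<Rightarrow> (nat \<Rightarrow> int ^ 'n) \<Rightarrow> (nat \<Rightarrow> int ^ 'n) \<Rightarrow> bool" where
  "dual_basis n p q \<longleftrightarrow>
     (\<forall>i\<in>{1..n}. \<forall>j\<in>{1..n}. pairing (q i) (p j) = (if i = j then 1 else 0))"

definition bilateral_numbering ::
    "(real ^ 'n) set set \<Rightarrow> nat \<Rightarrow> nat \<Rightarrow> (nat \<Rightarrow> int ^ 'n) \<Rightarrow> (nat \<Rightarrow> nat \<Rightarrow> nat) \<Rightarrow> bool" where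
  "bilateral_numbering \<Sigma> n m p a \<longleftrightarrow>
     n \<le> m \<and> bij_betw p {1..m} (ray_generators \<Sigma>) \<and> lattice_basis n p \<and>
     (\<forall>k\<in>{n<..m}. p k = - (\<Sum>j=1..n. int (a k j) *s p j))"

definition preord :: "nat \<Rightarrow> nat \<Rightarrow> (nat \<Rightarrow> nat \<Rightarrow> nat) \<Rightarrow> nat \<Rightarrow> nat \<Rightarrow> bool" where
  "preord n m a i j \<longleftrightarrow> (\<forall>k\<in>{n<..m}. a k i \<ge> a k j)"

definition preord_equiv :: "nat \<Rightarrow> nat \<Rightarrow> (nat \<Rightarrow> nat \<Rightarrow> nat) \<Rightarrow> nat \<Rightarrow> nat \<Rightarrow> bool" where
  "preord_equiv n m a i j \<longleftrightarrow> (\<forall>k\<in>{n<..m}. a k i = a k j)"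

text \<open>The equivalence classes are the blocks \<open>{c (s - 1)<..c s}\<close>, \<open>1 \<le> s \<le> r\<close>, and their numbering
  refines the reverse of the partial order on them.\<close>

definition ordered_classes ::
    "nat \<Rightarrow> nat \<Rightarrow> (nat \<Rightarrow> nat \<Rightarrow> nat) \<Rightarrow> nat \<Rightarrow> (nat \<Rightarrow> nat) \<Rightarrow> bool" where
  "ordered_classes n m a r c \<longleftrightarrow>
     c 0 = 0 \<and> c r = n \<and> (\<forall>s<r. c s < c (Suc s)) \<and>
     (\<forall>l\<in>{1..r}. \<forall>s\<in>{1..r}. \<forall>i\<in>{c (l - 1)<..c l}. \<forall>j\<in>{c (s - 1)<..c s}.
        (preord_equiv n m a i j \<longleftrightarrow> l = s) \<and>
        (preord n m a i j \<and> \<not> preord_equiv n m a i j \<longrightarrow> l < s))"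

definition positive_roots :: "nat \<Rightarrow> (nat \<Rightarrow> int ^ 'n) \<Rightarrow> int ^ 'n \<Rightarrow> (int ^ 'n) set" where
  "positive_roots m p v = {e \<in> semisimple_roots m p. pairing e v > 0} \<union> unipotent_roots m p"

definition U_max :: "(real ^ 'n) set set \<Rightarrow> nat \<Rightarrow> (nat \<Rightarrow> int ^ 'n) \<Rightarrow> int ^ 'n \<Rightarrow>
    ('n, 'k::field_char_0) toric_map set" where
  "U_max \<Sigma> m p v = generated_by_roots \<Sigma> m p (positive_roots m p v)"

section \<open>The graph of a set of roots\<close>

definition arrow :: "(int ^ 'n) set \<Rightarrow> int ^ 'n \<Rightarrow> int ^ 'n \<Rightarrow> bool" where
  "arrow E a b \<longleftrightarrow> a \<in> E \<and> b \<in> E \<and> (\<exists>e\<in>E. b = a + e)"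

definition path_of_length :: "(int ^ 'n) set \<Rightarrow> nat \<Rightarrow> (int ^ 'n) list \<Rightarrow> bool" where
  "path_of_length E k vs \<longleftrightarrow> length vs = Suc k \<and> set vs \<subseteq> E \<and> successively (arrow E) vs"

definition up :: "(int ^ 'n) set \<Rightarrow> nat \<Rightarrow> (int ^ 'n) set" where
  "up E k = {b \<in> E. \<exists>vs. path_of_length E k vs \<and> last vs = b}"

definition down :: "(int ^ 'n) set \<Rightarrow> nat \<Rightarrow> (int ^ 'n) set" where
  "down E k = {a \<in> E. \<forall>j vs. path_of_length E j vs \<and> hd vs = a \<longrightarrow> j < k}"

text \<open>The empty graph has no paths at all; by convention its longest path has length \<open>-1\<close>.\<close>

definition longest_path_length :: "(int ^ 'n) set \<Rightarrow> int" where
  "longest_path_length E = Max (insert (-1) {int k | k. \<exists>vs. path_of_length E k vs})"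

section \<open>Central series\<close>

definition commutator :: "('a, 'b) monoid_scheme \<Rightarrow> 'a \<Rightarrow> 'a \<Rightarrow> 'a" where
  "commutator G g h = g \<otimes>\<^bsub>G\<^esub> h \<otimes>\<^bsub>G\<^esub> inv\<^bsub>G\<^esub> g \<otimes>\<^bsub>G\<^esub> inv\<^bsub>G\<^esub> h"

fun lower_central :: "('a, 'b) monoid_scheme \<Rightarrow> 'a set \<Rightarrow> nat \<Rightarrow> 'a set" where
  "lower_central G U 0 = U"
| "lower_central G U (Suc k) =
     generate G {commutator G g h | g h. g \<in> U \<and> h \<in> lower_central G U k}"

fun upper_central :: "('a, 'b) monoid_scheme \<Rightarrow> 'a set \<Rightarrow> nat \<Rightarrow> 'a set" where
  "upper_central G U 0 = {\<one>\<^bsub>G\<^esub>}"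
| "upper_central G U (Suc k) =
     {g \<in> U. \<forall>h\<in>U. commutator G g h \<in> upper_central G U k}"

end

theory Submission
  imports Defs
begin

text \<open>The group \<open>U_max\<close> behaves like a group of unitriangular matrices. Its roots are the vectors
  \<open>e = - q i + (\<Sum>j>i. b j * q j)\<close> with \<open>b j \<ge> 0\<close> and nonnegative values on the remaining rays
  (\<open>positive_roots_eq\<close>), and on the open cell on which the Cox coordinates \<open>y k\<close>, \<open>k > n\<close>, are
  \<open>1\<close> the element \<open>x e s\<close> of the root subgroup of \<open>e\<close> acts by adding \<open>s\<close> times the monomial with
  exponents \<open>b\<close> to the coordinate \<open>y i\<close>. There is a linear weight which is positive and injective on
  these roots, namely a base \<open>B\<close> expansion with large \<open>B\<close>. The commutator of \<open>x e s\<close> and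
  \<open>x f t\<close> is trivial if \<open>e + f\<close> is not a root; otherwise it is \<open>x (e + f) (\<kappa> s t)\<close> with an
  integer \<open>\<kappa> \<noteq> 0\<close>, up to factors from roots \<open>e + r f\<close> or \<open>f + r e\<close>, \<open>r \<ge> 2\<close>, of larger weight. As
  the weight is injective, every nontrivial element has a leading term: it is \<open>x e s\<close> with
  \<open>s \<noteq> 0\<close> times a product over roots of larger weight, and \<open>e\<close> and \<open>s\<close> are unique.

  A subgroup \<open>U\<close> of \<open>U_max\<close> which is normalized by the torus is generated by the root subgroups that
  it contains (\<open>torus_stable_subgroup\<close>). If \<open>u = x e s * h\<close> with \<open>h\<close> of larger weight, then an element \<open>t\<close>
  of the torus that centralizes the root subgroup of \<open>e\<close>, but not that of the leading root \<open>f\<close> of \<open>h\<close>,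
  produces the element \<open>inverse u * (t u inverse t)\<close> of \<open>U\<close> with leading root \<open>f\<close>. Inductively
  the root subgroup of \<open>f\<close> lies in \<open>U\<close>, hence the factor at \<open>f\<close> can be split off, and after finitely many steps
  only \<open>x e s\<close> is left. So \<open>U\<close> is generated by the root subgroups of a set \<open>E\<close> of roots which is closed
  under sums that are roots. The sets \<open>up E k\<close> and \<open>down E k\<close> are ideals of \<open>E\<close>, and
  the groups that they generate are the terms of the two central series: commutators of generators lie
  in the next group because arrows of the graph are additions of roots, and the reverse inclusions follow
  from the leading terms of commutators (\<open>lower_central_eq\<close>, \<open>upper_central_eq\<close>).

  These arguments need the root subgroups in full, that is, every exponential of a root
  derivation has to descend from the Cox space to an automorphism of the variety. In terms of characters the
  action is \<open>\<chi>\<^sup>u \<mapsto> \<chi>\<^sup>u (1 + \<alpha> \<chi>\<^sup>e) ^ \<langle>u, p i\<rangle>\<close>, and \<open>root_action_locally_monomial\<close> expands this on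
  suitable charts as a quotient of regular functions. Two facts about fans enter: a cone of the fan is
  generated by the rays of the fan that it contains (\<open>cone_generated\<close>), and if the root \<open>e\<close> at \<open>p i\<close> vanishes on
  a cone of the fan, then this cone and \<open>p i\<close> together span a cone of the fan (\<open>root_extension\<close>). As the field
  is algebraically closed, the Cox quotient is surjective (\<open>quot_surj\<close>), so an automorphism is determined by
  a lift to the Cox space and all relations can be checked for maps of the Cox space.\<close>

section \<open>Groups generated by root elements\<close>

text \<open>The roots that can occur in a commutator of root elements for \<open>e\<close> and \<open>f\<close>: those reached from
  \<open>e + f\<close> by adding \<open>e\<close> or \<open>f\<close> repeatedly without leaving the set of roots. Requiring all intermediate sums to be
  roots makes every set that absorbs \<open>e\<close> and \<open>f\<close> and contains \<open>e + f\<close> contain all of them.\<close>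

inductive_set sums_above :: "(int ^ 'n) set \<Rightarrow> int ^ 'n \<Rightarrow> int ^ 'n \<Rightarrow> (int ^ 'n) set"
  for R e f where
  base: "e + f \<in> R \<Longrightarrow> e + f \<in> sums_above R e f"
| left: "g \<in> sums_above R e f \<Longrightarrow> g + e \<in> R \<Longrightarrow> g + e \<in> sums_above R e f"
| right: "g \<in> sums_above R e f \<Longrightarrow> g + f \<in> R \<Longrightarrow> g + f \<in> sums_above R e f"

lemma sums_above_subset: "g \<in> sums_above R e f \<Longrightarrow> g \<in> R"
  by (induction rule: sums_above.induct) auto

definition sum_closed :: "(int ^ 'n) set \<Rightarrow> (int ^ 'n) set \<Rightarrow> bool" where
  "sum_closed R S \<longleftrightarrow> S \<subseteq> R \<and> (\<forall>e\<in>S. \<forall>f\<in>S. e + f \<in> R \<longrightarrow> e + f \<in> S)"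

definition root_ideal :: "(int ^ 'n) set \<Rightarrow> (int ^ 'n) set \<Rightarrow> (int ^ 'n) set \<Rightarrow> bool" where
  "root_ideal R S I \<longleftrightarrow> I \<subseteq> S \<and> (\<forall>e\<in>I. \<forall>f\<in>S. e + f \<in> R \<longrightarrow> e + f \<in> I)"

lemma root_ideal_sum_closed: "sum_closed R S \<Longrightarrow> root_ideal R S I \<Longrightarrow> sum_closed R I"
  unfolding sum_closed_def root_ideal_def by blast

lemma root_ideal_self: "sum_closed R S \<Longrightarrow> root_ideal R S S"
  unfolding sum_closed_def root_ideal_def by blast

lemma sums_above_ideal:
  assumes "root_ideal R S I" "e \<in> S" "f \<in> S" "e + f \<in> R \<Longrightarrow> e + f \<in> I"
  shows "sums_above R e f \<subseteq> I"
proof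
  fix g assume "g \<in> sums_above R e f" then show "g \<in> I"
    by (induction rule: sums_above.induct) (use assms in \<open>auto simp: root_ideal_def\<close>)
qed

text \<open>An abstract unipotent group with its root elements. The only quantitative information about commutators is
  that the factor at \<open>e + f\<close> is bilinear with a nonzero coefficient; the last assumption says that
  root elements are independent modulo roots of larger weight.\<close>

locale root_group = group G for G :: "('a, 'b) monoid_scheme" (structure) +
  fixes R :: "(int ^ 'n) set" and w :: "int ^ 'n \<Rightarrow> int" and x :: "int ^ 'n \<Rightarrow> 'k::field \<Rightarrow> 'a"
  assumes finite_R: "finite R"
    and w_add: "w (e + f) = w e + w f"
    and w_pos: "e \<in> R \<Longrightarrow> 0 < w e"
    and w_inj: "inj_on w R"
    and x_closed: "e \<in> R \<Longrightarrow> x e s \<in> carrier G"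
    and x_add: "e \<in> R \<Longrightarrow> x e (s + t) = x e s \<otimes> x e t"
    and x_commute: "e \<in> R \<Longrightarrow> f \<in> R \<Longrightarrow> e + f \<notin> R \<Longrightarrow> x e s \<otimes> x f t = x f t \<otimes> x e s"
    and x_commutator: "e \<in> R \<Longrightarrow> f \<in> R \<Longrightarrow> e + f \<in> R \<Longrightarrow>
       \<exists>\<kappa>. \<kappa> \<noteq> 0 \<and> (\<forall>s t. \<exists>z \<in> generate G {x g u | g u. g \<in> sums_above R e f - {e + f}}.
          commutator G (x e s) (x f t) = x (e + f) (\<kappa> * s * t) \<otimes> z)"
    and x_indep: "e \<in> R \<Longrightarrow> x e s \<in> generate G {x g u | g u. g \<in> R \<and> w g > w e} \<Longrightarrow> s = 0"
begin

definition root_span :: "(int ^ 'n) set \<Rightarrow> 'a set" where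
  "root_span S = generate G {x e s | e s. e \<in> S}"

lemma x_in_root_span: "e \<in> S \<Longrightarrow> x e s \<in> root_span S"
  unfolding root_span_def by (rule generate.incl) auto

lemma root_span_subgroup: "S \<subseteq> R \<Longrightarrow> subgroup (root_span S) G"
  unfolding root_span_def by (rule generate_is_subgroup) (use x_closed in auto)

lemma root_span_closed: "S \<subseteq> R \<Longrightarrow> g \<in> root_span S \<Longrightarrow> g \<in> carrier G"
  by (rule subgroup.mem_carrier[OF root_span_subgroup])

lemma root_span_mono: "S \<subseteq> S' \<Longrightarrow> root_span S \<subseteq> root_span S'"
  unfolding root_span_def by (rule mono_generate) auto

lemma root_span_mult: "g \<in> root_span S \<Longrightarrow> h \<in> root_span S \<Longrightarrow> g \<otimes> h \<in> root_span S"
  unfolding root_span_def by (rule generate.eng)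

lemma root_span_one: "\<one> \<in> root_span S"
  unfolding root_span_def by (rule generate.one)

lemma root_span_inv: "S \<subseteq> R \<Longrightarrow> g \<in> root_span S \<Longrightarrow> inv g \<in> root_span S"
  by (rule subgroup.m_inv_closed[OF root_span_subgroup])

lemma root_span_empty: "root_span {} = {\<one>}"
  unfolding root_span_def by (simp add: generate_empty)

lemma x_0: "e \<in> R \<Longrightarrow> x e 0 = \<one>"
  using l_cancel_one'[of "x e 0" "x e 0"] x_add[of e 0 0, symmetric] x_closed[of e 0] by simp

lemma x_minus: "e \<in> R \<Longrightarrow> inv (x e s) = x e (- s)"
  by (rule inv_equality) (use x_add[of e "- s" s, symmetric] x_closed x_0 in auto)

lemma root_span_induct [consumes 2, case_names root one mult]:
  assumes "g \<in> root_span S" "S \<subseteq> R"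
    and "\<And>e s. e \<in> S \<Longrightarrow> P (x e s)"
    and "P \<one>"
    and "\<And>g h. g \<in> root_span S \<Longrightarrow> h \<in> root_span S \<Longrightarrow> P g \<Longrightarrow> P h \<Longrightarrow> P (g \<otimes> h)"
  shows "P g"
  using assms(1)[unfolded root_span_def]
proof (induction rule: generate.induct)
  case one then show ?case using assms(4) .
next
  case (incl h) then show ?case using assms(3) by auto
next
  case (inv h)
  then obtain e s where "h = x e s" "e \<in> S" by auto
  then show ?case using assms(2,3) x_minus by auto
next
  case (eng h1 h2) then show ?case using assms(5) by (auto simp: root_span_def)
qed

lemma root_span_least: "S \<subseteq> R \<Longrightarrow> subgroup H G \<Longrightarrow> (\<And>e s. e \<in> S \<Longrightarrow> x e s \<in> H) \<Longrightarrow> root_span S \<subseteq> H"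
  unfolding root_span_def by (rule generate_subgroup_incl) auto

lemma sums_above_weight:
  "g \<in> sums_above R e f \<Longrightarrow> e \<in> R \<Longrightarrow> f \<in> R \<Longrightarrow> g = e + f \<or> w (e + f) < w g"
proof (induction rule: sums_above.induct)
  case (left g) then show ?case using w_pos[of e] by (auto simp: w_add)
next
  case (right g) then show ?case using w_pos[of f] by (auto simp: w_add)
qed auto

lemma x_commutator_in:
  assumes "root_ideal R S I" "S \<subseteq> R" "e \<in> S" "f \<in> S" "e + f \<in> R \<Longrightarrow> e + f \<in> I"
  shows "commutator G (x e s) (x f t) \<in> root_span I"
proof (cases "e + f \<in> R")
  case False
  have [simp]: "x e s \<in> carrier G" "x f t \<in> carrier G" using assms x_closed by auto
  have "commutator G (x e s) (x f t) = \<one>"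
    unfolding commutator_def using x_commute[of e f s t] False assms
    by (simp add: m_assoc inv_solve_right' subset_iff)
  then show ?thesis using root_span_one by simp
next
  case True
  obtain \<kappa> z where z: "z \<in> root_span (sums_above R e f - {e + f})"
    and eq: "commutator G (x e s) (x f t) = x (e + f) (\<kappa> * s * t) \<otimes> z"
    using x_commutator[of e f] True assms unfolding root_span_def by blast
  have "sums_above R e f \<subseteq> I" by (rule sums_above_ideal[OF assms(1)]) (use assms in auto)
  then have "z \<in> root_span I" using z root_span_mono[of "sums_above R e f - {e + f}" I] by blast
  then show ?thesis unfolding eq using x_in_root_span[of "e + f" I] assms(5)[OF True] root_span_mult by blast
qed

lemma conj_eq_commutator:
  "g \<in> carrier G \<Longrightarrow> h \<in> carrier G \<Longrightarrow> g \<otimes> h \<otimes> inv g = commutator G g h \<otimes> h"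
  unfolding commutator_def by (simp add: m_assoc)

lemma inv_mult_cancel:
  "g \<in> carrier G \<Longrightarrow> h \<in> carrier G \<Longrightarrow> inv g \<otimes> (g \<otimes> h) = h"
  "g \<in> carrier G \<Longrightarrow> h \<in> carrier G \<Longrightarrow> g \<otimes> (inv g \<otimes> h) = h"
  by (simp_all flip: m_assoc)

lemma conj_mult: "g \<in> carrier G \<Longrightarrow> h \<in> carrier G \<Longrightarrow> k \<in> carrier G \<Longrightarrow>
  g \<otimes> (h \<otimes> k) \<otimes> inv g = (g \<otimes> h \<otimes> inv g) \<otimes> (g \<otimes> k \<otimes> inv g)"
  by (simp add: m_assoc inv_mult_cancel)

text \<open>Conjugating a root element changes it by a commutator, whose roots stay in the ideal.\<close>

lemma root_span_ideal_normal:
  assumes S: "sum_closed R S" and I: "root_ideal R S I" and g: "g \<in> root_span S" and h: "h \<in> root_span I"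
  shows "g \<otimes> h \<otimes> inv g \<in> root_span I"
proof -
  have SR: "S \<subseteq> R" "I \<subseteq> R" "I \<subseteq> S" using S I by (auto simp: sum_closed_def root_ideal_def)
  have I': "\<And>f e. f \<in> S \<Longrightarrow> e \<in> I \<Longrightarrow> f + e \<in> R \<Longrightarrow> f + e \<in> I"
    using I unfolding root_ideal_def by (metis add.commute)
  have gen: "x f t \<otimes> h \<otimes> inv (x f t) \<in> root_span I" if "f \<in> S" "h \<in> root_span I" for f t h
    using that(2) SR(2)
  proof (induction rule: root_span_induct)
    case (root e s)
    have "commutator G (x f t) (x e s) \<in> root_span I"
      using x_commutator_in[OF I SR(1) that(1), of e] root SR I'[OF that(1)] by auto
    then show ?case using conj_eq_commutator[of "x f t" "x e s"] x_closed root that SR x_in_root_span[OF root]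
      by (auto intro: root_span_mult simp: subset_iff)
  next
    case one
    then show ?case using x_closed that SR root_span_one by auto
  next
    case (mult g h)
    then show ?case using conj_mult[of "x f t" g h] root_span_closed[OF SR(2)] x_closed that SR root_span_mult
      by auto
  qed
  have "\<forall>h\<in>root_span I. g \<otimes> h \<otimes> inv g \<in> root_span I"
    using g SR(1)
  proof (induction rule: root_span_induct)
    case (root e s) then show ?case using gen by auto
  next
    case one then show ?case using root_span_closed[OF SR(2)] by auto
  next
    case (mult g1 g2)
    show ?case
    proof
      fix h assume h: "h \<in> root_span I"
      have "g1 \<otimes> g2 \<otimes> h \<otimes> inv (g1 \<otimes> g2) = g1 \<otimes> (g2 \<otimes> h \<otimes> inv g2) \<otimes> inv g1"
        using mult(1,2) h root_span_closed SR by (simp add: m_assoc inv_mult_group)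
      then show "g1 \<otimes> g2 \<otimes> h \<otimes> inv (g1 \<otimes> g2) \<in> root_span I" using mult h by auto
    qed
  qed
  then show ?thesis using h by blast
qed

lemma commutator_mult_right: "g \<in> carrier G \<Longrightarrow> h \<in> carrier G \<Longrightarrow> k \<in> carrier G \<Longrightarrow>
  commutator G g (h \<otimes> k) = commutator G g h \<otimes> (h \<otimes> commutator G g k \<otimes> inv h)"
  unfolding commutator_def by (simp add: m_assoc inv_mult_group inv_mult_cancel)

lemma commutator_mult_left: "g \<in> carrier G \<Longrightarrow> h \<in> carrier G \<Longrightarrow> k \<in> carrier G \<Longrightarrow>
  commutator G (g \<otimes> h) k = (g \<otimes> commutator G h k \<otimes> inv g) \<otimes> commutator G g k"
  unfolding commutator_def by (simp add: m_assoc inv_mult_group inv_mult_cancel)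

text \<open>Commutators of generators determine all commutators modulo a normal subgroup, by the identities that
  express \<open>[g, h k]\<close> and \<open>[g h, k]\<close> through conjugates.\<close>

lemma commutator_in_root_span:
  assumes S: "sum_closed R S" and J: "root_ideal R S J" and sub: "S1 \<subseteq> S" "S2 \<subseteq> S"
    and sums: "\<And>e f. e \<in> S1 \<Longrightarrow> f \<in> S2 \<Longrightarrow> e + f \<in> R \<Longrightarrow> e + f \<in> J"
    and g: "g \<in> root_span S1" and h: "h \<in> root_span S2"
  shows "commutator G g h \<in> root_span J"
proof -
  have SR: "S \<subseteq> R" "S1 \<subseteq> R" "S2 \<subseteq> R" "J \<subseteq> R" using S J sub by (auto simp: sum_closed_def root_ideal_def)
  have c[simp]: "\<And>g. g \<in> root_span S1 \<Longrightarrow> g \<in> carrier G" "\<And>g. g \<in> root_span S2 \<Longrightarrow> g \<in> carrier G"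
    using root_span_closed SR by auto
  have VS: "root_span S1 \<subseteq> root_span S" "root_span S2 \<subseteq> root_span S" using sub root_span_mono by auto
  have gen: "commutator G (x e s) h \<in> root_span J" if e: "e \<in> S1" and h: "h \<in> root_span S2" for e s h
    using h SR(3)
  proof (induction rule: root_span_induct)
    case (root f t)
    then show ?case using x_commutator_in[OF J SR(1), of e f s t] sums[OF e, of f] e sub by auto
  next
    case one
    then show ?case using x_closed e SR root_span_one by (auto simp: commutator_def)
  next
    case (mult g h)
    have "g \<otimes> commutator G (x e s) h \<otimes> inv g \<in> root_span J"
      using root_span_ideal_normal[OF S J] mult VS by auto
    then show ?case using mult x_closed e SR root_span_mult by (auto simp: commutator_mult_right)
  qed
  show ?thesis using g SR(2)
  proof (induction rule: root_span_induct)
    case (root e s) then show ?case using gen h by auto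
  next
    case one then show ?case using root_span_one h by (auto simp: commutator_def)
  next
    case (mult g1 g2)
    have "g1 \<otimes> commutator G g2 h \<otimes> inv g1 \<in> root_span J"
      using root_span_ideal_normal[OF S J] mult VS by auto
    then show ?case using mult h root_span_mult by (auto simp: commutator_mult_left)
  qed
qed

section \<open>Leading terms\<close>

definition R_above :: "int \<Rightarrow> (int ^ 'n) set" where
  "R_above d = {f \<in> R. d < w f}"

lemma R_above_subset: "R_above d \<subseteq> R" by (auto simp: R_above_def)

lemma above_ideal: "sum_closed R S \<Longrightarrow> root_ideal R S {f \<in> S. d < w f}"
  unfolding sum_closed_def root_ideal_def using w_pos by (fastforce simp: w_add)

lemma R_closed: "sum_closed R R" by (simp add: sum_closed_def)

lemma R_above_ideal: "root_ideal R R (R_above d)"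
  unfolding R_above_def by (rule above_ideal[OF R_closed])

text \<open>The root of least weight is a sum of no two roots of \<open>S\<close>; the others form an ideal, so the factors
  belonging to it can be collected on the left.\<close>

lemma lowest_root_factor:
  assumes S: "sum_closed R S" and e: "e \<in> S" "\<And>f. f \<in> S \<Longrightarrow> w e \<le> w f" and g: "g \<in> root_span S"
  shows "\<exists>s. \<exists>h\<in>root_span {f \<in> S. w e < w f}. g = x e s \<otimes> h"
proof -
  let ?S = "{f \<in> S. w e < w f}"
  have SR: "S \<subseteq> R" "?S \<subseteq> R" using S by (auto simp: sum_closed_def)
  have I: "root_ideal R S ?S" using above_ideal[OF S] .
  have c: "\<And>h. h \<in> root_span ?S \<Longrightarrow> h \<in> carrier G" using root_span_closed SR by auto
  have xc: "\<And>s. x e s \<in> carrier G" using x_closed e SR by auto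
  show ?thesis using g SR(1)
  proof (induction rule: root_span_induct)
    case (root f s)
    show ?case
    proof (cases "f = e")
      case True
      then show ?thesis using root_span_one[of ?S] xc by (metis r_one)
    next
      case False
      then have "w e < w f" using e root SR w_inj by (metis inj_on_def order_le_less subset_iff)
      then have "x f s \<in> root_span ?S" using root by (intro x_in_root_span) auto
      then show ?thesis using x_0 e SR c by (metis l_one subset_iff)
    qed
  next
    case one
    then show ?case using root_span_one[of ?S] x_0 e SR by (metis l_one one_closed subset_iff)
  next
    case (mult g1 g2)
    then obtain s1 h1 s2 h2 where h: "h1 \<in> root_span ?S" "h2 \<in> root_span ?S" "g1 = x e s1 \<otimes> h1" "g2 = x e s2 \<otimes> h2"
      by blast
    have "inv (x e s2) \<in> root_span S" using x_in_root_span[OF e(1)] SR root_span_inv by auto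
    then have "inv (x e s2) \<otimes> h1 \<otimes> inv (inv (x e s2)) \<in> root_span ?S"
      using root_span_ideal_normal[OF S I] h by blast
    then have "(inv (x e s2) \<otimes> h1 \<otimes> x e s2) \<otimes> h2 \<in> root_span ?S" using h root_span_mult xc by auto
    moreover have "g1 \<otimes> g2 = x e (s1 + s2) \<otimes> ((inv (x e s2) \<otimes> h1 \<otimes> x e s2) \<otimes> h2)"
      using h c xc x_add[of e s1 s2] e SR by (auto simp: m_assoc inv_mult_cancel)
    ultimately show ?case by blast
  qed
qed

lemma leading_term:
  assumes S: "sum_closed R S" and g: "g \<in> root_span S" "g \<noteq> \<one>"
  shows "\<exists>e\<in>S. \<exists>s. s \<noteq> 0 \<and> (\<exists>h\<in>root_span {f \<in> S. w e < w f}. g = x e s \<otimes> h)"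
  using assms
proof (induction "card S" arbitrary: S rule: less_induct)
  case (less S)
  have SR: "S \<subseteq> R" "finite S" using less.prems finite_R finite_subset by (auto simp: sum_closed_def)
  have "S \<noteq> {}" using less.prems root_span_empty by auto
  then obtain e where e: "e \<in> S" "\<And>f. f \<in> S \<Longrightarrow> w e \<le> w f"
    using SR(2) by (metis arg_min_if_finite(1) arg_min_least)
  let ?S = "{f \<in> S. w e < w f}"
  obtain s h where h: "h \<in> root_span ?S" "g = x e s \<otimes> h" using lowest_root_factor[OF less.prems(1) e less.prems(2)] by blast
  show ?case
  proof (cases "s = 0")
    case False then show ?thesis using h e by blast
  next
    case True
    have hc: "h \<in> carrier G" using root_span_closed[of ?S h] h SR by auto
    then have gh: "g = h" using True h x_0 e SR by auto
    have "card ?S < card S" using e SR by (intro psubset_card_mono) auto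
    moreover have "sum_closed R ?S" using root_ideal_sum_closed above_ideal less.prems by blast
    ultimately have "\<exists>e'\<in>?S. \<exists>s. s \<noteq> 0 \<and> (\<exists>h\<in>root_span {f \<in> ?S. w e' < w f}. g = x e' s \<otimes> h)"
      using less.hyps[of ?S] h gh less.prems by simp
    then obtain e' s' h' where e': "e' \<in> ?S" "s' \<noteq> 0" "h' \<in> root_span {f \<in> ?S. w e' < w f}" "g = x e' s' \<otimes> h'"
      by blast
    have "{f \<in> ?S. w e' < w f} = {f \<in> S. w e' < w f}" using e' by auto
    then show ?thesis using e' by auto
  qed
qed

lemma R_above_inv_mult:
  "h \<in> root_span (R_above d) \<Longrightarrow> h' \<in> root_span (R_above d) \<Longrightarrow> h' \<otimes> inv h \<in> root_span (R_above d)"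
  using root_span_inv root_span_mult R_above_subset by blast

lemma R_above_antimono: "d \<le> d' \<Longrightarrow> root_span (R_above d') \<subseteq> root_span (R_above d)"
  by (rule root_span_mono) (auto simp: R_above_def)

lemma x_indep_above: "e \<in> R \<Longrightarrow> x e s \<in> root_span (R_above (w e)) \<Longrightarrow> s = 0"
  using x_indep by (auto simp: root_span_def R_above_def)

text \<open>If the roots differ, the one of smaller weight violates independence; if they agree, the quotient of
  the two root elements does.\<close>

lemma leading_term_unique:
  assumes "e \<in> R" "f \<in> R" "s \<noteq> 0" "t \<noteq> 0" "h \<in> root_span (R_above (w e))" "k \<in> root_span (R_above (w f))"
    "x e s \<otimes> h = x f t \<otimes> k"
  shows "e = f \<and> s = t"
proof -
  have aux: False if "e \<in> R" "f \<in> R" "s \<noteq> 0" "h \<in> root_span (R_above (w e))" "k \<in> root_span (R_above (w f))"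
    "x e s \<otimes> h = x f t \<otimes> k" "w e < w f" for e f s t h k
  proof -
    have k: "k \<in> root_span (R_above (w e))" "x f t \<in> root_span (R_above (w e))"
      using R_above_antimono[of "w e" "w f"] x_in_root_span[of f "R_above (w e)"] that by (auto simp: R_above_def)
    have "x e s = x f t \<otimes> k \<otimes> inv h" using that(6) root_span_closed[OF R_above_subset] that x_closed
      by (metis inv_solve_right' m_closed)
    then have "x e s \<in> root_span (R_above (w e))" using k that R_above_inv_mult root_span_mult by auto
    then show False using x_indep_above that by auto
  qed
  have "w e = w f" using aux[of e f s h k t] aux[of f e t k h s] assms by (metis linorder_neqE)
  then have ef: "e = f" using w_inj assms by (auto dest: inj_onD)
  have c: "h \<in> carrier G" "k \<in> carrier G" using root_span_closed[OF R_above_subset] assms by auto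
  have "x e (s - t) = inv (x e t) \<otimes> x e s" using x_add[of e "- t" s] x_minus assms by auto
  also have "\<dots> = k \<otimes> inv h" using assms ef c x_closed[of e]
    by (metis inv_solve_left inv_solve_right' m_assoc m_closed inv_closed)
  finally have "s - t = 0" using x_indep_above R_above_inv_mult assms ef by (metis)
  then show ?thesis using ef by auto
qed

lemma leading_term_nontrivial:
  "e \<in> R \<Longrightarrow> s \<noteq> 0 \<Longrightarrow> h \<in> root_span (R_above (w e)) \<Longrightarrow> x e s \<otimes> h \<noteq> \<one>"
  using x_indep_above[of e s] root_span_inv[OF R_above_subset, of h] x_closed root_span_closed[OF R_above_subset, of h]
  by (metis inv_equality inv_inv)

text \<open>The leading term computed within \<open>S\<close> is also one among all roots, and that one is unique.\<close>

lemma leading_root_in: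
  assumes S: "sum_closed R S" and "f \<in> R" "s \<noteq> 0" "h \<in> root_span (R_above (w f))" "x f s \<otimes> h \<in> root_span S"
  shows "f \<in> S"
proof -
  obtain e t k where e: "e \<in> S" "t \<noteq> 0" "k \<in> root_span {f \<in> S. w e < w f}" "x f s \<otimes> h = x e t \<otimes> k"
    using leading_term[OF S assms(5)] leading_term_nontrivial assms by blast
  have "k \<in> root_span (R_above (w e))" using e(3) root_span_mono[of "{f \<in> S. w e < w f}" "R_above (w e)"] S
    by (auto simp: R_above_def sum_closed_def)
  then show ?thesis using leading_term_unique[of f e s t h k] assms e S by (auto simp: sum_closed_def)
qed

lemma commutator_leading_term:
  assumes "e \<in> R" "f \<in> R" "e + f \<in> R" "s \<noteq> 0" "t \<noteq> 0"
  shows "\<exists>c. c \<noteq> 0 \<and> (\<exists>h\<in>root_span (R_above (w (e + f))). commutator G (x e s) (x f t) = x (e + f) c \<otimes> h)"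
proof -
  obtain \<kappa> z where z: "\<kappa> \<noteq> 0" "z \<in> root_span (sums_above R e f - {e + f})"
    and eq: "commutator G (x e s) (x f t) = x (e + f) (\<kappa> * s * t) \<otimes> z"
    using x_commutator[of e f] assms unfolding root_span_def by blast
  have "sums_above R e f - {e + f} \<subseteq> R_above (w (e + f))"
    using sums_above_weight[OF _ assms(1,2)] sums_above_subset by (auto simp: R_above_def)
  then have "z \<in> root_span (R_above (w (e + f)))" using z root_span_mono by blast
  then show ?thesis using eq z assms by (metis mult_eq_0_iff)
qed

text \<open>The filtration by weight is compatible with commutators.\<close>

lemma commutator_R_above:
  assumes "f \<in> R" "g \<in> root_span (R_above d)"
  shows "commutator G g (x f t) \<in> root_span (R_above (d + w f))"
proof (rule commutator_in_root_span[OF R_closed R_above_ideal R_above_subset _ _ assms(2), of "{f}"])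
  show "\<And>e f'. e \<in> R_above d \<Longrightarrow> f' \<in> {f} \<Longrightarrow> e + f' \<in> R \<Longrightarrow> e + f' \<in> R_above (d + w f)"
    by (auto simp: R_above_def w_add)
qed (use assms x_in_root_span in auto)

end

section \<open>Central series and the root graph\<close>

lemma path_of_length_0: "path_of_length E 0 vs \<longleftrightarrow> (\<exists>b\<in>E. vs = [b])"
  by (cases vs) (auto simp: path_of_length_def)

lemma path_of_length_Suc_snoc:
  "path_of_length E (Suc k) vs \<longleftrightarrow>
     (\<exists>us b. vs = us @ [b] \<and> path_of_length E k us \<and> arrow E (last us) b)"
proof
  assume p: "path_of_length E (Suc k) vs"
  then obtain us b where vs: "vs = us @ [b]" "length us = Suc k"
    by (cases vs rule: rev_cases) (auto simp: path_of_length_def)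
  then have "path_of_length E k us" "arrow E (last us) b"
    using p by (auto simp: path_of_length_def successively_append_iff)
  then show "\<exists>us b. vs = us @ [b] \<and> path_of_length E k us \<and> arrow E (last us) b"
    using vs by blast
qed (auto simp: path_of_length_def successively_append_iff arrow_def)

lemma path_of_length_Suc_Cons:
  "path_of_length E (Suc k) vs \<longleftrightarrow>
     (\<exists>a us. vs = a # us \<and> path_of_length E k us \<and> arrow E a (hd us))"
proof
  assume p: "path_of_length E (Suc k) vs"
  then obtain a us where vs: "vs = a # us" "length us = Suc k"
    by (cases vs) (auto simp: path_of_length_def)
  then have "path_of_length E k us" "arrow E a (hd us)"
    using p by (auto simp: path_of_length_def successively_Cons)
  then show "\<exists>a us. vs = a # us \<and> path_of_length E k us \<and> arrow E a (hd us)"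
    using vs by blast
qed (auto simp: path_of_length_def successively_Cons arrow_def)

lemma up_0: "up E 0 = E"
  by (auto simp: up_def path_of_length_0)

lemma up_Suc: "up E (Suc k) = {b. \<exists>a\<in>up E k. arrow E a b}"
  (is "?L = ?R")
proof
  show "?L \<subseteq> ?R"
  proof
    fix b assume "b \<in> ?L"
    then obtain vs where "path_of_length E (Suc k) vs" "last vs = b" by (auto simp: up_def)
    then obtain us where us: "path_of_length E k us" "arrow E (last us) b"
      by (auto simp: path_of_length_Suc_snoc)
    then have "last us \<in> up E k" by (auto simp: up_def arrow_def)
    then show "b \<in> ?R" using us by auto
  qed
  show "?R \<subseteq> ?L"
  proof
    fix b assume "b \<in> ?R"
    then obtain us where us: "path_of_length E k us" "arrow E (last us) b" by (auto simp: up_def)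
    then have "path_of_length E (Suc k) (us @ [b])" by (auto simp: path_of_length_Suc_snoc)
    then show "b \<in> ?L" using us by (force simp: up_def arrow_def)
  qed
qed

lemma down_0: "down E 0 = {}"
proof -
  have "\<exists>j vs. path_of_length E j vs \<and> hd vs = a" if "a \<in> E" for a
    by (rule exI[of _ 0], rule exI[of _ "[a]"]) (use that in \<open>auto simp: path_of_length_0\<close>)
  then show ?thesis by (fastforce simp: down_def)
qed

lemma down_Suc: "down E (Suc k) = {a \<in> E. \<forall>b. arrow E a b \<longrightarrow> b \<in> down E k}"
  (is "?L = ?R")
proof
  show "?L \<subseteq> ?R"
  proof
    fix a assume a: "a \<in> ?L"
    have "b \<in> down E k" if "arrow E a b" for b
    proof -
      have "j < k" if p: "path_of_length E j vs" "hd vs = b" for j vs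
      proof -
        have "path_of_length E (Suc j) (a # vs)"
          using p \<open>arrow E a b\<close> by (auto simp: path_of_length_Suc_Cons)
        then show ?thesis using a unfolding down_def by fastforce
      qed
      then show ?thesis using \<open>arrow E a b\<close> by (auto simp: down_def arrow_def)
    qed
    then show "a \<in> ?R" using a by (auto simp: down_def)
  qed
  show "?R \<subseteq> ?L"
  proof
    fix a assume a: "a \<in> ?R"
    have "j < Suc k" if p: "path_of_length E j vs" "hd vs = a" for j vs
    proof (cases j)
      case (Suc j')
      then obtain us where "path_of_length E j' us" "arrow E a (hd us)"
        using p by (auto simp: path_of_length_Suc_Cons)
      then show ?thesis using a Suc by (auto simp: down_def)
    qed auto
    then show "a \<in> ?L" using a by (auto simp: down_def)
  qed
qed

lemma down_mono: "down E k \<subseteq> down E (Suc k)"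
  by (fastforce simp: down_def)

lemma down_subset: "down E k \<subseteq> E" by (auto simp: down_def)

lemma up_subset: "up E k \<subseteq> E" by (auto simp: up_def)

lemma up_nonempty_iff: "up E k \<noteq> {} \<longleftrightarrow> (\<exists>vs. path_of_length E k vs)"
proof
  assume "\<exists>vs. path_of_length E k vs"
  then obtain vs where "path_of_length E k vs" by blast
  moreover from this have "last vs \<in> E"
    by (metis last_in_set length_0_conv nat.simps(3) path_of_length_def subsetD)
  ultimately show "up E k \<noteq> {}" by (auto simp: up_def)
qed (auto simp: up_def)

lemma down_eq_iff: "down E k = E \<longleftrightarrow> (\<forall>j vs. path_of_length E j vs \<longrightarrow> j < k)"
proof
  assume a: "down E k = E"
  show "\<forall>j vs. path_of_length E j vs \<longrightarrow> j < k"
  proof (intro allI impI)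
    fix j vs assume p: "path_of_length E j vs"
    then have "hd vs \<in> E" by (metis list.set_sel(1) length_0_conv nat.simps(3) path_of_length_def subsetD)
    then show "j < k" using a p by (auto simp: down_def)
  qed
qed (auto simp: down_def)

lemma path_of_length_prefix:
  "path_of_length E (k + d) vs \<Longrightarrow> \<exists>us. path_of_length E k us"
proof (induction d arbitrary: vs)
  case (Suc d)
  then obtain us where "path_of_length E (k + d) us"
    using path_of_length_Suc_snoc[of E "k + d" vs] by auto
  then show ?case by (rule Suc.IH)
qed auto

context root_group
begin

text \<open>A step of a path adds a root, hence raises the weight by at least \<open>1\<close>, while a finite set of roots has bounded weights.\<close>

lemma path_length_bounded:
  assumes "E \<subseteq> R" "path_of_length E k vs"
  shows "int k < Max (insert 0 (w ` R))"
proof -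
  have "int k < w (last vs) \<and> last vs \<in> E"
    using assms(2)
  proof (induction k arbitrary: vs)
    case 0 then show ?case using w_pos assms(1) by (auto simp: path_of_length_0)
  next
    case (Suc k)
    then obtain us b where us: "vs = us @ [b]" "path_of_length E k us" "arrow E (last us) b"
      by (auto simp: path_of_length_Suc_snoc)
    then obtain e where "e \<in> E" "b = last us + e" "b \<in> E" by (auto simp: arrow_def)
    then show ?case using Suc.IH[OF us(2)] us w_pos[of e] assms(1) by (auto simp: w_add)
  qed
  moreover have "w (last vs) \<le> Max (insert 0 (w ` R))" if "last vs \<in> E"
    using that assms(1) finite_R by (intro Max_ge) auto
  ultimately show ?thesis by force
qed

lemma longest_path_cases:
  assumes "E \<subseteq> R"
  shows "int k \<le> longest_path_length E \<longleftrightarrow> (\<exists>vs. path_of_length E k vs)"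
proof -
  let ?L = "{int k | k. \<exists>vs. path_of_length E k vs}"
  have "?L \<subseteq> {0..Max (insert 0 (w ` R))}" using path_length_bounded[OF assms] by force
  then have fin: "finite ?L" using finite_subset by blast
  show ?thesis
  proof
    assume le: "int k \<le> longest_path_length E"
    have "longest_path_length E \<in> insert (-1) ?L" unfolding longest_path_length_def
      by (rule Max_in) (use fin in auto)
    then obtain j vs where "path_of_length E j vs" "longest_path_length E = int j" using le by auto
    then show "\<exists>vs. path_of_length E k vs" using path_of_length_prefix[of E k "j - k" vs] le by auto
  next
    assume "\<exists>vs. path_of_length E k vs"
    then show "int k \<le> longest_path_length E" unfolding longest_path_length_def
      by (intro Max_ge) (use fin in auto)
  qed
qed

text \<open>For \<open>b = a + e\<close> with \<open>a\<close> in the previous set, \<open>b\<close> itself belongs to the previous set by induction, and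
  then every root \<open>b + f\<close> is the end of an arrow starting in that set.\<close>

lemma up_ideal:
  assumes "sum_closed R E"
  shows "root_ideal R E (up E k)"
proof (induction k)
  case 0 then show ?case using root_ideal_self[OF assms] by (simp add: up_0)
next
  case (Suc k)
  show ?case unfolding root_ideal_def
  proof (intro conjI ballI impI)
    fix b f assume b: "b \<in> up E (Suc k)" "f \<in> E" "b + f \<in> R"
    then obtain a where a: "a \<in> up E k" "arrow E a b" by (auto simp: up_Suc)
    then obtain e where e: "e \<in> E" "b = a + e" "a \<in> E" "b \<in> E" by (auto simp: arrow_def)
    show "b + f \<in> up E (Suc k)"
    proof -
      have "b \<in> up E k"
        using Suc.IH e a b assms unfolding root_ideal_def sum_closed_def by blast
      then show ?thesis using b e assms unfolding up_Suc arrow_def sum_closed_def by blast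
    qed
  qed (auto simp: up_subset)
qed

lemma down_ideal:
  assumes "sum_closed R E"
  shows "root_ideal R E (down E k)"
proof (cases k)
  case 0 then show ?thesis by (simp add: down_0 root_ideal_def)
next
  case (Suc k')
  show ?thesis unfolding root_ideal_def
  proof (intro conjI ballI impI)
    fix a f assume a: "a \<in> down E k" "f \<in> E" "a + f \<in> R"
    then have "a + f \<in> E" using assms down_subset[of E k] by (auto simp: sum_closed_def)
    then have "arrow E a (a + f)" using a down_subset by (auto simp: arrow_def)
    then show "a + f \<in> down E k" using a Suc down_Suc down_mono by blast
  qed (rule down_subset)
qed

text \<open>One inclusion is the computation with generators. For the other one, a root \<open>b = e + f\<close> with \<open>e\<close> in \<open>E\<close> and
  \<open>f\<close> in the previous set is reached by the commutator of \<open>x e s\<close> and \<open>x f 1\<close>, up to factors of larger weight.\<close>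

lemma lower_central_eq:
  assumes E: "sum_closed R E"
  shows "lower_central G (root_span E) k = root_span (up E k)"
proof (induction k)
  case 0 then show ?case by (simp add: up_0)
next
  case (Suc k)
  let ?C = "{commutator G g h | g h. g \<in> root_span E \<and> h \<in> root_span (up E k)}"
  let ?J = "up E (Suc k)"
  have ER: "E \<subseteq> R" using E by (auto simp: sum_closed_def)
  have UR: "\<And>k. up E k \<subseteq> R" using up_subset ER by blast
  have J: "root_ideal R E ?J" using up_ideal[OF E] .
  have JC: "sum_closed R ?J" using root_ideal_sum_closed[OF E J] .
  have sums: "e + f \<in> ?J" if "e \<in> E" "f \<in> up E k" "e + f \<in> R" for e f
  proof -
    have "f \<in> E" "e + f \<in> E" using that up_subset[of E k] E by (auto simp: sum_closed_def)
    then have "arrow E f (e + f)" using that by (auto simp: arrow_def add.commute)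
    then show ?thesis using that by (auto simp: up_Suc)
  qed
  have C: "?C \<subseteq> root_span ?J"
    using commutator_in_root_span[OF E J order_refl up_subset sums] by blast
  have sub: "subgroup (generate G ?C) G"
    by (rule generate_is_subgroup) (use C root_span_closed[OF UR] in blast)
  have "generate G ?C \<subseteq> root_span ?J" using generate_subgroup_incl[OF C root_span_subgroup[OF UR]] .
  moreover have "root_span ?J \<subseteq> generate G ?C"
  proof (rule root_span_least[OF UR sub])
    fix b s assume "b \<in> ?J"
    then show "x b s \<in> generate G ?C"
    proof (induction "card {f \<in> R. w b < w f}" arbitrary: b s rule: less_induct)
      case (less b)
      have bR: "b \<in> R" using less.prems UR by blast
      obtain f e where fe: "f \<in> up E k" "e \<in> E" "b = e + f"
        using less.prems by (auto simp: up_Suc arrow_def add.commute)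
      have feR: "e \<in> R" "f \<in> R" "e + f \<in> R" using fe ER UR bR by auto
      obtain \<kappa> where k0: "\<kappa> \<noteq> 0" and comm: "\<And>s t. \<exists>z\<in>root_span (sums_above R e f - {e + f}).
          commutator G (x e s) (x f t) = x (e + f) (\<kappa> * s * t) \<otimes> z"
        using x_commutator[OF feR] unfolding root_span_def by blast
      obtain z where z: "z \<in> root_span (sums_above R e f - {e + f})"
        and eq: "commutator G (x e (s / \<kappa>)) (x f 1) = x (e + f) (\<kappa> * (s / \<kappa>) * 1) \<otimes> z"
        using comm by blast
      \<comment> \<open>Scaling by the inverse of \<open>\<kappa>\<close> makes the leading term equal to \<open>x b s\<close>; the other factors are known by induction on the weight.\<close>
      have sa: "sums_above R e f \<subseteq> ?J"
        by (rule sums_above_ideal[OF J fe(2)]) (use fe sums up_subset[of E k] in auto)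
      have "root_span (sums_above R e f - {e + f}) \<subseteq> generate G ?C"
      proof (rule root_span_least[OF _ sub])
        show "sums_above R e f - {e + f} \<subseteq> R" using sums_above_subset by blast
        fix g u assume g: "g \<in> sums_above R e f - {e + f}"
        then have "w b < w g" using sums_above_weight[OF _ feR(1,2)] fe by blast
        then have "{f \<in> R. w g < w f} \<subset> {f \<in> R. w b < w f}" using sums_above_subset g by fastforce
        then have "card {f \<in> R. w g < w f} < card {f \<in> R. w b < w f}"
          using finite_R by (intro psubset_card_mono) auto
        then show "x g u \<in> generate G ?C" using less.hyps sa g by blast
      qed
      then have zC: "z \<in> generate G ?C" using z by blast
      have "commutator G (x e (s / \<kappa>)) (x f 1) \<in> generate G ?C"
        using x_in_root_span[OF fe(2)] x_in_root_span[OF fe(1)] by (intro generate.incl) blast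
      then have "x b s \<otimes> z \<otimes> inv z \<in> generate G ?C"
        using eq k0 fe subgroup.m_inv_closed[OF sub zC] subgroup.m_closed[OF sub] by simp
      moreover have "z \<in> carrier G" by (rule subgroup.mem_carrier[OF sub zC])
      ultimately show ?case using x_closed[OF bR] by (simp add: m_assoc)
    qed
  qed
  ultimately show ?case using Suc by (auto simp: lower_central.simps)
qed

text \<open>The factor \<open>h\<close> contributes to the commutator only roots of weight above \<open>w (e + f)\<close>, so the leading term
  is that of the commutator of the two root elements.\<close>

lemma commutator_lowest_not_central:
  assumes E: "sum_closed R E" and J: "root_ideal R E J"
    and e: "e \<in> E" "s \<noteq> 0" "h \<in> root_span {f \<in> E. w e < w f}" and f: "f \<in> E" "e + f \<in> E" "e + f \<notin> J"
  shows "commutator G (x e s \<otimes> h) (x f 1) \<notin> root_span J"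
proof
  assume in_J: "commutator G (x e s \<otimes> h) (x f 1) \<in> root_span J"
  have ER: "E \<subseteq> R" using E by (auto simp: sum_closed_def)
  have h: "h \<in> root_span (R_above (w e))" using e(3) root_span_mono[of "{f \<in> E. w e < w f}" "R_above (w e)"] ER
    by (auto simp: R_above_def)
  have eR: "e \<in> R" "f \<in> R" "e + f \<in> R" using e f ER by auto
  have c: "h \<in> carrier G" "x e s \<in> carrier G" "x f 1 \<in> carrier G"
    using root_span_closed[OF R_above_subset h] x_closed eR by auto
  obtain c k where k: "c \<noteq> 0" "k \<in> root_span (R_above (w (e + f)))"
    "commutator G (x e s) (x f 1) = x (e + f) c \<otimes> k"
    using commutator_leading_term[OF eR e(2), of 1] by auto
  have "commutator G h (x f 1) \<in> root_span (R_above (w e + w f))" by (rule commutator_R_above[OF eR(2) h])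
  then have y: "commutator G h (x f 1) \<in> root_span (R_above (w (e + f)))" by (simp add: w_add)
  define y where "y = x e s \<otimes> commutator G h (x f 1) \<otimes> inv (x e s)"
  have yin: "y \<in> root_span (R_above (w (e + f)))" unfolding y_def
    using root_span_ideal_normal[OF R_closed R_above_ideal x_in_root_span[OF eR(1)] y] .
  have xab: "x (e + f) c \<in> root_span R" "inv (x (e + f) c) \<in> root_span R" using x_in_root_span[OF eR(3)] root_span_inv by auto
  define y' where "y' = inv (x (e + f) c) \<otimes> y \<otimes> inv (inv (x (e + f) c))"
  have y'in: "y' \<in> root_span (R_above (w (e + f)))" unfolding y'_def
    using root_span_ideal_normal[OF R_closed R_above_ideal xab(2) yin] .
  have yc: "y \<in> carrier G" "k \<in> carrier G" "x (e + f) c \<in> carrier G"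
    using root_span_closed[OF R_above_subset] yin k x_closed eR by auto
  have "commutator G (x e s \<otimes> h) (x f 1) = y \<otimes> (x (e + f) c \<otimes> k)"
    using commutator_mult_left c k y_def by simp
  also have "\<dots> = x (e + f) c \<otimes> (y' \<otimes> k)"
    unfolding y'_def using yc by (simp add: m_assoc inv_mult_cancel)
  finally have "x (e + f) c \<otimes> (y' \<otimes> k) \<in> root_span J" using in_J by simp
  moreover have "y' \<otimes> k \<in> root_span (R_above (w (e + f)))" using y'in k root_span_mult by blast
  ultimately have "e + f \<in> J"
    using leading_root_in[OF root_ideal_sum_closed[OF E J] eR(3) k(1)] by blast
  then show False using f by blast
qed

text \<open>An element that is central modulo the previous term loses its leading factor step by step: the
  leading root lies in \<open>down E (Suc k)\<close> by \<open>commutator_lowest_not_central\<close>, so the factor is itself central modulo the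
  previous term and dividing by it preserves the condition.\<close>

lemma upper_central_eq:
  assumes E: "sum_closed R E"
  shows "upper_central G (root_span E) k = root_span (down E k)"
proof (induction k)
  case 0 then show ?case by (simp add: down_0 root_span_empty)
next
  case (Suc k)
  let ?D = "down E (Suc k)" and ?J = "down E k"
  have ER: "E \<subseteq> R" using E by (auto simp: sum_closed_def)
  have DR: "\<And>k. down E k \<subseteq> R" using down_subset ER by blast
  have J: "root_ideal R E ?J" using down_ideal[OF E] .
  have VD: "root_span ?D \<subseteq> root_span E" by (rule root_span_mono[OF down_subset])
  have sums: "e + f \<in> ?J" if "e \<in> ?D" "f \<in> E" "e + f \<in> R" for e f
  proof -
    have "e \<in> E" "e + f \<in> E" using that down_subset[of E "Suc k"] E by (auto simp: sum_closed_def)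
    then have "arrow E e (e + f)" using that by (auto simp: arrow_def)
    then show ?thesis using that by (auto simp: down_Suc)
  qed
  have central: "commutator G g h \<in> root_span ?J" if "g \<in> root_span ?D" "h \<in> root_span E" for g h
    using commutator_in_root_span[OF E J down_subset order_refl sums] that by blast
  have conv: "g \<in> root_span ?D" if "g \<in> root_span E" "\<forall>h\<in>root_span E. commutator G g h \<in> root_span ?J"
    "g \<in> root_span {f \<in> E. d < w f}" for g d
    using that
  proof (induction "card {f \<in> E. d < w f}" arbitrary: g d rule: less_induct)
    case (less d g)
    let ?E = "{f \<in> E. d < w f}"
    have EC: "sum_closed R ?E" using root_ideal_sum_closed[OF E above_ideal[OF E]] .
    show ?case
    proof (cases "g = \<one>")
      case True then show ?thesis using root_span_one by simp
    next
      case False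
      obtain e s h where e: "e \<in> ?E" "s \<noteq> 0" "h \<in> root_span {f \<in> ?E. w e < w f}" "g = x e s \<otimes> h"
        using leading_term[OF EC less.prems(3) False] by blast
      have above: "{f \<in> ?E. w e < w f} = {f \<in> E. w e < w f}" using e by auto
      have h: "h \<in> root_span {f \<in> E. w e < w f}" using e(3) above by simp
      then have hE: "h \<in> root_span E" using root_span_mono[of "{f \<in> E. w e < w f}" E] by auto
      have xE: "x e s \<in> root_span E" using e x_in_root_span by auto
      have c: "h \<in> carrier G" "x e s \<in> carrier G" using hE xE root_span_closed[OF ER] by auto
      have eD: "e \<in> ?D"
      proof (rule ccontr)
        assume "e \<notin> ?D"
        then obtain f where f: "f \<in> E" "e + f \<in> E" "e + f \<notin> ?J"
          using e by (auto simp: down_Suc arrow_def)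
        have "e \<in> E" using e by auto
        then have "commutator G g (x f 1) \<notin> root_span ?J"
          using commutator_lowest_not_central[OF E J _ e(2) h f] e(4) by blast
        then show False using less.prems(2) x_in_root_span[OF f(1)] by blast
      qed
      have hcomm: "commutator G h k \<in> root_span ?J" if k: "k \<in> root_span E" for k
      proof -
        have kc: "k \<in> carrier G" using root_span_closed[OF ER] k by auto
        have xi: "inv (x e s) \<in> root_span ?D" "inv (x e s) \<in> root_span E"
          using root_span_inv[OF DR x_in_root_span[OF eD]] root_span_inv[OF ER xE] by auto
        have "h = inv (x e s) \<otimes> g" using e(4) c by (simp add: inv_mult_cancel)
        then have "commutator G h k =
            (inv (x e s) \<otimes> commutator G g k \<otimes> inv (inv (x e s))) \<otimes> commutator G (inv (x e s)) k"
          using commutator_mult_left[of "inv (x e s)" g k] c kc e(4) by simp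
        moreover have "inv (x e s) \<otimes> commutator G g k \<otimes> inv (inv (x e s)) \<in> root_span ?J"
          using root_span_ideal_normal[OF E J xi(2)] less.prems(2) k by blast
        ultimately show ?thesis using central[OF xi(1) k] root_span_mult by simp
      qed
      have "{f \<in> E. w e < w f} \<subset> ?E" using e by auto
      then have "card {f \<in> E. w e < w f} < card ?E"
        using finite_subset[OF ER finite_R] by (intro psubset_card_mono) auto
      then have "h \<in> root_span ?D" using less.hyps[of "w e" h] hE hcomm h by blast
      then show ?thesis using e(4) x_in_root_span[OF eD] root_span_mult by blast
    qed
  qed
  have "{f \<in> E. 0 < w f} = E" using w_pos ER by auto
  then have "g \<in> root_span ?D" if "g \<in> root_span E" "\<forall>h\<in>root_span E. commutator G g h \<in> root_span ?J" for g
    using conv[OF that, of 0] that by simp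
  then show ?case using central VD Suc by auto
qed

lemma root_span_eq_imp_eq:
  assumes "sum_closed R S" "sum_closed R S'" "root_span S = root_span S'"
  shows "S = S'"
proof -
  have aux: "S \<subseteq> S'" if "sum_closed R S" "sum_closed R S'" "root_span S = root_span S'" for S S'
  proof
    fix e assume e: "e \<in> S"
    have eR: "e \<in> R" using e that by (auto simp: sum_closed_def)
    have "x e 1 \<otimes> \<one> \<in> root_span S'" using x_in_root_span[OF e, of 1] that x_closed[OF eR] by simp
    then show "e \<in> S'" using leading_root_in[OF that(2) eR, of 1 \<one>] root_span_one by simp
  qed
  show ?thesis using aux[of S S'] aux[of S' S] assms by auto
qed

theorem central_series:
  assumes E: "sum_closed R E"
  defines "l \<equiv> longest_path_length E"
  shows "lower_central G (root_span E) k = root_span (up E k)" "upper_central G (root_span E) k = root_span (down E k)"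
    "lower_central G (root_span E) (nat (l + 1)) = {\<one>}" "upper_central G (root_span E) (nat (l + 1)) = root_span E"
    "int k \<le> l \<Longrightarrow> lower_central G (root_span E) k \<noteq> {\<one>} \<and> upper_central G (root_span E) k \<noteq> root_span E"
proof -
  have ER: "E \<subseteq> R" using E by (auto simp: sum_closed_def)
  note path = longest_path_cases[OF ER, folded l_def]
  have l: "-1 \<le> l" unfolding l_def longest_path_length_def
  proof (rule Max_ge)
    have "{int k | k. \<exists>vs. path_of_length E k vs} \<subseteq> {0..Max (insert 0 (w ` R))}"
      using path_length_bounded[OF ER] by force
    then have "finite {int k | k. \<exists>vs. path_of_length E k vs}" by (rule finite_subset) simp
    then show "finite (insert (-1) {int k | k. \<exists>vs. path_of_length E k vs})" by simp
  qed auto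
  show low: "lower_central G (root_span E) k = root_span (up E k)" for k by (rule lower_central_eq[OF E])
  show upp: "upper_central G (root_span E) k = root_span (down E k)" for k by (rule upper_central_eq[OF E])
  have "up E (nat (l + 1)) = {}" using path[of "nat (l + 1)"] l up_nonempty_iff[of E] by auto
  then show "lower_central G (root_span E) (nat (l + 1)) = {\<one>}" using low root_span_empty by simp
  have "down E (nat (l + 1)) = E" unfolding down_eq_iff
  proof (intro allI impI)
    fix j vs assume "path_of_length E j vs"
    then have "int j \<le> l" using path by auto
    then show "j < nat (l + 1)" by auto
  qed
  then show "upper_central G (root_span E) (nat (l + 1)) = root_span E" using upp by simp
  assume "int k \<le> l"
  then have p: "\<exists>vs. path_of_length E k vs" using path by simp
  then have "up E k \<noteq> {}" using up_nonempty_iff by blast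
  then have "root_span (up E k) \<noteq> root_span {}"
    using root_span_eq_imp_eq[OF root_ideal_sum_closed[OF E up_ideal[OF E]], of "{}"] by (auto simp: sum_closed_def)
  moreover have "down E k \<noteq> E" using p down_eq_iff[of E k] by blast
  then have "root_span (down E k) \<noteq> root_span E"
    using root_span_eq_imp_eq[OF root_ideal_sum_closed[OF E down_ideal[OF E]] E] by blast
  ultimately show "lower_central G (root_span E) k \<noteq> {\<one>} \<and> upper_central G (root_span E) k \<noteq> root_span E"
    using low upp root_span_empty by simp
qed

end

section \<open>Subgroups stable under the torus\<close>

text \<open>The torus enters through pairs of an element and the character values by which it acts on the root
  elements. For triangular roots an element as in the third assumption exists because none of them is a multiple of another one.\<close>

locale torus_root_group = root_group G R w x
  for G :: "('a, 'b) monoid_scheme" (structure)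
    and R :: "(int ^ 'n) set" and w :: "int ^ 'n \<Rightarrow> int" and x :: "int ^ 'n \<Rightarrow> 'k::field \<Rightarrow> 'a" +
  fixes T :: "('a \<times> (int ^ 'n \<Rightarrow> 'k)) set"
  assumes T_closed: "(t, ch) \<in> T \<Longrightarrow> t \<in> carrier G"
    and T_conj: "(t, ch) \<in> T \<Longrightarrow> e \<in> R \<Longrightarrow> t \<otimes> x e s \<otimes> inv t = x e (ch e * s)"
    and T_separates: "e \<in> R \<Longrightarrow> f \<in> R \<Longrightarrow> e \<noteq> f \<Longrightarrow> \<exists>(t, ch)\<in>T. ch e = 1 \<and> ch f \<noteq> 1"
    and T_scales: "e \<in> R \<Longrightarrow> c \<noteq> 0 \<Longrightarrow> \<exists>(t, ch)\<in>T. ch e = c"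
begin

lemma T_conj_root_span: "S \<subseteq> R \<Longrightarrow> (t, ch) \<in> T \<Longrightarrow> g \<in> root_span S \<Longrightarrow> t \<otimes> g \<otimes> inv t \<in> root_span S"
proof -
  assume S: "S \<subseteq> R" and t: "(t, ch) \<in> T" and g: "g \<in> root_span S"
  show ?thesis using g S
  proof (induction rule: root_span_induct)
    case (root e s) then show ?case using T_conj[OF t] S x_in_root_span by auto
  next
    case one then show ?case using T_closed[OF t] root_span_one by auto
  next
    case (mult g h)
    then show ?case using conj_mult[of t g h] T_closed[OF t] root_span_closed[OF S] root_span_mult by auto
  qed
qed

context
  fixes U :: "'a set"
  assumes U: "subgroup U G" and UV: "U \<subseteq> root_span R"
    and U_conj: "\<And>t ch g. (t, ch) \<in> T \<Longrightarrow> g \<in> U \<Longrightarrow> t \<otimes> g \<otimes> inv t \<in> U"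
begin

lemma U_mult: "g \<in> U \<Longrightarrow> h \<in> U \<Longrightarrow> g \<otimes> h \<in> U" and U_inv: "g \<in> U \<Longrightarrow> inv g \<in> U"
  and U_carrier: "g \<in> U \<Longrightarrow> g \<in> carrier G"
  by (rule subgroup.m_closed[OF U], assumption+)
    (rule subgroup.m_inv_closed[OF U], assumption, rule subgroup.mem_carrier[OF U])

lemma root_in_U_scale:
  assumes "e \<in> R" "s \<noteq> 0" "x e s \<in> U"
  shows "x e u \<in> U"
proof (cases "u = 0")
  case True then show ?thesis using x_0 assms subgroup.one_closed[OF U] by simp
next
  case False
  then obtain t ch where "(t, ch) \<in> T" "ch e = u / s" using T_scales[of e "u / s"] assms by auto
  then show ?thesis using U_conj[of t ch "x e s"] T_conj[of t ch e s] assms by simp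
qed

text \<open>Induction on the leading root, starting from the largest weight. The remaining factors are removed from
  \<open>x e s \<otimes> h\<close> one after the other; the torus provides the root subgroups that are needed for this.\<close>

lemma leading_root_in_U:
  assumes "e \<in> R" "s \<noteq> 0" "h \<in> root_span (R_above (w e))" "x e s \<otimes> h \<in> U"
  shows "x e u \<in> U"
  using assms
proof (induction "card (R_above (w e))" arbitrary: e s h u rule: less_induct)
  case (less e s h)
  note outer = less.hyps
  note eR = less.prems(1)
  have card: "card (R_above (w f)) < card (R_above d)" if "f \<in> R_above d" for f d
    using that finite_R by (intro psubset_card_mono) (auto simp: R_above_def)
  have strip: "x e s \<in> U" if "d \<ge> w e" "h \<in> root_span (R_above d)" "x e s \<otimes> h \<in> U" for d h
    using that
  proof (induction "card (R_above d)" arbitrary: d h rule: less_induct)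
    case (less d h)
    note inner_prems = less.prems and inner_hyps = less.hyps
    show ?case
    proof (cases "h = \<one>")
      case True then show ?thesis using inner_prems x_closed[OF eR] by simp
    next
      case False
      have EC: "sum_closed R (R_above d)" by (rule root_ideal_sum_closed[OF R_closed R_above_ideal])
      obtain f c k where f: "f \<in> R_above d" "c \<noteq> 0" "k \<in> root_span {g \<in> R_above d. w f < w g}" "h = x f c \<otimes> k"
        using leading_term[OF EC inner_prems(2) False] by blast
      have "{g \<in> R_above d. w f < w g} = R_above (w f)" using f by (auto simp: R_above_def)
      then have k: "k \<in> root_span (R_above (w f))" using f by simp
      have fR: "f \<in> R" "w e < w f" "f \<in> R_above (w e)" using f inner_prems by (auto simp: R_above_def)
      obtain t ch where t: "(t, ch) \<in> T" "ch e = 1" "ch f \<noteq> 1"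
        using T_separates[of e f] eR fR by auto
      let ?h' = "t \<otimes> h \<otimes> inv t" and ?k' = "t \<otimes> k \<otimes> inv t"
      have k': "?k' \<in> root_span (R_above (w f))" by (rule T_conj_root_span[OF R_above_subset t(1) k])
      have c: "t \<in> carrier G" "k \<in> carrier G" "h \<in> carrier G" "?k' \<in> carrier G"
        "x e s \<in> carrier G" "\<And>u. x f u \<in> carrier G"
        using T_closed[OF t(1)] root_span_closed[OF R_above_subset] k inner_prems(2) k' x_closed eR fR by auto
      have xe: "t \<otimes> x e s \<otimes> inv t = x e s" using T_conj[OF t(1) eR] t by simp
      \<comment> \<open>The factor \<open>x e s\<close> is fixed by \<open>t\<close> and cancels, while \<open>x f c\<close> is rescaled and leaves a leading term at \<open>f\<close>.\<close>
      have "inv (x e s \<otimes> h) \<otimes> (t \<otimes> (x e s \<otimes> h) \<otimes> inv t) \<in> U"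
        using inner_prems(3) U_conj[OF t(1)] U_inv U_mult by blast
      also have "inv (x e s \<otimes> h) \<otimes> (t \<otimes> (x e s \<otimes> h) \<otimes> inv t) = inv h \<otimes> ?h'"
        unfolding conj_mult[OF c(1,5,3)] xe using c by (simp add: inv_mult_group m_assoc inv_mult_cancel)
      also have "?h' = x f (ch f * c) \<otimes> ?k'"
        unfolding f(4) conj_mult[OF c(1) c(6) c(2)] T_conj[OF t(1) fR(1)] ..
      also have "inv h \<otimes> (x f (ch f * c) \<otimes> ?k') =
          inv k \<otimes> x f (ch f * c - c) \<otimes> ?k'"
        using c x_add[OF fR(1), of "- c" "ch f * c"] unfolding f(4)
        by (simp add: inv_mult_group m_assoc x_minus[OF fR(1)])
      also have "\<dots> = x f (ch f * c - c) \<otimes>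
          ((inv (x f (ch f * c - c)) \<otimes> inv k \<otimes> inv (inv (x f (ch f * c - c)))) \<otimes> ?k')"
        using c by (simp add: m_assoc inv_mult_cancel)
      finally have lead: "\<dots> \<in> U" .
      have "inv (x f (ch f * c - c)) \<in> root_span R" using root_span_inv[OF order_refl x_in_root_span[OF fR(1)]] .
      then have "(inv (x f (ch f * c - c)) \<otimes> inv k \<otimes> inv (inv (x f (ch f * c - c)))) \<otimes> ?k'
          \<in> root_span (R_above (w f))"
        using root_span_ideal_normal[OF R_closed R_above_ideal _ root_span_inv[OF R_above_subset k]] root_span_mult k' by blast
      moreover have "ch f * c - c \<noteq> 0" using t f by auto
      ultimately have fU: "x f (- c) \<in> U"
        using outer[OF card[OF fR(3)] fR(1)] lead by blast
      \<comment> \<open>Dividing by \<open>x f c\<close> on the right leaves \<open>x e s\<close> times a factor whose weights exceed that of \<open>f\<close>.\<close>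
      let ?k2 = "x f c \<otimes> k \<otimes> inv (x f c)"
      have "x e s \<otimes> h \<otimes> x f (- c) \<in> U" using inner_prems(3) fU U_mult by blast
      also have "x e s \<otimes> h \<otimes> x f (- c) = x e s \<otimes> ?k2"
        unfolding f(4) using c by (simp add: m_assoc x_minus[OF fR(1)])
      finally have "x e s \<otimes> ?k2 \<in> U" .
      moreover have "?k2 \<in> root_span (R_above (w f))"
        using root_span_ideal_normal[OF R_closed R_above_ideal x_in_root_span[OF fR(1)] k] .
      ultimately show ?thesis using inner_hyps[of "w f" ?k2] card[OF f(1)] fR by simp
    qed
  qed
  then have "x e s \<in> U" using strip[OF order_refl] less.prems by blast
  then show ?case using root_in_U_scale less.prems by blast
qed

theorem torus_stable_subgroup:
  defines "E \<equiv> {e \<in> R. \<forall>s. x e s \<in> U}"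
  shows "sum_closed R E" "U = root_span E"
proof -
  have ER: "E \<subseteq> R" by (auto simp: E_def)
  show E: "sum_closed R E"
    unfolding sum_closed_def
  proof (intro conjI ballI impI)
    fix e f assume ef: "e \<in> E" "f \<in> E" "e + f \<in> R"
    then obtain c h where h: "c \<noteq> 0" "h \<in> root_span (R_above (w (e + f)))"
      "commutator G (x e 1) (x f 1) = x (e + f) c \<otimes> h"
      using commutator_leading_term[of e f 1 1] by (auto simp: E_def)
    have "commutator G (x e 1) (x f 1) \<in> U"
      unfolding commutator_def using ef U_mult U_inv by (auto simp: E_def)
    then have "x (e + f) u \<in> U" for u using leading_root_in_U[OF ef(3) h(1,2)] h(3) by simp
    then show "e + f \<in> E" using ef by (auto simp: E_def)
  qed (rule ER)
  have "g \<in> root_span E" if "g \<in> U" "g \<in> root_span (R_above d)" for g d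
    using that
  proof (induction "card (R_above d)" arbitrary: d g rule: less_induct)
    case (less d g)
    show ?case
    proof (cases "g = \<one>")
      case True then show ?thesis using root_span_one by simp
    next
      case False
      have EC: "sum_closed R (R_above d)" by (rule root_ideal_sum_closed[OF R_closed R_above_ideal])
      obtain f c k where f: "f \<in> R_above d" "c \<noteq> 0" "k \<in> root_span {g \<in> R_above d. w f < w g}" "g = x f c \<otimes> k"
        using leading_term[OF EC less.prems(2) False] by blast
      have "{g \<in> R_above d. w f < w g} = R_above (w f)" using f by (auto simp: R_above_def)
      then have k: "k \<in> root_span (R_above (w f))" using f by simp
      have fR: "f \<in> R" using f by (auto simp: R_above_def)
      have xU: "x f u \<in> U" for u using leading_root_in_U[OF fR f(2) k] less.prems f by simp
      have "k \<in> carrier G" using root_span_closed[OF R_above_subset k] .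
      then have "k = inv (x f c) \<otimes> g" using f(4) x_closed[OF fR] by (simp add: inv_mult_cancel)
      then have "k \<in> U" using xU less.prems U_inv U_mult by blast
      moreover have "card (R_above (w f)) < card (R_above d)"
        using f finite_R by (intro psubset_card_mono) (auto simp: R_above_def)
      ultimately have "k \<in> root_span E" using less.hyps k by blast
      moreover have "f \<in> E" using xU fR by (auto simp: E_def)
      ultimately show ?thesis using f(4) x_in_root_span root_span_mult by blast
    qed
  qed
  moreover have "R_above 0 = R" using w_pos by (auto simp: R_above_def)
  ultimately have "U \<subseteq> root_span E" using UV by (metis subset_iff)
  moreover have "root_span E \<subseteq> U" by (rule root_span_least[OF ER U]) (auto simp: E_def)
  ultimately show "U = root_span E" by blast
qed

end
end

section \<open>The pairing and primitive vectors\<close>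

lemma pairing_add_left: "pairing (u + u') w = pairing u w + pairing u' w"
  and pairing_add_right: "pairing u (w + w') = pairing u w + pairing u w'"
  and pairing_minus_left: "pairing (- u) w = - pairing u w"
  and pairing_minus_right: "pairing u (- w) = - pairing u w"
  and pairing_scale_left: "pairing (k *s u) w = k * pairing u w"
  and pairing_scale_right: "pairing u (k *s w) = k * pairing u w"
  and pairing_zero_left: "pairing 0 w = 0"
  and pairing_zero_right: "pairing u 0 = 0"
  by (simp_all add: pairing_def algebra_simps sum.distrib sum_negf sum_distrib_left)

lemma pairing_diff_left: "pairing (u - u') w = pairing u w - pairing u' w"
  using pairing_add_left[of u "- u'" w] by (simp add: pairing_minus_left)

lemma pairing_sum_right: "pairing u (\<Sum>i\<in>I. f i) = (\<Sum>i\<in>I. pairing u (f i))"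
  by (induction I rule: infinite_finite_induct) (auto simp: pairing_add_right pairing_zero_right)

lemma pairing_sum_left: "pairing (\<Sum>i\<in>I. f i) w = (\<Sum>i\<in>I. pairing (f i) w)"
  by (induction I rule: infinite_finite_induct) (auto simp: pairing_add_left pairing_zero_left)

lemma pairing_axis: "pairing u (axis i 1) = u $ i"
  by (simp add: pairing_def axis_def if_distrib cong: if_cong)

lemma real_vec_inner: "real_vec u \<bullet> real_vec w = of_int (pairing u w)"
  by (simp add: real_vec_def pairing_def inner_vec_def)

lemma real_vec_add: "real_vec (u + w) = real_vec u + real_vec w"
  and real_vec_minus: "real_vec (- u) = - real_vec u"
  and real_vec_scale: "real_vec (k *s u) = of_int k *\<^sub>R real_vec u"
  and real_vec_0: "real_vec 0 = 0"
  by (simp_all add: real_vec_def vec_eq_iff)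

lemma real_vec_eq_0_iff: "real_vec u = 0 \<longleftrightarrow> u = 0"
  by (simp add: real_vec_def vec_eq_iff)

lemma real_vec_sum: "real_vec (\<Sum>i\<in>I. f i) = (\<Sum>i\<in>I. real_vec (f i))"
  by (induction I rule: infinite_finite_induct) (auto simp: real_vec_add real_vec_0)

lemma primitive_nonzero: "primitive w \<Longrightarrow> w \<noteq> 0"
proof
  assume w: "primitive w" "w = 0"
  then have "w = 0 *s w" by simp
  then have "\<bar>0 :: int\<bar> = 1" using w(1) unfolding primitive_def by blast
  then show False by simp
qed

lemma primitive_uminus: "primitive w \<Longrightarrow> primitive (- w)"
  unfolding primitive_def
proof (intro allI impI)
  fix k w' assume w: "\<forall>k w'. w = k *s w' \<longrightarrow> \<bar>k\<bar> = 1" and "- w = k *s w'"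
  then have "w = k *s (- w')" by (metis minus_equation_iff vector_smult_rneg)
  then show "\<bar>k\<bar> = 1" using w by blast
qed

text \<open>Dividing by a factor of absolute value at least \<open>2\<close> makes the sum of the absolute values of the entries
  smaller, so this terminates at a primitive vector.\<close>

lemma primitive_multiple:
  fixes g :: "int ^ 'n"
  assumes "g \<noteq> 0"
  shows "\<exists>k g'. k > 0 \<and> primitive g' \<and> g = k *s g'"
  using assms
proof (induction "nat (\<Sum>i\<in>UNIV. \<bar>g $ i\<bar>)" arbitrary: g rule: less_induct)
  case (less g)
  show ?case
  proof (cases "primitive g")
    case True
    then show ?thesis by (intro exI[of _ 1] exI[of _ g]) auto
  next
    case False
    then obtain k w where k: "g = k *s w" "\<bar>k\<bar> \<noteq> 1" by (auto simp: primitive_def)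
    have kw: "k \<noteq> 0" "w \<noteq> 0" using less.prems k by auto
    have pos: "(\<Sum>i\<in>UNIV. \<bar>w $ i\<bar>) > 0"
    proof -
      obtain i where "w $ i \<noteq> 0" using kw by (auto simp: vec_eq_iff)
      then show ?thesis by (intro sum_pos2[of UNIV i]) auto
    qed
    have "(\<Sum>i\<in>UNIV. \<bar>g $ i\<bar>) = \<bar>k\<bar> * (\<Sum>i\<in>UNIV. \<bar>w $ i\<bar>)"
      using k by (simp add: abs_mult sum_distrib_left)
    moreover have "\<bar>k\<bar> \<ge> 2" using k kw by auto
    ultimately have "(\<Sum>i\<in>UNIV. \<bar>w $ i\<bar>) < (\<Sum>i\<in>UNIV. \<bar>g $ i\<bar>)"
      using pos mult_right_mono[of 2 "\<bar>k\<bar>" "\<Sum>i\<in>UNIV. \<bar>w $ i\<bar>"] by linarith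
    then obtain k' g' where g': "k' > 0" "primitive g'" "w = k' *s g'"
      using less.hyps[of w] kw pos by (auto simp: nat_less_iff)
    show ?thesis
    proof (cases "k > 0")
      case True
      then show ?thesis using k g' by (intro exI[of _ "k * k'"] exI[of _ g']) auto
    next
      case False
      then have "- k * k' > 0" using kw g' by (auto simp: mult_neg_pos)
      moreover have "g = (- k * k') *s (- g')" using k g' by (simp add: vec_eq_iff)
      ultimately show ?thesis using primitive_uminus[OF g'(2)] by blast
    qed
  qed
qed

section \<open>Rational polyhedral cones\<close>

lemma convex_cone_sum:
  "convex_cone S \<Longrightarrow> (\<And>i. i \<in> I \<Longrightarrow> f i \<in> S) \<Longrightarrow> (\<Sum>i\<in>I. f i) \<in> S"
  by (induction I rule: infinite_finite_induct) (auto simp: convex_cone_add convex_cone_contains_0)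

lemma convex_cone_hull_family:
  assumes "finite S"
  shows "convex_cone hull (f ` S) = {\<Sum>s\<in>S. c s *\<^sub>R f s | c. \<forall>s. 0 \<le> c s}"
proof
  let ?C = "{\<Sum>s\<in>S. c s *\<^sub>R f s | c. \<forall>s. 0 \<le> c s}"
  have "convex_cone ?C" unfolding convex_cone_iff
  proof (intro conjI ballI allI impI)
    show "0 \<in> ?C" by (auto intro: exI[of _ "\<lambda>_. 0"])
  next
    fix x y assume "x \<in> ?C" "y \<in> ?C"
    then obtain c d where "x = (\<Sum>s\<in>S. c s *\<^sub>R f s)" "y = (\<Sum>s\<in>S. d s *\<^sub>R f s)"
      "\<forall>s. 0 \<le> c s" "\<forall>s. 0 \<le> d s" by blast
    then have "x + y = (\<Sum>s\<in>S. (c s + d s) *\<^sub>R f s)" "\<forall>s. 0 \<le> c s + d s"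
      by (auto simp: sum.distrib algebra_simps)
    then show "x + y \<in> ?C" by (auto intro!: exI[of _ "\<lambda>s. c s + d s"])
  next
    fix x and k :: real assume "x \<in> ?C" "0 \<le> k"
    then obtain c where "x = (\<Sum>s\<in>S. c s *\<^sub>R f s)" "\<forall>s. 0 \<le> c s" by blast
    then have "k *\<^sub>R x = (\<Sum>s\<in>S. (k * c s) *\<^sub>R f s)" "\<forall>s. 0 \<le> k * c s"
      using \<open>0 \<le> k\<close> by (auto simp: scaleR_sum_right)
    then show "k *\<^sub>R x \<in> ?C" by (auto intro!: exI[of _ "\<lambda>s. k * c s"])
  qed
  moreover have "f ` S \<subseteq> ?C"
  proof
    fix y assume "y \<in> f ` S"
    then obtain s where s: "s \<in> S" "y = f s" by blast
    have "y = (\<Sum>t\<in>S. (if t = s then 1 else 0) *\<^sub>R f t)"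
      using s assms by (simp add: if_distrib[of "\<lambda>c. c *\<^sub>R _"] cong: if_cong)
    then show "y \<in> ?C" by (auto intro!: exI[of _ "\<lambda>t. if t = s then 1 else 0"])
  qed
  ultimately show "convex_cone hull (f ` S) \<subseteq> ?C" by (intro hull_minimal)
  show "?C \<subseteq> convex_cone hull (f ` S)"
  proof
    fix y assume "y \<in> ?C"
    then obtain c where "y = (\<Sum>s\<in>S. c s *\<^sub>R f s)" "\<forall>s. 0 \<le> c s" by blast
    then show "y \<in> convex_cone hull (f ` S)"
      by (simp, intro convex_cone_sum[OF convex_cone_convex_cone_hull] convex_cone_hull_mul hull_inc; simp)
  qed
qed

lemma convex_cone_hull_singleton:
  "convex_cone hull {g} = {k *\<^sub>R g | k. 0 \<le> k}"
  using convex_cone_hull_family[of "{g}" "\<lambda>x. x"] by auto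

text \<open>For cones the midpoint of a segment may be replaced by the sum of its ends; this form of the definition of
  a face avoids convex combinations.\<close>

lemma convex_cone_face_of_iff:
  assumes S: "convex_cone S" and T: "convex_cone T"
  shows "T face_of S \<longleftrightarrow> T \<subseteq> S \<and> (\<forall>a\<in>S. \<forall>b\<in>S. a + b \<in> T \<longrightarrow> a \<in> T \<and> b \<in> T)"
proof (intro iffI conjI ballI impI)
  assume F: "T face_of S"
  then show "T \<subseteq> S" by (rule face_of_imp_subset)
  fix a b assume ab: "a \<in> S" "b \<in> S" "a + b \<in> T"
  have mid: "(1/2) *\<^sub>R (a + b) \<in> T" using convex_cone_scaleR[OF T _ ab(3), of "1/2"] by simp
  have "a \<in> T \<and> b \<in> T"
  proof (cases "a = b")
    case True then show ?thesis using mid by (simp flip: scaleR_2)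
  next
    case False
    then have "(1/2) *\<^sub>R (a + b) \<in> open_segment a b"
      unfolding in_segment using False by (intro conjI exI[of _ "1/2"]) (auto simp: scaleR_add_right)
    then show ?thesis using F ab mid unfolding face_of_def by blast
  qed
  then show "a \<in> T" "b \<in> T" by auto
next
  assume R: "T \<subseteq> S \<and> (\<forall>a\<in>S. \<forall>b\<in>S. a + b \<in> T \<longrightarrow> a \<in> T \<and> b \<in> T)"
  show "T face_of S" unfolding face_of_def
  proof (intro conjI ballI impI)
    show "T \<subseteq> S" using R by blast
    show "convex T" using T by (simp add: convex_cone_def)
    fix a b x assume ab: "a \<in> S" "b \<in> S" "x \<in> T" "x \<in> open_segment a b"
    then obtain t where t: "0 < t" "t < 1" "x = (1 - t) *\<^sub>R a + t *\<^sub>R b" by (auto simp: in_segment)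
    have "(1 - t) *\<^sub>R a \<in> S" "t *\<^sub>R b \<in> S" using convex_cone_scaleR[OF S] ab t by auto
    then have "(1 - t) *\<^sub>R a \<in> T" "t *\<^sub>R b \<in> T" using R t ab by auto
    then have "(1 / (1 - t)) *\<^sub>R (1 - t) *\<^sub>R a \<in> T" "(1 / t) *\<^sub>R t *\<^sub>R b \<in> T"
      using convex_cone_scaleR[OF T] t by (metis divide_nonneg_pos diff_gt_0_iff_gt zero_le_one)+
    then show "a \<in> T" "b \<in> T" using t by auto
  qed
qed

text \<open>The members of a generating set of least cardinality work. In a relation \<open>a + b = c g\<close> all coefficients
  at other generators vanish: otherwise \<open>g\<close> would be redundant or the cone would contain a line.\<close>
lemma pointed_cone_extreme_generators:
  fixes H :: "(real ^ 'n) set"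
  assumes "finite H" and pointed: "convex_cone hull H \<inter> uminus ` (convex_cone hull H) = {0}"
  shows "\<exists>H'\<subseteq>H. convex_cone hull H' = convex_cone hull H \<and>
     (\<forall>g\<in>H'. g \<noteq> 0 \<and> (convex_cone hull {g}) face_of (convex_cone hull H))"
proof -
  let ?P = "\<lambda>H'. H' \<subseteq> H \<and> convex_cone hull H' = convex_cone hull H"
  obtain H' where H': "?P H'" and least: "\<And>K. ?P K \<Longrightarrow> card H' \<le> card K"
    using ex_has_least_nat[of ?P H card] by blast
  let ?S = "convex_cone hull H"
  have fin: "finite H'" using H' assms finite_subset by blast
  have cc: "convex_cone ?S" by (rule convex_cone_convex_cone_hull)
  have notin: "g \<notin> convex_cone hull (H' - {g})" if g: "g \<in> H'" for g
  proof
    assume "g \<in> convex_cone hull (H' - {g})"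
    then have "H' \<subseteq> convex_cone hull (H' - {g})" using hull_subset[of "H' - {g}" convex_cone] by blast
    then have "convex_cone hull H' \<subseteq> convex_cone hull (H' - {g})"
      by (rule hull_minimal) (rule convex_cone_convex_cone_hull)
    then have "?P (H' - {g})" using H' hull_mono[of "H' - {g}" H' convex_cone] by blast
    then show False using least[of "H' - {g}"] g fin card_Diff1_less[of H' g] by simp
  qed
  have H'S: "h \<in> ?S" if "h \<in> H'" for h using that H' hull_inc[of h H' convex_cone] by simp
  have "g \<noteq> 0 \<and> (convex_cone hull {g}) face_of ?S" if g: "g \<in> H'" for g
  proof
    show "g \<noteq> 0" using notin[OF g] convex_cone_hull_contains_0 by metis
    show "(convex_cone hull {g}) face_of ?S"
      unfolding convex_cone_face_of_iff[OF cc convex_cone_convex_cone_hull]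
    proof (intro conjI ballI impI)
      show "convex_cone hull {g} \<subseteq> ?S" using H'S[OF g] cc by (intro hull_minimal) auto
      fix a b assume ab: "a \<in> ?S" "b \<in> ?S" "a + b \<in> convex_cone hull {g}"
      have "?S = {\<Sum>h\<in>H'. c h *\<^sub>R h | c. \<forall>h. 0 \<le> c h}"
        using convex_cone_hull_family[OF fin, of "\<lambda>h. h"] H' by simp
      then obtain \<alpha> \<beta> where \<alpha>: "a = (\<Sum>h\<in>H'. \<alpha> h *\<^sub>R h)" "\<forall>h. 0 \<le> \<alpha> h"
        and \<beta>: "b = (\<Sum>h\<in>H'. \<beta> h *\<^sub>R h)" "\<forall>h. 0 \<le> \<beta> h" using ab(1,2) by blast
      obtain c where c: "a + b = c *\<^sub>R g" "0 \<le> c" using ab(3) by (auto simp: convex_cone_hull_singleton)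
      define y where "y = (\<Sum>h\<in>H' - {g}. \<alpha> h *\<^sub>R h)"
      define z where "z = (\<Sum>h\<in>H' - {g}. \<beta> h *\<^sub>R h)"
      have a: "a = \<alpha> g *\<^sub>R g + y" and b: "b = \<beta> g *\<^sub>R g + z"
        unfolding y_def z_def \<alpha>(1) \<beta>(1) using sum.remove[OF fin g] by auto
      have yz: "y \<in> convex_cone hull (H' - {g})" "z \<in> convex_cone hull (H' - {g})"
        unfolding y_def z_def using \<alpha>(2) \<beta>(2)
        by (intro convex_cone_sum[OF convex_cone_convex_cone_hull] convex_cone_hull_mul hull_inc; simp)+
      then have yzS: "y \<in> ?S" "z \<in> ?S" using H' hull_mono[of "H' - {g}" H' convex_cone] by auto
      define d where "d = \<alpha> g + \<beta> g - c"
      have rel: "d *\<^sub>R g + y + z = 0" using a b c by (simp add: d_def algebra_simps)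
      have d: "0 \<le> d"
      proof (rule ccontr)
        assume "\<not> 0 \<le> d"
        have "d *\<^sub>R g + (y + z) = 0" using rel by (simp add: add.assoc)
        then have "y + z = - (d *\<^sub>R g)" using minus_unique by metis
        then have "g = (1 / (- d)) *\<^sub>R (y + z)" using \<open>\<not> 0 \<le> d\<close> by simp
        moreover have "(1 / (- d)) *\<^sub>R (y + z) \<in> convex_cone hull (H' - {g})"
          using yz \<open>\<not> 0 \<le> d\<close> by (intro convex_cone_hull_mul convex_cone_hull_add) auto
        ultimately show False using notin[OF g] by simp
      qed
      have dg: "d *\<^sub>R g \<in> ?S" using convex_cone_hull_mul[OF H'S[OF g] d] H' by (metis hull_hull)
      have "- y = d *\<^sub>R g + z" "- z = d *\<^sub>R g + y" 
        using minus_unique[of y "d *\<^sub>R g + z"] minus_unique[of z "d *\<^sub>R g + y"] rel by (auto simp: algebra_simps)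
      then have "- y \<in> ?S" "- z \<in> ?S" using dg yzS convex_cone_add[OF cc] by metis+
      then have "y \<in> uminus ` ?S" "z \<in> uminus ` ?S" by (metis image_eqI minus_minus)+
      then have "y = 0" "z = 0" using pointed yzS by blast+
      then show "a \<in> convex_cone hull {g}" "b \<in> convex_cone hull {g}"
        using a b \<alpha> \<beta> by (auto simp: convex_cone_hull_singleton)
    qed
  qed
  then show ?thesis using H' by blast
qed

section \<open>Complete fans\<close>

locale toric_fan =
  fixes \<Sigma> :: "(real ^ 'n) set set" and m :: nat and p :: "nat \<Rightarrow> int ^ 'n"
  assumes complete: "complete_fan \<Sigma>" and p_bij: "bij_betw p {1..m} (ray_generators \<Sigma>)"
begin

text \<open>Since cones of the fan are generated by the rays that they contain, this index set describes a cone completely;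
  duals, orthogonal complements and inclusions are read off from it.\<close>

definition rays :: "(real ^ 'n) set \<Rightarrow> nat set" where
  "rays \<tau> = {s \<in> {1..m}. real_vec (p s) \<in> \<tau>}"

lemma rays_subset: "rays \<tau> \<subseteq> {1..m}" by (auto simp: rays_def)

lemma finite_rays: "finite (rays \<tau>)" by (simp add: rays_def)

lemma fan: "is_fan \<Sigma>" using complete by (simp add: complete_fan_def)

lemma cone_rational: "\<tau> \<in> \<Sigma> \<Longrightarrow> rational_cone \<tau>"
  using fan by (simp add: is_fan_def)

lemma cone_convex: "\<tau> \<in> \<Sigma> \<Longrightarrow> convex_cone \<tau>"
proof -
  assume "\<tau> \<in> \<Sigma>"
  then obtain G where "\<tau> = convex_cone hull (real_vec ` G)"
    using cone_rational rational_cone_def by meson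
  then show ?thesis using convex_cone_convex_cone_hull by simp
qed

lemma cone_pointed: "\<tau> \<in> \<Sigma> \<Longrightarrow> w \<in> \<tau> \<Longrightarrow> - w \<in> \<tau> \<Longrightarrow> w = 0"
proof -
  assume w: "\<tau> \<in> \<Sigma>" "w \<in> \<tau>" "- w \<in> \<tau>"
  have "\<tau> \<inter> uminus ` \<tau> = {0}"
    using cone_rational[OF w(1)] by (simp add: rational_cone_def)
  moreover have "w \<in> uminus ` \<tau>" using w(3) by (intro image_eqI[of _ _ "- w"]) auto
  ultimately show ?thesis using w(2) by blast
qed

lemma face_in_fan: "\<sigma> \<in> \<Sigma> \<Longrightarrow> \<tau> face_of \<sigma> \<Longrightarrow> \<tau> \<noteq> {} \<Longrightarrow> \<tau> \<in> \<Sigma>"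
  using fan by (simp add: is_fan_def)

lemma Int_face: "\<sigma> \<in> \<Sigma> \<Longrightarrow> \<tau> \<in> \<Sigma> \<Longrightarrow> (\<sigma> \<inter> \<tau>) face_of \<sigma>"
  using fan by (simp add: is_fan_def)

lemma Int_in_fan: "\<sigma> \<in> \<Sigma> \<Longrightarrow> \<tau> \<in> \<Sigma> \<Longrightarrow> \<sigma> \<inter> \<tau> \<in> \<Sigma>"
  using face_in_fan[OF _ Int_face] cone_convex convex_cone_contains_0 by blast

lemma subcone_face: "\<sigma> \<in> \<Sigma> \<Longrightarrow> \<tau> \<in> \<Sigma> \<Longrightarrow> \<tau> \<subseteq> \<sigma> \<Longrightarrow> \<tau> face_of \<sigma>"
  using Int_face[of \<sigma> \<tau>] by (simp add: inf.absorb2)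

lemma p_nonzero: "s \<in> {1..m} \<Longrightarrow> p s \<noteq> 0"
  using p_bij primitive_nonzero unfolding bij_betw_def ray_generators_def by blast

text \<open>By pointedness an extreme generator spans a face, that is, a cone of the fan, and its primitive multiple is a
  ray generator of the fan.\<close>

lemma cone_generated:
  assumes \<tau>: "\<tau> \<in> \<Sigma>"
  shows "\<tau> = {\<Sum>s\<in>rays \<tau>. c s *\<^sub>R real_vec (p s) | c. \<forall>s. 0 \<le> c s}"
proof -
  obtain G where G: "finite G" "\<tau> = convex_cone hull (real_vec ` G)" "\<tau> \<inter> uminus ` \<tau> = {0}"
    using cone_rational[OF \<tau>] unfolding rational_cone_def by metis
  obtain H where H: "H \<subseteq> real_vec ` G" "convex_cone hull H = \<tau>"
    "\<And>g. g \<in> H \<Longrightarrow> g \<noteq> 0 \<and> (convex_cone hull {g}) face_of \<tau>"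
    using pointed_cone_extreme_generators[of "real_vec ` G"] G by auto
  let ?P = "convex_cone hull ((\<lambda>s. real_vec (p s)) ` rays \<tau>)"
  have "H \<subseteq> ?P"
  proof
    fix h assume h: "h \<in> H"
    then obtain g where g: "h = real_vec g" "g \<noteq> 0" using H by (fastforce simp: real_vec_0)
    obtain k g' where k: "k > 0" "primitive g'" "g = k *s g'" using primitive_multiple[OF g(2)] by blast
    have hk: "h = of_int k *\<^sub>R real_vec g'" using g k by (simp add: real_vec_scale)
    have "(1 / of_int k) *\<^sub>R h = (1 / of_int k * of_int k) *\<^sub>R real_vec g'"
      unfolding hk by (rule scaleR_scaleR)
    moreover have "1 / of_int k * of_int k = (1 :: real)" using k(1) by simp
    ultimately have g'h: "real_vec g' = (1 / of_int k) *\<^sub>R h" by simp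
    have ray: "convex_cone hull {h} = convex_cone hull {real_vec g'}"
    proof
      have "of_int k *\<^sub>R real_vec g' \<in> convex_cone hull {real_vec g'}"
        using k by (intro convex_cone_hull_mul hull_inc) auto
      then show "convex_cone hull {h} \<subseteq> convex_cone hull {real_vec g'}"
        unfolding hk[symmetric] by (intro hull_minimal) (auto intro: convex_cone_convex_cone_hull)
      have "(1 / of_int k) *\<^sub>R h \<in> convex_cone hull {h}"
        using k by (intro convex_cone_hull_mul hull_inc) auto
      then show "convex_cone hull {real_vec g'} \<subseteq> convex_cone hull {h}"
        unfolding g'h[symmetric] by (intro hull_minimal) (auto intro: convex_cone_convex_cone_hull)
    qed
    have "convex_cone hull {h} \<in> \<Sigma>"
      using face_in_fan[OF \<tau>] H(3)[OF h] convex_cone_hull_nonempty by blast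
    then have "g' \<in> ray_generators \<Sigma>" using ray k by (simp add: ray_generators_def)
    then have "g' \<in> p ` {1..m}" using bij_betw_imp_surj_on[OF p_bij] by simp
    then obtain s where s: "s \<in> {1..m}" "p s = g'" by blast
    have "h \<in> \<tau>" using hull_inc[OF h, of convex_cone] H(2) by simp
    then have "real_vec g' \<in> \<tau>" unfolding g'h using convex_cone_scaleR[OF cone_convex[OF \<tau>]] k by simp
    then have "s \<in> rays \<tau>" using s by (simp add: rays_def)
    then have "real_vec g' \<in> ?P" using s by (auto intro!: hull_inc)
    then show "h \<in> ?P" unfolding hk using k by (intro convex_cone_hull_mul) auto
  qed
  then have "\<tau> \<subseteq> ?P"
    using hull_minimal[of H ?P convex_cone, OF _ convex_cone_convex_cone_hull] H(2) by simp
  moreover have "?P \<subseteq> \<tau>" using cone_convex[OF \<tau>] by (intro hull_minimal) (auto simp: rays_def)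
  ultimately have "\<tau> = ?P" by (rule equalityI)
  also note convex_cone_hull_family[OF finite_rays]
  finally show ?thesis .
qed

lemma cone_memberE:
  assumes "\<tau> \<in> \<Sigma>" "w \<in> \<tau>"
  obtains c where "w = (\<Sum>s\<in>rays \<tau>. c s *\<^sub>R real_vec (p s))" "\<And>s. 0 \<le> c s"
  using subsetD[OF equalityD1[OF cone_generated[OF assms(1)]] assms(2)] that by blast

lemma cone_sumI:
  assumes "\<tau> \<in> \<Sigma>" "I \<subseteq> rays \<tau>" "\<And>s. s \<in> I \<Longrightarrow> 0 \<le> c s"
  shows "(\<Sum>s\<in>I. c s *\<^sub>R real_vec (p s)) \<in> \<tau>"
  using assms cone_convex[OF assms(1)]
  by (intro convex_cone_sum convex_cone_scaleR) (auto simp: rays_def)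

lemma inner_cone_sum:
  "real_vec u \<bullet> (\<Sum>s\<in>S. c s *\<^sub>R real_vec (p s)) = (\<Sum>s\<in>S. c s * of_int (pairing u (p s)))"
  by (simp add: inner_sum_right real_vec_inner)

lemma dual_semigroup_iff:
  assumes "\<tau> \<in> \<Sigma>"
  shows "u \<in> dual_semigroup \<tau> \<longleftrightarrow> (\<forall>s\<in>rays \<tau>. 0 \<le> pairing u (p s))"
proof
  assume "u \<in> dual_semigroup \<tau>"
  then show "\<forall>s\<in>rays \<tau>. 0 \<le> pairing u (p s)"
    by (auto simp: dual_semigroup_def rays_def real_vec_inner dest!: bspec)
next
  assume u: "\<forall>s\<in>rays \<tau>. 0 \<le> pairing u (p s)"
  show "u \<in> dual_semigroup \<tau>" unfolding dual_semigroup_def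
  proof (intro CollectI ballI)
    fix w assume "w \<in> \<tau>"
    then obtain c where "w = (\<Sum>s\<in>rays \<tau>. c s *\<^sub>R real_vec (p s))" "\<And>s. 0 \<le> c s"
      using cone_memberE assms by metis
    then show "0 \<le> real_vec u \<bullet> w" using u by (simp add: inner_cone_sum sum_nonneg)
  qed
qed

lemma perp_iff:
  assumes "\<tau> \<in> \<Sigma>"
  shows "u \<in> perp \<tau> \<longleftrightarrow> (\<forall>s\<in>rays \<tau>. pairing u (p s) = 0)"
proof
  assume "u \<in> perp \<tau>"
  then show "\<forall>s\<in>rays \<tau>. pairing u (p s) = 0"
    by (auto simp: perp_def rays_def real_vec_inner dest!: bspec)
next
  assume u: "\<forall>s\<in>rays \<tau>. pairing u (p s) = 0"
  show "u \<in> perp \<tau>" unfolding perp_def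
  proof (intro CollectI ballI)
    fix w assume "w \<in> \<tau>"
    then obtain c where "w = (\<Sum>s\<in>rays \<tau>. c s *\<^sub>R real_vec (p s))" "\<And>s. 0 \<le> c s"
      using cone_memberE assms by metis
    then show "real_vec u \<bullet> w = 0" using u by (simp add: inner_cone_sum)
  qed
qed

lemma subcone_iff:
  assumes "\<tau> \<in> \<Sigma>" "\<sigma> \<in> \<Sigma>"
  shows "\<tau> \<subseteq> \<sigma> \<longleftrightarrow> rays \<tau> \<subseteq> rays \<sigma>"
proof
  assume r: "rays \<tau> \<subseteq> rays \<sigma>"
  show "\<tau> \<subseteq> \<sigma>"
  proof
    fix w assume "w \<in> \<tau>"
    then obtain c where "w = (\<Sum>s\<in>rays \<tau>. c s *\<^sub>R real_vec (p s))" "\<And>s. 0 \<le> c s"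
      using cone_memberE assms by metis
    then show "w \<in> \<sigma>" using cone_sumI[OF assms(2) r] by simp
  qed
qed (auto simp: rays_def)

lemma supporting_face:
  assumes "\<tau> \<in> \<Sigma>" "u \<in> dual_semigroup \<tau>"
  shows "\<tau> \<inter> {w. real_vec u \<bullet> w = 0} \<in> \<Sigma>"
proof (rule face_in_fan[OF assms(1)])
  have cc: "convex_cone \<tau>" by (rule cone_convex[OF assms(1)])
  show "(\<tau> \<inter> {w. real_vec u \<bullet> w = 0}) face_of \<tau>"
    by (rule face_of_Int_supporting_hyperplane_ge)
      (use cc assms(2) in \<open>auto simp: convex_cone_def dual_semigroup_def\<close>)
  show "\<tau> \<inter> {w. real_vec u \<bullet> w = 0} \<noteq> {}" using convex_cone_contains_0[OF cc] by force
qed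

text \<open>The cone meets \<open>\<sigma>\<close> in a face, and a face containing a sum contains its summands.\<close>

lemma face_rays:
  assumes "\<tau> \<in> \<Sigma>" "\<sigma> \<in> \<Sigma>" "\<And>s. s \<in> rays \<tau> \<Longrightarrow> 0 < c s" "(\<Sum>s\<in>rays \<tau>. c s *\<^sub>R real_vec (p s)) \<in> \<sigma>"
  shows "\<tau> \<subseteq> \<sigma>"
proof -
  let ?F = "\<tau> \<inter> \<sigma>"
  have F: "?F face_of \<tau>" "?F \<in> \<Sigma>" using Int_face Int_in_fan assms by auto
  note iff = convex_cone_face_of_iff[OF cone_convex[OF assms(1)] cone_convex[OF F(2)]]
  have "rays \<tau> \<subseteq> rays \<sigma>"
  proof
    fix s assume s: "s \<in> rays \<tau>"
    let ?r = "\<Sum>t\<in>rays \<tau> - {s}. c t *\<^sub>R real_vec (p t)"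
    have "c s *\<^sub>R real_vec (p s) + ?r \<in> ?F"
      using assms(4) cone_sumI[OF assms(1) order_refl, of c] assms(3) less_imp_le
      unfolding sum.remove[OF finite_rays s] by auto
    moreover have "c s *\<^sub>R real_vec (p s) \<in> \<tau>" "?r \<in> \<tau>"
      using cone_sumI[OF assms(1), of "{s}" c] cone_sumI[OF assms(1), of "rays \<tau> - {s}" c] s assms(3)
      by (auto simp: less_imp_le)
    ultimately have "c s *\<^sub>R real_vec (p s) \<in> \<sigma>" using F(1) iff by blast
    then have "(1 / c s) *\<^sub>R c s *\<^sub>R real_vec (p s) \<in> \<sigma>"
      using convex_cone_scaleR[OF cone_convex[OF assms(2)]] assms(3)[OF s] less_imp_le
      by (metis zero_le_divide_1_iff)
    then show "s \<in> rays \<sigma>" using s assms(3)[OF s] by (auto simp: rays_def)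
  qed
  then show ?thesis using subcone_iff assms by blast
qed

text \<open>Let \<open>w\<close> be the sum of the rays of \<open>\<tau>\<close> and let \<open>\<sigma>\<close> be a cone that contains \<open>w + p i\<close>. As \<open>e\<close> is
  \<open>-1\<close> on \<open>p i\<close> and nonnegative on all other rays, the ray \<open>p i\<close> belongs to \<open>\<sigma>\<close> and so does \<open>w\<close>. Hence \<open>\<tau>\<close> is a face of \<open>\<sigma>\<close>,
  and evaluating \<open>e\<close> shows that \<open>\<tau>\<close> together with \<open>p i\<close> generates a face of \<open>\<sigma>\<close>, too.\<close>

lemma root_extension:
  assumes i: "i \<in> {1..m}" and e: "e \<in> roots_at m p i" and \<tau>: "\<tau> \<in> \<Sigma>" "e \<in> perp \<tau>"
  shows "\<exists>\<tau>'\<in>\<Sigma>. rays \<tau>' = insert i (rays \<tau>)"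
proof -
  have ei: "pairing e (p i) = -1" and es: "\<And>s. s \<in> {1..m} \<Longrightarrow> s \<noteq> i \<Longrightarrow> 0 \<le> pairing e (p s)"
    using e by (auto simp: roots_at_def)
  have e0: "\<And>s. s \<in> rays \<tau> \<Longrightarrow> pairing e (p s) = 0" using perp_iff[OF \<tau>(1)] \<tau>(2) by blast
  let ?pi = "real_vec (p i)" and ?e = "real_vec e"
  define w where "w = (\<Sum>s\<in>rays \<tau>. 1 *\<^sub>R real_vec (p s))"
  have epi: "?e \<bullet> ?pi = -1" using ei by (simp add: real_vec_inner)
  have ew: "?e \<bullet> w = 0" unfolding w_def inner_cone_sum using e0 by simp
  obtain \<sigma> where \<sigma>: "\<sigma> \<in> \<Sigma>" "w + ?pi \<in> \<sigma>" using complete unfolding complete_fan_def by blast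
  have cc: "convex_cone \<sigma>" by (rule cone_convex[OF \<sigma>(1)])
  \<comment> \<open>Every point of \<open>\<sigma>\<close> splits into a multiple of \<open>p i\<close> and a point on which \<open>e\<close> is nonnegative.\<close>
  have split: "\<exists>c y. x = c *\<^sub>R ?pi + y \<and> 0 \<le> c \<and> y \<in> \<sigma> \<and> 0 \<le> ?e \<bullet> y \<and> (0 < c \<longrightarrow> ?pi \<in> \<sigma>)"
    if x\<sigma>: "x \<in> \<sigma>" for x
  proof -
    obtain c where c: "x = (\<Sum>s\<in>rays \<sigma>. c s *\<^sub>R real_vec (p s))" "\<And>s. 0 \<le> c s"
      using cone_memberE[OF \<sigma>(1) x\<sigma>] by metis
    let ?y = "\<Sum>s\<in>rays \<sigma> - {i}. c s *\<^sub>R real_vec (p s)"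
    have y: "?y \<in> \<sigma>" using cone_sumI[OF \<sigma>(1), of "rays \<sigma> - {i}" c] c by auto
    have ey: "0 \<le> ?e \<bullet> ?y" unfolding inner_cone_sum
      using c es rays_subset[of \<sigma>] by (intro sum_nonneg mult_nonneg_nonneg) (auto simp: subset_iff)
    show ?thesis
    proof (cases "i \<in> rays \<sigma>")
      case True
      then have "x = c i *\<^sub>R ?pi + ?y" using c sum.remove[OF finite_rays True] by simp
      moreover have "?pi \<in> \<sigma>" using True by (simp add: rays_def)
      ultimately show ?thesis using y ey c by blast
    next
      case False
      then show ?thesis using y ey c by (intro exI[of _ 0] exI[of _ x]) auto
    qed
  qed
  obtain c y where cy: "w + ?pi = c *\<^sub>R ?pi + y" "0 \<le> c" "y \<in> \<sigma>" "0 \<le> ?e \<bullet> y" "0 < c \<longrightarrow> ?pi \<in> \<sigma>"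
    using split[OF \<sigma>(2)] by blast
  have "?e \<bullet> (w + ?pi) = ?e \<bullet> (c *\<^sub>R ?pi + y)" using cy(1) by simp
  then have "1 \<le> c" using ew epi cy(4) by (simp add: inner_add_right)
  then have pi\<sigma>: "?pi \<in> \<sigma>" using cy by auto
  have "w = (c - 1) *\<^sub>R ?pi + y" using cy(1) by (simp add: algebra_simps)
  then have w\<sigma>: "w \<in> \<sigma>" using convex_cone_add[OF cc _ cy(3)] convex_cone_scaleR[OF cc _ pi\<sigma>] \<open>1 \<le> c\<close> by simp
  have \<tau>\<sigma>: "\<tau> \<subseteq> \<sigma>" using face_rays[OF \<tau>(1) \<sigma>(1), of "\<lambda>_. 1"] w\<sigma> by (simp add: w_def)
  then have \<tau>face: "\<tau> face_of \<sigma>" using subcone_face \<tau> \<sigma> by blast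
  note \<tau>iff = convex_cone_face_of_iff[OF cc cone_convex[OF \<tau>(1)]]
  let ?\<tau>' = "{t + c *\<^sub>R ?pi | t c. t \<in> \<tau> \<and> 0 \<le> c}"
  have \<tau>c: "convex_cone \<tau>" by (rule cone_convex[OF \<tau>(1)])
  have \<tau>'c: "convex_cone ?\<tau>'" unfolding convex_cone_iff
  proof (intro conjI ballI allI impI)
    show "0 \<in> ?\<tau>'" using convex_cone_contains_0[OF \<tau>c] by force
  next
    fix x y assume "x \<in> ?\<tau>'" "y \<in> ?\<tau>'"
    then obtain t c t' c' where "x = t + c *\<^sub>R ?pi" "y = t' + c' *\<^sub>R ?pi" "t \<in> \<tau>" "t' \<in> \<tau>" "0 \<le> c" "0 \<le> c'"
      by blast
    then have "x + y = (t + t') + (c + c') *\<^sub>R ?pi" "t + t' \<in> \<tau>" "0 \<le> c + c'"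
      using convex_cone_add[OF \<tau>c] by (auto simp: algebra_simps)
    then show "x + y \<in> ?\<tau>'" by blast
  next
    fix x and k :: real assume "x \<in> ?\<tau>'" "0 \<le> k"
    then obtain t c where "x = t + c *\<^sub>R ?pi" "t \<in> \<tau>" "0 \<le> c" by blast
    then have "k *\<^sub>R x = k *\<^sub>R t + (k * c) *\<^sub>R ?pi" "k *\<^sub>R t \<in> \<tau>" "0 \<le> k * c"
      using convex_cone_scaleR[OF \<tau>c] \<open>0 \<le> k\<close> by (auto simp: algebra_simps)
    then show "k *\<^sub>R x \<in> ?\<tau>'" by blast
  qed
  have et: "\<And>t. t \<in> \<tau> \<Longrightarrow> ?e \<bullet> t = 0" using \<tau>(2) by (auto simp: perp_def)
  have "?\<tau>' face_of \<sigma>" unfolding convex_cone_face_of_iff[OF cc \<tau>'c]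
  proof (intro conjI)
    show "?\<tau>' \<subseteq> \<sigma>" using \<tau>\<sigma> pi\<sigma> convex_cone_add[OF cc] convex_cone_scaleR[OF cc] by blast
    have "a \<in> ?\<tau>' \<and> b \<in> ?\<tau>'" if ab: "a \<in> \<sigma>" "b \<in> \<sigma>" "a + b \<in> ?\<tau>'" for a b
    proof -
      obtain t d where t: "a + b = t + d *\<^sub>R ?pi" "t \<in> \<tau>" "0 \<le> d" using ab(3) by blast
      obtain ca ya where A: "a = ca *\<^sub>R ?pi + ya" "0 \<le> ca" "ya \<in> \<sigma>" "0 \<le> ?e \<bullet> ya"
        using split[OF ab(1)] by blast
      obtain cb yb where B: "b = cb *\<^sub>R ?pi + yb" "0 \<le> cb" "yb \<in> \<sigma>" "0 \<le> ?e \<bullet> yb"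
        using split[OF ab(2)] by blast
      have "?e \<bullet> (ca *\<^sub>R ?pi + ya + (cb *\<^sub>R ?pi + yb)) = ?e \<bullet> (t + d *\<^sub>R ?pi)" using t A B by simp
      then have "- ca + ?e \<bullet> ya - cb + ?e \<bullet> yb = - d" using et[OF t(2)] epi by (simp add: inner_add_right)
      then have k: "0 \<le> ca + cb - d" using A B by linarith
      have "t = (ya + yb) + (ca + cb - d) *\<^sub>R ?pi" using t A B by (simp add: algebra_simps)
      moreover have "ya + yb \<in> \<sigma>" "(ca + cb - d) *\<^sub>R ?pi \<in> \<sigma>"
        using convex_cone_add[OF cc] A B convex_cone_scaleR[OF cc k pi\<sigma>] by auto
      ultimately have "ya + yb \<in> \<tau>" using \<tau>face \<tau>iff t(2) by metis
      then have "ya \<in> \<tau>" "yb \<in> \<tau>" using \<tau>face \<tau>iff A(3) B(3) by auto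
      then show ?thesis using A(1,2) B(1,2) by (auto simp: add.commute)
    qed
    then show "\<forall>a\<in>\<sigma>. \<forall>b\<in>\<sigma>. a + b \<in> ?\<tau>' \<longrightarrow> a \<in> ?\<tau>' \<and> b \<in> ?\<tau>'" by blast
  qed
  then have in_fan: "?\<tau>' \<in> \<Sigma>" using face_in_fan[OF \<sigma>(1)] convex_cone_nonempty[OF \<tau>'c] by blast
  have "rays ?\<tau>' = insert i (rays \<tau>)"
  proof
    show "insert i (rays \<tau>) \<subseteq> rays ?\<tau>'"
    proof
      fix s assume "s \<in> insert i (rays \<tau>)"
      then consider "s = i" | "s \<in> rays \<tau>" by blast
      then show "s \<in> rays ?\<tau>'"
      proof cases
        case 1
        have "?pi = 0 + 1 *\<^sub>R ?pi" by simp
        then have "?pi \<in> ?\<tau>'" using convex_cone_contains_0[OF \<tau>c] zero_le_one by blast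
        then show ?thesis using 1 i by (simp add: rays_def)
      next
        case 2
        then have "real_vec (p s) \<in> \<tau>" "s \<in> {1..m}" by (auto simp: rays_def)
        moreover have "real_vec (p s) = real_vec (p s) + 0 *\<^sub>R ?pi" by simp
        ultimately have "real_vec (p s) \<in> ?\<tau>'" by blast
        then show ?thesis using \<open>s \<in> {1..m}\<close> by (simp add: rays_def)
      qed
    qed
    show "rays ?\<tau>' \<subseteq> insert i (rays \<tau>)"
    proof
      fix s assume "s \<in> rays ?\<tau>'"
      then obtain t c where s: "s \<in> {1..m}" "real_vec (p s) = t + c *\<^sub>R ?pi" "t \<in> \<tau>" "0 \<le> c"
        by (auto simp: rays_def)
      show "s \<in> insert i (rays \<tau>)"
      proof (cases "s = i")
        case False
        have "?e \<bullet> real_vec (p s) = - c" using s et epi by (simp add: inner_add_right)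
        then have "real_of_int (pairing e (p s)) = - c" by (simp add: real_vec_inner)
        then have "c = 0" using es[OF s(1) False] s(4) by linarith
        then show ?thesis using s by (simp add: rays_def)
      qed simp
    qed
  qed
  then show ?thesis using in_fan by blast
qed

end

section \<open>Roots of a bilateral fan\<close>

locale bilateral_fan = toric_fan \<Sigma> m p
  for \<Sigma> :: "(real ^ 'n) set set" and m :: nat and p :: "nat \<Rightarrow> int ^ 'n" +
  fixes n :: nat and a :: "nat \<Rightarrow> nat \<Rightarrow> nat" and q :: "nat \<Rightarrow> int ^ 'n"
  assumes bilateral: "bilateral_numbering \<Sigma> n m p a" and dual: "dual_basis n p q"
begin

lemma n_le_m: "n \<le> m"
  using bilateral by (simp add: bilateral_numbering_def)

lemma p_above: "k \<in> {n<..m} \<Longrightarrow> p k = - (\<Sum>j=1..n. int (a k j) *s p j)"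
  using bilateral by (simp add: bilateral_numbering_def)

lemma q_p: "i \<in> {1..n} \<Longrightarrow> j \<in> {1..n} \<Longrightarrow> pairing (q i) (p j) = (if i = j then 1 else 0)"
  using dual by (simp add: dual_basis_def)

lemma pairing_above: "k \<in> {n<..m} \<Longrightarrow> pairing u (p k) = - (\<Sum>j=1..n. int (a k j) * pairing u (p j))"
  by (simp add: p_above pairing_minus_right pairing_sum_right pairing_scale_right)

lemma q_p_above: "i \<in> {1..n} \<Longrightarrow> k \<in> {n<..m} \<Longrightarrow> pairing (q i) (p k) = - int (a k i)"
  by (simp add: pairing_above q_p if_distrib cong: if_cong)

lemma lattice_eqI:
  assumes "\<And>j. j \<in> {1..n} \<Longrightarrow> pairing u (p j) = pairing u' (p j)"
  shows "u = u'"
proof -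
  have "u $ i = u' $ i" for i
  proof -
    have "bij_betw (\<lambda>c :: nat \<Rightarrow> int. \<Sum>j=1..n. c j *s p j) ({1..n} \<rightarrow>\<^sub>E UNIV) UNIV"
      using bilateral by (simp add: bilateral_numbering_def lattice_basis_def)
    then have "axis i 1 \<in> (\<lambda>c :: nat \<Rightarrow> int. \<Sum>j=1..n. c j *s p j) ` ({1..n} \<rightarrow>\<^sub>E UNIV)"
      by (simp add: bij_betw_def)
    then obtain c :: "nat \<Rightarrow> int" where "axis i 1 = (\<Sum>j=1..n. c j *s p j)" by blast
    then have "pairing u (axis i 1) = pairing u' (axis i 1)"
      using assms by (simp add: pairing_sum_right pairing_scale_right)
    then show ?thesis by (simp add: pairing_axis)
  qed
  then show ?thesis by (simp add: vec_eq_iff)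
qed

lemma lattice_expand: "u = (\<Sum>j=1..n. pairing u (p j) *s q j)"
  by (rule lattice_eqI)
    (simp add: pairing_sum_left pairing_scale_left q_p if_distrib cong: if_cong)

lemma indices_split: "s \<in> {1..m} \<Longrightarrow> s \<in> {1..n} \<or> s \<in> {n<..m}" by auto

text \<open>A cone that contains \<open>p 1 + \<dots> + p n\<close> contains each \<open>p j\<close>, \<open>j \<le> n\<close>, as only \<open>p j\<close> pairs positively
  with \<open>q j\<close>. By pointedness it contains no other ray, because these are negative combinations of \<open>p 1, \<dots>, p n\<close>.\<close>

lemma basis_cone: "\<exists>\<sigma>\<in>\<Sigma>. rays \<sigma> = {1..n}"
proof -
  let ?w = "\<Sum>j=1..n. real_vec (p j)"
  obtain \<sigma> where \<sigma>: "\<sigma> \<in> \<Sigma>" "?w \<in> \<sigma>" using complete unfolding complete_fan_def by blast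
  obtain c where c: "?w = (\<Sum>s\<in>rays \<sigma>. c s *\<^sub>R real_vec (p s))" "\<And>s. 0 \<le> c s"
    using cone_memberE[OF \<sigma>] by metis
  have basis: "j \<in> rays \<sigma>" if j: "j \<in> {1..n}" for j
  proof (rule ccontr)
    assume nj: "j \<notin> rays \<sigma>"
    have "real_vec (q j) \<bullet> ?w = (\<Sum>s=1..n. of_int (pairing (q j) (p s)))"
      by (simp add: inner_sum_right real_vec_inner)
    also have "\<dots> = 1" using j by (simp add: q_p if_distrib cong: if_cong)
    finally have "(\<Sum>s\<in>rays \<sigma>. c s * of_int (pairing (q j) (p s))) = 1"
      unfolding c(1) inner_cone_sum .
    moreover have "(\<Sum>s\<in>rays \<sigma>. c s * of_int (pairing (q j) (p s))) \<le> 0"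
    proof (rule sum_nonpos)
      fix s assume s: "s \<in> rays \<sigma>"
      have "pairing (q j) (p s) \<le> 0"
        using indices_split[OF subsetD[OF rays_subset s]] q_p[OF j, of s] q_p_above[OF j, of s] s nj by auto
      then show "c s * of_int (pairing (q j) (p s)) \<le> 0" using c(2)[of s] by (simp add: mult_nonneg_nonpos)
    qed
    ultimately show False by simp
  qed
  have "k \<notin> rays \<sigma>" if k: "k \<in> {n<..m}" for k
  proof
    assume kr: "k \<in> rays \<sigma>"
    have "real_vec (p k) = - (\<Sum>j=1..n. real (a k j) *\<^sub>R real_vec (p j))"
      by (simp add: p_above[OF k] real_vec_minus real_vec_sum real_vec_scale)
    moreover have "(\<Sum>j=1..n. real (a k j) *\<^sub>R real_vec (p j)) \<in> \<sigma>"
      using basis by (intro cone_sumI[OF \<sigma>(1)]) auto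
    ultimately have "- real_vec (p k) \<in> \<sigma>" by simp
    then have "real_vec (p k) = 0" using cone_pointed[OF \<sigma>(1)] kr by (simp add: rays_def)
    then show False using p_nonzero[of k] k real_vec_eq_0_iff by auto
  qed
  then have "rays \<sigma> = {1..n}" using basis rays_subset[of \<sigma>] indices_split by blast
  then show ?thesis using \<sigma> by blast
qed

text \<open>Otherwise \<open>q j\<close> would be nonnegative on all rays, contrary to completeness.\<close>

lemma column_nonzero:
  assumes j: "j \<in> {1..n}"
  shows "\<exists>k\<in>{n<..m}. 0 < a k j"
proof (rule ccontr)
  assume "\<not> ?thesis"
  then have z: "\<And>k. k \<in> {n<..m} \<Longrightarrow> a k j = 0" by auto
  obtain \<sigma> where \<sigma>: "\<sigma> \<in> \<Sigma>" "- real_vec (p j) \<in> \<sigma>" using complete unfolding complete_fan_def by blast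
  obtain c where c: "- real_vec (p j) = (\<Sum>s\<in>rays \<sigma>. c s *\<^sub>R real_vec (p s))" "\<And>s. 0 \<le> c s"
    using cone_memberE[OF \<sigma>] by metis
  have "real_vec (q j) \<bullet> (- real_vec (p j)) = -1" using j by (simp add: real_vec_inner q_p)
  then have "(\<Sum>s\<in>rays \<sigma>. c s * of_int (pairing (q j) (p s))) = -1"
    unfolding c(1) inner_cone_sum .
  moreover have "0 \<le> (\<Sum>s\<in>rays \<sigma>. c s * of_int (pairing (q j) (p s)))"
  proof (rule sum_nonneg)
    fix s assume s: "s \<in> rays \<sigma>"
    have "0 \<le> pairing (q j) (p s)"
      using indices_split[OF subsetD[OF rays_subset s]] z[of s] q_p[OF j, of s] q_p_above[OF j, of s] by auto
    then show "0 \<le> c s * of_int (pairing (q j) (p s))" using c(2)[of s] by simp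
  qed
  ultimately show False by simp
qed

lemma roots_at_index_unique:
  "e \<in> roots_at m p i \<Longrightarrow> e \<in> roots_at m p j \<Longrightarrow> i \<in> {1..m} \<Longrightarrow> j \<in> {1..m} \<Longrightarrow> i = j"
  unfolding roots_at_def by force

lemma root_at_inequality:
  assumes "e \<in> roots_at m p i" "i \<in> {1..n}" "k \<in> {n<..m}"
  shows "(\<Sum>j\<in>{1..n}-{i}. int (a k j) * pairing e (p j)) \<le> int (a k i)"
proof -
  have "0 \<le> pairing e (p k)" using assms by (auto simp: roots_at_def)
  also have "pairing e (p k) = - (\<Sum>j=1..n. int (a k j) * pairing e (p j))" by (rule pairing_above[OF assms(3)])
  also have "(\<Sum>j=1..n. int (a k j) * pairing e (p j)) =
     int (a k i) * pairing e (p i) + (\<Sum>j\<in>{1..n}-{i}. int (a k j) * pairing e (p j))"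
    using assms by (intro sum.remove) auto
  finally show ?thesis using assms by (simp add: roots_at_def)
qed

lemma root_at_summand:
  assumes "e \<in> roots_at m p i" "i \<in> {1..n}" "k \<in> {n<..m}" "J \<subseteq> {1..n} - {i}"
  shows "(\<Sum>j\<in>J. int (a k j) * pairing e (p j)) \<le> int (a k i)"
proof -
  have "(\<Sum>j\<in>J. int (a k j) * pairing e (p j)) \<le> (\<Sum>j\<in>{1..n}-{i}. int (a k j) * pairing e (p j))"
    using assms n_le_m by (intro sum_mono2) (auto simp: roots_at_def)
  then show ?thesis using root_at_inequality[OF assms(1-3)] by linarith
qed

text \<open>This bound makes the set of roots finite.\<close>

lemma root_coefficient_le:
  assumes "e \<in> roots_at m p i" "i \<in> {1..n}" "j \<in> {1..n}" "j \<noteq> i"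
  shows "\<exists>k\<in>{n<..m}. pairing e (p j) \<le> int (a k i)"
proof -
  obtain k where k: "k \<in> {n<..m}" "0 < a k j" using column_nonzero[OF assms(3)] by blast
  have "int (a k j) * pairing e (p j) \<le> int (a k i)"
    using root_at_summand[OF assms(1,2) k(1), of "{j}"] assms by simp
  moreover have "0 \<le> pairing e (p j)" using assms n_le_m by (auto simp: roots_at_def)
  then have "pairing e (p j) \<le> int (a k j) * pairing e (p j)"
    using k mult_right_mono[of 1 "int (a k j)" "pairing e (p j)"] by simp
  ultimately show ?thesis using k by (meson order_trans)
qed

text \<open>The roots of the derivations \<open>x\<^sup>b \<partial>/\<partial>x i\<close>, \<open>i \<le> n\<close>, whose monomial involves, of the first
  \<open>n\<close> variables, only those with index above \<open>i\<close>.\<close>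

definition triangular_roots :: "(int ^ 'n) set" where
  "triangular_roots = {e. \<exists>i\<in>{1..n}. e \<in> roots_at m p i \<and> (\<forall>j\<in>{1..<i}. pairing e (p j) = 0)}"

lemma triangular_roots_subset: "triangular_roots \<subseteq> roots m p"
  using n_le_m unfolding triangular_roots_def roots_def by fastforce

text \<open>The nonnegative integers \<open>a i j * \<langle>e, p j\<rangle>\<close> add up to \<open>1\<close>, so exactly one of them is \<open>1\<close>, and on all other
  indices nonzero columns force \<open>\<langle>e, p s\<rangle>\<close> to vanish.\<close>

lemma root_above_is_dual_vector:
  assumes i: "i \<in> {n<..m}" and e: "e \<in> roots_at m p i"
  shows "\<exists>j\<in>{1..n}. e = q j"
proof -
  have ei: "pairing e (p i) = -1" and es: "\<And>s. s \<in> {1..m} \<Longrightarrow> s \<noteq> i \<Longrightarrow> 0 \<le> pairing e (p s)"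
    using e by (auto simp: roots_at_def)
  have nonneg: "0 \<le> pairing e (p j)" if "j \<in> {1..n}" for j
    using es[of j] that i n_le_m by auto
  have sum1: "(\<Sum>j=1..n. int (a i j) * pairing e (p j)) = 1" using pairing_above[OF i, of e] ei by simp
  have zero: "int (a k j) * pairing e (p j) = 0" if "k \<in> {n<..m}" "k \<noteq> i" "j \<in> {1..n}" for k j
  proof -
    have "(\<Sum>j=1..n. int (a k j) * pairing e (p j)) \<le> 0" using pairing_above[OF that(1), of e] es[of k] that by auto
    moreover have "\<forall>j\<in>{1..n}. 0 \<le> int (a k j) * pairing e (p j)" using nonneg by simp
    ultimately show ?thesis using sum_nonneg_eq_0_iff[of "{1..n}" "\<lambda>j. int (a k j) * pairing e (p j)"] that
      by (metis (no_types, lifting) finite_atLeastAtMost order_antisym sum_nonneg)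
  qed
  have "\<exists>j\<in>{1..n}. int (a i j) * pairing e (p j) \<noteq> 0"
  proof (rule ccontr)
    assume "\<not> ?thesis"
    then have "(\<Sum>j=1..n. int (a i j) * pairing e (p j)) = 0" by (intro sum.neutral) auto
    then show False using sum1 by simp
  qed
  then obtain j where j: "j \<in> {1..n}" "int (a i j) * pairing e (p j) \<noteq> 0" by blast
  have split: "1 = int (a i j) * pairing e (p j) + (\<Sum>s\<in>{1..n}-{j}. int (a i s) * pairing e (p s))"
    using sum1 sum.remove[of "{1..n}" j "\<lambda>s. int (a i s) * pairing e (p s)"] j by simp
  have rest: "0 \<le> (\<Sum>s\<in>{1..n}-{j}. int (a i s) * pairing e (p s))" using nonneg by (intro sum_nonneg) auto
  have pos: "1 \<le> int (a i j) * pairing e (p j)" using j nonneg[OF j(1)]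
    by (metis int_one_le_iff_zero_less less_le mult_nonneg_nonneg of_nat_0_le_iff)
  then have one: "int (a i j) * pairing e (p j) = 1" and
    rest0: "(\<Sum>s\<in>{1..n}-{j}. int (a i s) * pairing e (p s)) = 0" using split rest by linarith+
  have ej: "pairing e (p j) = 1" using one nonneg[OF j(1)]
    by (metis abs_of_nonneg abs_zmult_eq_1 abs_mult_pos mult.commute abs_one)
  have "pairing e (p s) = 0" if s: "s \<in> {1..n}" "s \<noteq> j" for s
  proof -
    obtain k where k: "k \<in> {n<..m}" "0 < a k s" using column_nonzero[OF s(1)] by blast
    show ?thesis
    proof (cases "k = i")
      case True
      have "int (a i s) * pairing e (p s) = 0"
        using sum_nonneg_eq_0_iff[of "{1..n}-{j}" "\<lambda>s. int (a i s) * pairing e (p s)"] rest0 nonneg s by auto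
      then show ?thesis using True k by simp
    next
      case False
      then show ?thesis using zero[OF k(1) False s(1)] k by simp
    qed
  qed
  then have "e = q j" using ej q_p j by (intro lattice_eqI) auto
  then show ?thesis using j by blast
qed

lemma neg_dual_vector_root:
  assumes "j \<in> {1..n}"
  shows "- q j \<in> roots_at m p j"
proof -
  have "0 \<le> pairing (- q j) (p s)" if "s \<in> {1..m}" "s \<noteq> j" for s
    using indices_split[OF that(1)] q_p[OF assms] q_p_above[OF assms] that by (auto simp: pairing_minus_left)
  then show ?thesis using assms q_p by (auto simp: roots_at_def pairing_minus_left)
qed

lemma class_of_index:
  fixes c :: "nat \<Rightarrow> nat"
  assumes "c 0 = 0" "c r = n" "i \<in> {1..n}"
  shows "\<exists>l\<in>{1..r}. i \<in> {c (l - 1)<..c l}"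
proof -
  let ?l = "LEAST l. i \<le> c l"
  have ex: "i \<le> c r" using assms by auto
  have l: "i \<le> c ?l" "?l \<le> r" using LeastI[of "\<lambda>l. i \<le> c l", OF ex] Least_le[of "\<lambda>l. i \<le> c l", OF ex] by auto
  have l0: "?l \<noteq> 0" using l(1) assms by (metis atLeastAtMost_iff not_one_le_zero le_zero_eq)
  then have "\<not> i \<le> c (?l - 1)" using not_less_Least[of "?l - 1" "\<lambda>l. i \<le> c l"] by auto
  then show ?thesis using l l0 by (intro bexI[of _ ?l]) auto
qed

lemma preord_index_less:
  assumes oc: "ordered_classes n m a r c" and ij: "i \<in> {1..n}" "j \<in> {1..n}"
    and pre: "preord n m a i j" "\<not> preord_equiv n m a i j"
  shows "i < j"
proof -
  have c: "c 0 = 0" "c r = n" "\<And>s. s < r \<Longrightarrow> c s < c (Suc s)" using oc by (auto simp: ordered_classes_def)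
  obtain l s where ls: "l \<in> {1..r}" "s \<in> {1..r}" "i \<in> {c (l - 1)<..c l}" "j \<in> {c (s - 1)<..c s}"
    using class_of_index[of c r] c ij by metis
  then have "l < s" using oc pre unfolding ordered_classes_def by blast
  then have "l \<le> s - 1" "s - 1 \<le> r" using ls by auto
  moreover have "c l \<le> c t" if "l \<le> t" "t \<le> r" for t
    using that
  proof (induction t)
    case (Suc t)
    then show ?case using c(3)[of t] by (cases "l = Suc t") auto
  qed simp
  ultimately have "c l \<le> c (s - 1)" by blast
  then show ?thesis using ls by auto
qed

text \<open>If \<open>\<langle>e, p j\<rangle> > 0\<close> for a root \<open>e\<close> at \<open>i \<le> n\<close>, then column \<open>i\<close> dominates column \<open>j\<close>. For \<open>j < i\<close> the order of the
  classes makes the columns equal, which leaves only the semisimple root \<open>q j - q i\<close>, and this one is negative on \<open>v\<close>.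
  Roots at \<open>i > n\<close> are the vectors \<open>q j\<close>, which are semisimple and negative on \<open>v\<close> as well.\<close>

lemma positive_roots_eq:
  assumes oc: "ordered_classes n m a r c"
    and v: "\<forall>i\<in>{1..n}. \<forall>j\<in>{1..n}. i < j \<longrightarrow> pairing (q i) v < pairing (q j) v"
    and vneg: "\<forall>i\<in>{1..n}. pairing (q i) v < 0"
  shows "positive_roots m p v = triangular_roots"
proof
  show "triangular_roots \<subseteq> positive_roots m p v"
  proof
    fix e assume eP: "e \<in> triangular_roots"
    then obtain i where i: "i \<in> {1..n}" "e \<in> roots_at m p i" "\<And>j. j \<in> {1..<i} \<Longrightarrow> pairing e (p j) = 0"
      by (auto simp: triangular_roots_def)
    have er: "e \<in> roots m p" using eP triangular_roots_subset by blast
    have ei: "pairing e (p i) = -1" and es: "\<And>s. s \<in> {1..m} \<Longrightarrow> s \<noteq> i \<Longrightarrow> 0 \<le> pairing e (p s)"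
      using i by (auto simp: roots_at_def)
    have im: "i \<in> {1..m}" using i n_le_m by auto
    show "e \<in> positive_roots m p v"
    proof (cases "e \<in> semisimple_roots m p")
      case False
      then show ?thesis using er by (auto simp: positive_roots_def unipotent_roots_def)
    next
      case True
      then have "- e \<in> roots m p" by (auto simp: semisimple_roots_def)
      then obtain j where j: "j \<in> {1..m}" "- e \<in> roots_at m p j" by (auto simp: roots_def)
      have ej: "pairing e (p j) = 1" and esj: "\<And>s. s \<in> {1..m} \<Longrightarrow> s \<noteq> j \<Longrightarrow> pairing e (p s) \<le> 0"
        using j by (force simp: roots_at_def pairing_minus_left)+
      have ij: "i \<noteq> j" using ei ej by auto
      have e0: "pairing e (p s) = 0" if "s \<in> {1..m}" "s \<noteq> i" "s \<noteq> j" for s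
        using es[of s] esj[of s] that by force
      have "pairing e v > 0"
      proof (cases "j \<le> n")
        case True
        have "e = q j - q i"
        proof (rule lattice_eqI)
          fix s assume s: "s \<in> {1..n}"
          show "pairing e (p s) = pairing (q j - q i) (p s)"
            using s True j i q_p ei ej e0[of s] ij n_le_m by (auto simp: pairing_diff_left)
        qed
        moreover have "i < j" using i(3)[of j] ej j ij True by (metis atLeastAtMost_iff atLeastLessThan_iff linorder_neqE_nat zero_neq_one)
        ultimately show ?thesis using v i True j by (auto simp: pairing_diff_left)
      next
        case False
        have "e = - q i"
        proof (rule lattice_eqI)
          fix s assume s: "s \<in> {1..n}"
          show "pairing e (p s) = pairing (- q i) (p s)"
            using s False i q_p ei e0[of s] n_le_m by (auto simp: pairing_minus_left)
        qed
        then show ?thesis using vneg i by (auto simp: pairing_minus_left)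
      qed
      then show ?thesis using True by (auto simp: positive_roots_def)
    qed
  qed
  show "positive_roots m p v \<subseteq> triangular_roots"
  proof
    fix e assume pos: "e \<in> positive_roots m p v"
    then have notneg: "\<not> (e \<in> semisimple_roots m p \<and> pairing e v \<le> 0)"
      by (auto simp: positive_roots_def unipotent_roots_def)
    have er: "e \<in> roots m p" using pos
      by (auto simp: positive_roots_def unipotent_roots_def semisimple_roots_def)
    then obtain i where i: "i \<in> {1..m}" "e \<in> roots_at m p i" by (auto simp: roots_def)
    have ei: "pairing e (p i) = -1" and es: "\<And>s. s \<in> {1..m} \<Longrightarrow> s \<noteq> i \<Longrightarrow> 0 \<le> pairing e (p s)"
      using i by (auto simp: roots_at_def)
    have ss: "e \<in> semisimple_roots m p" if "j \<in> {1..m}" "- e \<in> roots_at m p j" for j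
    proof -
      have "- e \<in> roots m p" using that by (auto simp: roots_def)
      then have "e \<in> uminus ` roots m p" by (metis image_eqI minus_minus)
      then show ?thesis using er by (simp add: semisimple_roots_def)
    qed
    have iN: "i \<in> {1..n}"
    proof (rule ccontr)
      assume "i \<notin> {1..n}"
      then have "i \<in> {n<..m}" using i by auto
      then obtain j where j: "j \<in> {1..n}" "e = q j" using root_above_is_dual_vector i by blast
      then have "e \<in> semisimple_roots m p" using ss[of j] neg_dual_vector_root n_le_m by auto
      moreover have "pairing e v < 0" using vneg j by auto
      ultimately show False using notneg by auto
    qed
    have "pairing e (p j) = 0" if j: "j \<in> {1..<i}" for j
    proof (rule ccontr)
      assume nz: "pairing e (p j) \<noteq> 0"
      have jN: "j \<in> {1..n}" "j \<noteq> i" "j < i" using j iN by auto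
      have ej: "1 \<le> pairing e (p j)" using nz es[of j] jN n_le_m by force
      have le: "int (a k j) + int (a k s) * pairing e (p s) \<le> int (a k i)"
        if k: "k \<in> {n<..m}" and s: "s \<in> {1..n}" "s \<noteq> i" "s \<noteq> j" for k s
      proof -
        have "int (a k j) * pairing e (p j) + int (a k s) * pairing e (p s) \<le> int (a k i)"
          using root_at_summand[OF i(2) iN k, of "{j, s}"] s jN by auto
        moreover have "int (a k j) \<le> int (a k j) * pairing e (p j)" using ej mult_left_mono[of 1 "pairing e (p j)" "int (a k j)"] by simp
        ultimately show ?thesis by linarith
      qed
      have lej: "int (a k j) * pairing e (p j) \<le> int (a k i)" if k: "k \<in> {n<..m}" for k
        using root_at_summand[OF i(2) iN k, of "{j}"] jN by auto
      have "int (a k j) \<le> int (a k i)" if k: "k \<in> {n<..m}" for k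
        using lej[OF k] ej mult_left_mono[of 1 "pairing e (p j)" "int (a k j)"] by simp
      then have pre: "preord n m a i j" by (auto simp: preord_def)
      have equiv: "preord_equiv n m a i j" using preord_index_less[OF oc iN jN(1) pre] jN(3) by auto
      then have aeq: "\<And>k. k \<in> {n<..m} \<Longrightarrow> a k i = a k j" by (auto simp: preord_equiv_def)
      obtain k0 where k0: "k0 \<in> {n<..m}" "0 < a k0 j" using column_nonzero[OF jN(1)] by blast
      have "int (a k0 j) * pairing e (p j) \<le> int (a k0 j) * 1" using lej[OF k0(1)] aeq[OF k0(1)] by simp
      then have ej1: "pairing e (p j) = 1" using k0 ej by (simp add: mult_le_cancel_left)
      have e0: "pairing e (p s) = 0" if s: "s \<in> {1..n}" "s \<noteq> i" "s \<noteq> j" for s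
      proof -
        obtain k where k: "k \<in> {n<..m}" "0 < a k s" using column_nonzero[OF s(1)] by blast
        have "int (a k s) * pairing e (p s) \<le> 0" using le[OF k(1) s] aeq[OF k(1)] by simp
        then show ?thesis using k es[of s] s n_le_m by (force simp: mult_le_0_iff)
      qed
      have e: "e = q j - q i"
      proof (rule lattice_eqI)
        fix s assume s: "s \<in> {1..n}"
        show "pairing e (p s) = pairing (q j - q i) (p s)"
          using s jN iN q_p ei ej1 e0[of s] by (auto simp: pairing_diff_left)
      qed
      have "- e \<in> roots_at m p j"
      proof -
        have "0 \<le> pairing (- e) (p s)" if s: "s \<in> {1..m}" "s \<noteq> j" for s
          using indices_split[OF s(1)] s q_p[of _ s] q_p_above[of _ s] aeq[of s] jN iN
          by (auto simp: e pairing_diff_left pairing_minus_left)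
        then show ?thesis using ej1 by (auto simp: roots_at_def pairing_minus_left)
      qed
      then have "e \<in> semisimple_roots m p" using ss[of j] jN n_le_m by auto
      moreover have "pairing e v < 0" using v iN jN by (auto simp: e pairing_diff_left)
      ultimately show False using notneg by auto
    qed
    then show "e \<in> triangular_roots" using iN i by (auto simp: triangular_roots_def)
  qed
qed

lemma triangular_root_index:
  assumes "e \<in> triangular_roots"
  obtains i where "i \<in> {1..n}" "e \<in> roots_at m p i" "\<And>j. j \<in> {1..<i} \<Longrightarrow> pairing e (p j) = 0"
  using assms by (auto simp: triangular_roots_def)

section \<open>A separating weight\<close>

text \<open>Coordinates of a triangular root lie between \<open>-1\<close> and the largest \<open>a k i\<close>. Adding \<open>3\<close> ensures that they, and
  their differences for two roots, are digits of absolute value below \<open>weight_base\<close>.\<close>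

definition weight_base :: int where
  "weight_base = 3 + (\<Sum>k=1..m. \<Sum>i=1..n. int (a k i))"

definition cell_weight :: "nat \<Rightarrow> int" where
  "cell_weight j = weight_base ^ (n - j)"

definition root_weight :: "int ^ 'n \<Rightarrow> int" where
  "root_weight e = - (\<Sum>j=1..n. cell_weight j * pairing e (p j))"

lemma root_weight_add: "root_weight (e + f) = root_weight e + root_weight f"
  by (simp add: root_weight_def pairing_add_left algebra_simps sum.distrib)

lemma a_less_weight_base: "k \<in> {n<..m} \<Longrightarrow> i \<in> {1..n} \<Longrightarrow> int (a k i) + 3 \<le> weight_base"
proof -
  assume ki: "k \<in> {n<..m}" "i \<in> {1..n}"
  have "int (a k i) \<le> (\<Sum>i=1..n. int (a k i))" by (rule member_le_sum) (use ki in auto)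
  also have "\<dots> \<le> (\<Sum>k=1..m. \<Sum>i=1..n. int (a k i))"
    by (rule member_le_sum[of k "{1..m}" "\<lambda>k. \<Sum>i=1..n. int (a k i)"]) (use ki in \<open>auto intro: sum_nonneg\<close>)
  finally show ?thesis by (simp add: weight_base_def)
qed

lemma weight_base_ge: "3 \<le> weight_base"
  unfolding weight_base_def by (simp add: sum_nonneg)

lemma cell_weight_pos: "0 < cell_weight j" using weight_base_ge by (simp add: cell_weight_def)

text \<open>The sign of a base \<open>B\<close> expansion with digits of absolute value below \<open>B\<close> is the sign of its first nonzero
  digit. Applied to a root and to a difference of roots, this gives positivity and injectivity of the weight.\<close>

lemma base_expansion_positive:
  assumes "i \<in> {1..n}" "\<And>j. j \<in> {1..<i} \<Longrightarrow> d j = 0" "1 \<le> d i" "\<And>j. j \<in> {i<..n} \<Longrightarrow> \<bar>d j\<bar> \<le> weight_base - 1"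
  shows "0 < (\<Sum>j=1..n. cell_weight j * (d j :: int))"
proof -
  have tail: "\<bar>\<Sum>j\<in>{l<..n}. cell_weight j * d j\<bar> < cell_weight l" if "i \<le> l" "l \<le> n" for l
    using that(2,1)
  proof (induction l rule: inc_induct)
    case base then show ?case by (simp add: cell_weight_pos)
  next
    case (step l)
    have "{l<..n} = insert (Suc l) {Suc l<..n}" using step by auto
    then have "(\<Sum>j\<in>{l<..n}. cell_weight j * d j) = cell_weight (Suc l) * d (Suc l) + (\<Sum>j\<in>{Suc l<..n}. cell_weight j * d j)" by simp
    also have "\<bar>\<dots>\<bar> \<le> \<bar>cell_weight (Suc l) * d (Suc l)\<bar> + \<bar>\<Sum>j\<in>{Suc l<..n}. cell_weight j * d j\<bar>" by (rule abs_triangle_ineq)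
    also have "\<dots> < cell_weight (Suc l) * (weight_base - 1) + cell_weight (Suc l)"
    proof -
      have "\<bar>cell_weight (Suc l) * d (Suc l)\<bar> \<le> cell_weight (Suc l) * (weight_base - 1)"
        using assms(4)[of "Suc l"] step cell_weight_pos[of "Suc l"] by (simp add: abs_mult mult_left_mono)
      then show ?thesis using step by simp
    qed
    also have "\<dots> = cell_weight l"
    proof -
      have "n - l = Suc (n - Suc l)" using step by auto
      then show ?thesis by (simp add: cell_weight_def algebra_simps)
    qed
    finally show ?case .
  qed
  have "{1..n} = {1..<i} \<union> {i..n}" using assms(1) by auto
  then have "(\<Sum>j=1..n. cell_weight j * d j) = (\<Sum>j\<in>{1..<i} \<union> {i..n}. cell_weight j * d j)" by simp
  also have "\<dots> = (\<Sum>j\<in>{1..<i}. cell_weight j * d j) + (\<Sum>j\<in>{i..n}. cell_weight j * d j)"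
    by (rule sum.union_disjoint) auto
  also have "(\<Sum>j\<in>{1..<i}. cell_weight j * d j) = 0" using assms(2) by (intro sum.neutral) auto
  also have "{i..n} = insert i {i<..n}" using assms(1) by auto
  finally have "(\<Sum>j=1..n. cell_weight j * d j) = cell_weight i * d i + (\<Sum>j\<in>{i<..n}. cell_weight j * d j)" by simp
  moreover have "cell_weight i \<le> cell_weight i * d i" using assms(3) cell_weight_pos[of i] mult_left_mono[of 1 "d i" "cell_weight i"] by simp
  ultimately show ?thesis using tail[of i] assms(1) by auto
qed

lemma triangular_root_coefficient_bound:
  assumes "e \<in> triangular_roots" "j \<in> {1..n}"
  shows "-1 \<le> pairing e (p j)" "pairing e (p j) \<le> weight_base - 3"
proof -
  obtain i where i: "i \<in> {1..n}" "e \<in> roots_at m p i" using triangular_root_index[OF assms(1)] by blast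
  show "-1 \<le> pairing e (p j)" using i assms(2) n_le_m by (cases "j = i") (auto simp: roots_at_def intro: order_trans[of _ 0])
  show "pairing e (p j) \<le> weight_base - 3"
  proof (cases "j = i")
    case True then show ?thesis using i weight_base_ge by (simp add: roots_at_def)
  next
    case False
    then obtain k where "k \<in> {n<..m}" "pairing e (p j) \<le> int (a k i)"
      using root_coefficient_le[OF i(2,1) assms(2)] by blast
    then show ?thesis using a_less_weight_base[of k i] i by linarith
  qed
qed

lemma root_weight_pos: "e \<in> triangular_roots \<Longrightarrow> 0 < root_weight e"
proof -
  assume e: "e \<in> triangular_roots"
  obtain i where i: "i \<in> {1..n}" "e \<in> roots_at m p i" "\<And>j. j \<in> {1..<i} \<Longrightarrow> pairing e (p j) = 0"
    using triangular_root_index[OF e] by blast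
  have "0 < (\<Sum>j=1..n. cell_weight j * (- pairing e (p j)))"
  proof (rule base_expansion_positive[OF i(1)])
    fix j assume "j \<in> {i<..n}"
    then show "\<bar>- pairing e (p j)\<bar> \<le> weight_base - 1" using triangular_root_coefficient_bound[OF e, of j] weight_base_ge i(1) by auto
  qed (use i in \<open>auto simp: roots_at_def\<close>)
  then show ?thesis by (simp add: root_weight_def sum_negf)
qed

lemma root_weight_inj: "inj_on root_weight triangular_roots"
proof (rule inj_onI, rule ccontr)
  have aux: "root_weight e \<noteq> root_weight f" if ef: "e \<in> triangular_roots" "f \<in> triangular_roots"
    and i: "i \<in> {1..n}" "\<And>j. j \<in> {1..<i} \<Longrightarrow> pairing e (p j) = pairing f (p j)"
      "pairing e (p i) < pairing f (p i)" for e f i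
  proof -
    have "0 < (\<Sum>j=1..n. cell_weight j * (pairing f (p j) - pairing e (p j)))"
    proof (rule base_expansion_positive[OF i(1)])
      fix j assume "j \<in> {i<..n}"
      then have "j \<in> {1..n}" using i(1) by auto
      then show "\<bar>pairing f (p j) - pairing e (p j)\<bar> \<le> weight_base - 1"
        using triangular_root_coefficient_bound[OF ef(1), of j] triangular_root_coefficient_bound[OF ef(2), of j] by linarith
    qed (use i in auto)
    then show ?thesis by (simp add: root_weight_def right_diff_distrib sum_subtractf)
  qed
  fix e f assume ef: "e \<in> triangular_roots" "f \<in> triangular_roots" "root_weight e = root_weight f" "e \<noteq> f"
  let ?D = "\<lambda>j. j \<in> {1..n} \<and> pairing e (p j) \<noteq> pairing f (p j)"
  obtain j where "?D j" using lattice_eqI[of e f] ef(4) by blast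
  define i where "i = (LEAST j. ?D j)"
  have i: "?D i" unfolding i_def by (rule LeastI[of ?D, OF \<open>?D j\<close>])
  have before: "pairing e (p j) = pairing f (p j)" if "j \<in> {1..<i}" for j
    using not_less_Least[of j ?D] that i unfolding i_def[symmetric] by auto
  show False
  proof (cases "pairing e (p i) < pairing f (p i)")
    case True then show False using aux[of e f i] ef i before by auto
  next
    case False then show False using aux[of f e i] ef i before by auto
  qed
qed

lemma finite_triangular_roots: "finite triangular_roots"
proof (rule inj_on_finite[of "\<lambda>e. restrict (\<lambda>j. pairing e (p j)) {1..n}" triangular_roots "{1..n} \<rightarrow>\<^sub>E {-1..weight_base - 3}"])
  show "inj_on (\<lambda>e. restrict (\<lambda>j. pairing e (p j)) {1..n}) triangular_roots"
    by (rule inj_onI, rule lattice_eqI) (metis restrict_apply')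
  show "(\<lambda>e. restrict (\<lambda>j. pairing e (p j)) {1..n}) ` triangular_roots \<subseteq> {1..n} \<rightarrow>\<^sub>E {-1..weight_base - 3}"
    using triangular_root_coefficient_bound by fastforce
  show "finite ({1..n} \<rightarrow>\<^sub>E {-1..weight_base - 3})" by (intro finite_PiE) auto
qed

end

section \<open>Exponentials of root derivations\<close>

abbreviation (input) "psingle \<equiv> Poly_Mapping.single"
abbreviation (input) "plookup \<equiv> Poly_Mapping.lookup"
abbreviation (input) "pkeys \<equiv> Poly_Mapping.keys"

definition monomial_value :: "(nat \<Rightarrow>\<^sub>0 nat) \<Rightarrow> (nat \<Rightarrow> 'k::comm_ring_1) \<Rightarrow> 'k" where
  "monomial_value t x = (\<Prod>s\<in>pkeys t. x s ^ plookup t s)"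

lemma peval_superset:
  assumes "finite S" "pkeys f \<subseteq> S"
  shows "peval f x = (\<Sum>t\<in>S. plookup f t * monomial_value t x)"
  unfolding peval_def monomial_value_def
  by (rule sum.mono_neutral_left) (use assms in \<open>auto simp: in_keys_iff\<close>)

lemma peval_add: "peval (f + g) x = peval f x + peval g x"
proof -
  let ?S = "pkeys f \<union> pkeys g"
  have "pkeys (f + g) \<subseteq> ?S" by (rule Poly_Mapping.keys_add)
  then show ?thesis
    using peval_superset[of ?S f x] peval_superset[of ?S g x] peval_superset[of ?S "f + g" x]
    by (simp add: lookup_add algebra_simps sum.distrib)
qed

lemma peval_single: "peval (psingle t c) x = c * monomial_value t x"
  using peval_superset[of "{t}" "psingle t c" x] by (simp add: keys_single)

lemma monomial_value_superset:
  "finite S \<Longrightarrow> pkeys t \<subseteq> S \<Longrightarrow> monomial_value t x = (\<Prod>s\<in>S. x s ^ plookup t s)"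
  unfolding monomial_value_def by (rule prod.mono_neutral_left) (auto simp: in_keys_iff)

lemma Var_power: "(Var s :: 'k::field polynomials) ^ k = psingle (psingle s k) 1"
proof (induction k)
  case 0 then show ?case by simp
next
  case (Suc k)
  then show ?case by (simp add: Var_def mult_single flip: single_add)
qed

lemma prod_Var_power:
  "finite S \<Longrightarrow> (\<Prod>s\<in>S. (Var s :: 'k::field polynomials) ^ k s) = psingle (\<Sum>s\<in>S. psingle s (k s)) 1"
  by (induction S rule: finite_induct) (simp_all add: Var_power mult_single)

lemma lookup_sum_single:
  "finite S \<Longrightarrow> plookup (\<Sum>s\<in>S. psingle s (k s)) u = (if u \<in> S then k u else (0::nat))"
  by (simp add: lookup_sum lookup_single when_def if_distrib cong: if_cong)

lemma partial_deriv_single: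
  "partial_deriv i (psingle t c) = psingle (t - psingle i 1) (of_nat (plookup t i) * (c :: 'k::field))"
  by (cases "c = 0") (simp_all add: partial_deriv_def)

lemma partial_deriv_0: "partial_deriv i 0 = 0"
  by (simp add: partial_deriv_def)

text \<open>The monomial of the derivation does not involve \<open>x i\<close>, so its square kills \<open>x i\<close> and the exponential series
  stops after the linear term.\<close>

lemma root_action_eq:
  fixes \<alpha> :: "'k::field_char_0"
  shows "root_action m p i e \<alpha> x =
    x(i := x i + \<alpha> * (\<Prod>s\<in>{1..m} - {i}. x s ^ nat (pairing e (p s))))"
proof
  fix s
  define t where "t = (\<Sum>s\<in>{1..m} - {i}. psingle s (nat (pairing e (p s))))"
  let ?D = "root_derivation m p i e :: 'k polynomials \<Rightarrow> 'k polynomials"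
  have D: "?D f = psingle t 1 * partial_deriv i f" for f
    unfolding root_derivation_def t_def by (subst prod_Var_power) auto
  have t_lookup: "plookup t u = (if u \<in> {1..m} - {i} then nat (pairing e (p u)) else 0)" for u
    unfolding t_def by (rule lookup_sum_single) simp
  have D0: "(?D ^^ k) 0 = 0" for k by (induction k) (auto simp: D partial_deriv_0)
  have Var0: "(Var s :: 'k polynomials) \<noteq> 0"
    unfolding Var_def by (metis lookup_single_eq lookup_zero one_neq_zero)
  have Var_value: "peval (Var s :: 'k polynomials) x = x s"
    unfolding Var_def peval_single by (simp add: monomial_value_def)
  show "root_action m p i e \<alpha> x s =
      (x(i := x i + \<alpha> * (\<Prod>s\<in>{1..m} - {i}. x s ^ nat (pairing e (p s))))) s"
  proof (cases "s = i")
    case False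
    have "?D (Var s) = 0" unfolding D Var_def partial_deriv_single using False by (simp add: lookup_single)
    then have pow: "(?D ^^ k) (Var s) = (if k = 0 then Var s else 0)" for k
      using D0 by (cases k) (simp_all add: funpow_swap1)
    then have "{k. (?D ^^ k) (Var s) \<noteq> 0} = {0}" using Var0 by auto
    then show ?thesis using False Var_value
      by (simp add: root_action_def exp_derivation_def)
  next
    case True
    have D1: "?D (Var s) = psingle t 1"
      unfolding D Var_def partial_deriv_single using True by (simp add: mult_single)
    have D2: "?D (psingle t 1) = 0"
      unfolding D partial_deriv_single t_lookup by simp
    have pow: "(?D ^^ k) (Var s) = (if k = 0 then Var s else if k = 1 then psingle t 1 else 0)" for k
    proof (cases k)
      case (Suc k')
      then show ?thesis using D0[of "k' - 1"] D2 by (cases k') (simp_all add: funpow_swap1 D1)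
    qed simp
    have "psingle t (1 :: 'k) \<noteq> 0" by (metis lookup_single_eq lookup_zero one_neq_zero)
    then have "{k. (?D ^^ k) (Var s) \<noteq> 0} = {0, 1}" using Var0 pow by auto
    then have "exp_derivation \<alpha> ?D (Var s) = Var s + psingle t \<alpha>"
      by (simp add: exp_derivation_def D1 mult_single)
    then have "root_action m p i e \<alpha> x s = x s + \<alpha> * monomial_value t x"
      by (simp add: root_action_def peval_add peval_single Var_value)
    also have "monomial_value t x = (\<Prod>s\<in>{1..m} - {i}. x s ^ plookup t s)"
      by (rule monomial_value_superset) (auto simp: in_keys_iff t_lookup split: if_splits)
    also have "\<dots> = (\<Prod>s\<in>{1..m} - {i}. x s ^ nat (pairing e (p s)))"
      by (rule prod.cong) (auto simp: t_lookup)
    finally show ?thesis using True by simp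
  qed
qed

section \<open>Regular functions on toric charts\<close>

definition chart_points :: "(real ^ 'n) set set \<Rightarrow> (real ^ 'n) set \<Rightarrow> ('n, 'k::field) toric_point set" where
  "chart_points \<Sigma> \<sigma> = (\<Union>\<tau>\<in>{\<tau>\<in>\<Sigma>. \<tau> \<subseteq> \<sigma>}. orbit \<tau>)"

text \<open>Only the values on the chart matter. This makes the regular functions closed under products, since characters
  are multiplicative at the points of the chart but not everywhere.\<close>

definition chart_regular ::
    "(real ^ 'n) set set \<Rightarrow> (real ^ 'n) set \<Rightarrow> (('n, 'k::field) toric_point \<Rightarrow> 'k) \<Rightarrow> bool" where
  "chart_regular \<Sigma> \<sigma> f \<longleftrightarrow> (\<exists>A c. finite A \<and> A \<subseteq> dual_semigroup \<sigma> \<and>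
     (\<forall>z\<in>chart_points \<Sigma> \<sigma>. f z = (\<Sum>u\<in>A. c u * snd z u)))"

lemma toric_chart_fst: "fst (toric_chart \<Sigma> \<sigma>) = chart_points \<Sigma> \<sigma>"
  by (simp add: toric_chart_def chart_points_def)

lemma chart_regular_iff:
  "chart_regular \<Sigma> \<sigma> f \<longleftrightarrow> (\<exists>g\<in>snd (toric_chart \<Sigma> \<sigma>). \<forall>z\<in>chart_points \<Sigma> \<sigma>. f z = g z)"
proof
  assume "chart_regular \<Sigma> \<sigma> f"
  then obtain A c where A: "finite A" "A \<subseteq> dual_semigroup \<sigma>"
    "\<forall>z\<in>chart_points \<Sigma> \<sigma>. f z = (\<Sum>u\<in>A. c u * snd z u)" by (auto simp: chart_regular_def)
  then have "(\<lambda>(\<tau>, x). \<Sum>u\<in>A. c u * x u) \<in> snd (toric_chart \<Sigma> \<sigma>)" by (auto simp: toric_chart_def)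
  then show "\<exists>g\<in>snd (toric_chart \<Sigma> \<sigma>). \<forall>z\<in>chart_points \<Sigma> \<sigma>. f z = g z"
    by (rule rev_bexI) (use A(3) in \<open>auto simp: case_prod_beta\<close>)
next
  assume "\<exists>g\<in>snd (toric_chart \<Sigma> \<sigma>). \<forall>z\<in>chart_points \<Sigma> \<sigma>. f z = g z"
  then obtain A c where "finite A" "A \<subseteq> dual_semigroup \<sigma>"
    "\<forall>z\<in>chart_points \<Sigma> \<sigma>. f z = (\<lambda>(\<tau>, x). \<Sum>u\<in>A. c u * x u) z"
    unfolding toric_chart_def by auto
  then show "chart_regular \<Sigma> \<sigma> f"
    unfolding chart_regular_def by (intro exI[of _ A] exI[of _ c]) (simp add: case_prod_beta)
qed

lemma dual_semigroup_0: "0 \<in> dual_semigroup \<sigma>"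
  by (simp add: dual_semigroup_def real_vec_0)

lemma dual_semigroup_add:
  "u \<in> dual_semigroup \<sigma> \<Longrightarrow> u' \<in> dual_semigroup \<sigma> \<Longrightarrow> u + u' \<in> dual_semigroup \<sigma>"
  by (auto simp: dual_semigroup_def real_vec_add inner_add_left)

lemma dual_semigroup_antimono: "\<tau> \<subseteq> \<sigma> \<Longrightarrow> dual_semigroup \<sigma> \<subseteq> dual_semigroup \<tau>"
  by (auto simp: dual_semigroup_def)

lemma orbit_mult:
  "(\<tau>, x) \<in> orbit \<tau> \<Longrightarrow> u \<in> dual_semigroup \<tau> \<Longrightarrow> u' \<in> dual_semigroup \<tau> \<Longrightarrow> x (u + u') = x u * x u'"
  by (auto simp: orbit_def)

lemma chart_points_mult:
  assumes "z \<in> chart_points \<Sigma> \<sigma>" "u \<in> dual_semigroup \<sigma>" "u' \<in> dual_semigroup \<sigma>"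
  shows "snd z (u + u') = snd z u * snd z u'"
proof -
  obtain \<tau> x where "\<tau> \<subseteq> \<sigma>" "(\<tau>, x) \<in> orbit \<tau>" "z = (\<tau>, x)"
    using assms(1) by (auto simp: chart_points_def orbit_def)
  then show ?thesis using orbit_mult[of \<tau> x u u'] dual_semigroup_antimono assms by auto
qed

lemma chart_points_0: "z \<in> chart_points \<Sigma> \<sigma> \<Longrightarrow> snd z 0 = 1"
  by (auto simp: chart_points_def orbit_def)

lemma chart_regular_cong:
  "(\<And>z. z \<in> chart_points \<Sigma> \<sigma> \<Longrightarrow> f z = g z) \<Longrightarrow> chart_regular \<Sigma> \<sigma> f \<Longrightarrow> chart_regular \<Sigma> \<sigma> g"
  unfolding chart_regular_def by metis

lemma chart_regular_scaled_char:
  "u \<in> dual_semigroup \<sigma> \<Longrightarrow> chart_regular \<Sigma> \<sigma> (\<lambda>z. c * snd z u)"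
  unfolding chart_regular_def by (intro exI[of _ "{u}"] exI[of _ "\<lambda>_. c"]) auto

lemma chart_regular_char: "u \<in> dual_semigroup \<sigma> \<Longrightarrow> chart_regular \<Sigma> \<sigma> (\<lambda>z. snd z u)"
  using chart_regular_scaled_char[of u \<sigma> \<Sigma> 1] by simp

lemma chart_regular_const: "chart_regular \<Sigma> \<sigma> (\<lambda>_. c)"
  by (rule chart_regular_cong[OF _ chart_regular_scaled_char[OF dual_semigroup_0, of _ _ c]])
    (simp add: chart_points_0)

lemma chart_regular_add:
  assumes "chart_regular \<Sigma> \<sigma> f" "chart_regular \<Sigma> \<sigma> g"
  shows "chart_regular \<Sigma> \<sigma> (\<lambda>z. f z + g z)"
proof -
  obtain A c where A: "finite A" "A \<subseteq> dual_semigroup \<sigma>"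
    "\<forall>z\<in>chart_points \<Sigma> \<sigma>. f z = (\<Sum>u\<in>A. c u * snd z u)" using assms(1) by (auto simp: chart_regular_def)
  obtain B d where B: "finite B" "B \<subseteq> dual_semigroup \<sigma>"
    "\<forall>z\<in>chart_points \<Sigma> \<sigma>. g z = (\<Sum>u\<in>B. d u * snd z u)" using assms(2) by (auto simp: chart_regular_def)
  let ?c = "\<lambda>u. (if u \<in> A then c u else 0) + (if u \<in> B then d u else 0)"
  have "f z + g z = (\<Sum>u\<in>A \<union> B. ?c u * snd z u)" if z: "z \<in> chart_points \<Sigma> \<sigma>" for z
  proof -
    have "(\<Sum>u\<in>A. c u * snd z u) = (\<Sum>u\<in>A \<union> B. (if u \<in> A then c u else 0) * snd z u)"
      by (rule sum.mono_neutral_cong_left) (use A B in auto)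
    moreover have "(\<Sum>u\<in>B. d u * snd z u) = (\<Sum>u\<in>A \<union> B. (if u \<in> B then d u else 0) * snd z u)"
      by (rule sum.mono_neutral_cong_left) (use A B in auto)
    ultimately show ?thesis using A(3) B(3) z by (simp add: distrib_right sum.distrib)
  qed
  then show ?thesis unfolding chart_regular_def using A B
    by (intro exI[of _ "A \<union> B"] exI[of _ ?c]) auto
qed

lemma chart_regular_sum:
  "(\<And>i. i \<in> I \<Longrightarrow> chart_regular \<Sigma> \<sigma> (f i)) \<Longrightarrow> chart_regular \<Sigma> \<sigma> (\<lambda>z. \<Sum>i\<in>I. f i z)"
  by (induction I rule: infinite_finite_induct) (auto intro: chart_regular_const chart_regular_add)

lemma chart_regular_mult:
  fixes f g :: "('n::finite, 'k::field) toric_point \<Rightarrow> 'k"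
  assumes "chart_regular \<Sigma> \<sigma> f" "chart_regular \<Sigma> \<sigma> g"
  shows "chart_regular \<Sigma> \<sigma> (\<lambda>z. f z * g z)"
proof -
  obtain A c where A: "finite A" "A \<subseteq> dual_semigroup \<sigma>"
    "\<forall>z\<in>chart_points \<Sigma> \<sigma>. f z = (\<Sum>u\<in>A. c u * snd z u)" using assms(1) by (auto simp: chart_regular_def)
  obtain B d where B: "finite B" "B \<subseteq> dual_semigroup \<sigma>"
    "\<forall>z\<in>chart_points \<Sigma> \<sigma>. g z = (\<Sum>u\<in>B. d u * snd z u)" using assms(2) by (auto simp: chart_regular_def)
  have "chart_regular \<Sigma> \<sigma> (\<lambda>z. \<Sum>u\<in>A. \<Sum>u'\<in>B. (c u * d u') * snd z (u + u'))"
    using A(2) B(2) by (intro chart_regular_sum chart_regular_scaled_char dual_semigroup_add) auto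
  then show ?thesis
  proof (rule chart_regular_cong[rotated])
    fix z :: "('n, 'k) toric_point" assume z: "z \<in> chart_points \<Sigma> \<sigma>"
    have "(\<Sum>u\<in>A. \<Sum>u'\<in>B. (c u * d u') * snd z (u + u')) =
        (\<Sum>u\<in>A. \<Sum>u'\<in>B. (c u * snd z u) * (d u' * snd z u'))"
      using A(2) B(2) chart_points_mult[OF z] by (intro sum.cong refl) (auto simp: subset_iff)
    also have "\<dots> = f z * g z" using A(3) B(3) z by (simp add: sum_product)
    finally show "(\<Sum>u\<in>A. \<Sum>u'\<in>B. (c u * d u') * snd z (u + u')) = f z * g z" .
  qed
qed

lemma chart_regular_power: "chart_regular \<Sigma> \<sigma> f \<Longrightarrow> chart_regular \<Sigma> \<sigma> (\<lambda>z. f z ^ k)"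
  by (induction k) (auto intro: chart_regular_const chart_regular_mult)

lemma toric_variety_eq: "toric_variety \<Sigma> = (\<Union>\<sigma>\<in>\<Sigma>. chart_points \<Sigma> \<sigma>)"
  by (auto simp: points_def toric_atlas_def toric_chart_def chart_points_def)

lemma toric_variety_orbits: "toric_variety \<Sigma> = (\<Union>\<tau>\<in>\<Sigma>. orbit \<tau>)"
  unfolding toric_variety_eq chart_points_def by blast

lemma chart_in_variety: "\<sigma> \<in> \<Sigma> \<Longrightarrow> chart_points \<Sigma> \<sigma> \<subseteq> toric_variety \<Sigma>"
  unfolding toric_variety_eq by blast

lemma toric_atlas_Bex:
  "(\<exists>(P, A)\<in>toric_atlas \<Sigma>. Q P A) \<longleftrightarrow> (\<exists>\<sigma>\<in>\<Sigma>. Q (chart_points \<Sigma> \<sigma>) (snd (toric_chart \<Sigma> \<sigma>)))"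
  unfolding toric_atlas_def by (simp add: case_prod_beta toric_chart_fst)

lemma Bex_toric_chart_iff:
  assumes "\<And>f g. (\<And>z. z \<in> chart_points \<Sigma> \<sigma> \<Longrightarrow> f z = g z) \<Longrightarrow> Q f \<Longrightarrow> Q g"
  shows "(\<exists>h\<in>snd (toric_chart \<Sigma> \<sigma>). Q h) \<longleftrightarrow> (\<exists>h. chart_regular \<Sigma> \<sigma> h \<and> Q h)"
proof
  assume "\<exists>h\<in>snd (toric_chart \<Sigma> \<sigma>). Q h"
  then obtain h where h: "h \<in> snd (toric_chart \<Sigma> \<sigma>)" "Q h" by blast
  then have "chart_regular \<Sigma> \<sigma> h" unfolding chart_regular_iff by (intro bexI[of _ h]) auto
  then show "\<exists>h. chart_regular \<Sigma> \<sigma> h \<and> Q h" using h(2) by (intro exI[of _ h]) simp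
next
  assume "\<exists>h. chart_regular \<Sigma> \<sigma> h \<and> Q h"
  then obtain h where h: "chart_regular \<Sigma> \<sigma> h" "Q h" by blast
  then obtain g where g: "g \<in> snd (toric_chart \<Sigma> \<sigma>)" "\<forall>z\<in>chart_points \<Sigma> \<sigma>. h z = g z"
    unfolding chart_regular_iff by blast
  have "Q g" using assms[of h g] g(2) h(2) by simp
  then show "\<exists>h\<in>snd (toric_chart \<Sigma> \<sigma>). Q h" by (rule bexI[OF _ g(1)])
qed

lemma toric_zariski_open_iff:
  fixes V :: "('n::finite, 'k::field) toric_point set"
  shows "zariski_open (toric_atlas \<Sigma>) V \<longleftrightarrow> V \<subseteq> toric_variety \<Sigma> \<and>
     (\<forall>z\<in>V. \<exists>\<sigma>\<in>\<Sigma>. z \<in> chart_points \<Sigma> \<sigma> \<and> (\<exists>h. chart_regular \<Sigma> \<sigma> h \<and> h z \<noteq> 0 \<and>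
        (\<forall>y\<in>chart_points \<Sigma> \<sigma>. h y \<noteq> 0 \<longrightarrow> y \<in> V)))"
  unfolding zariski_open_def toric_atlas_Bex
proof (intro conj_cong refl ball_cong bex_cong)
  fix z :: "('n, 'k) toric_point" and \<sigma> assume z: "z \<in> chart_points \<Sigma> \<sigma>"
  show "(\<exists>h\<in>snd (toric_chart \<Sigma> \<sigma>). h z \<noteq> 0 \<and> {y \<in> chart_points \<Sigma> \<sigma>. h y \<noteq> 0} \<subseteq> V) \<longleftrightarrow>
      (\<exists>h. chart_regular \<Sigma> \<sigma> h \<and> h z \<noteq> 0 \<and> (\<forall>y\<in>chart_points \<Sigma> \<sigma>. h y \<noteq> 0 \<longrightarrow> y \<in> V))"
    by (subst Bex_toric_chart_iff) (use z in auto)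
qed

lemma toric_regular_on_iff:
  fixes V :: "('n::finite, 'k::field) toric_point set"
  shows "regular_on (toric_atlas \<Sigma>) V f \<longleftrightarrow>
     (\<forall>z\<in>V. \<exists>\<sigma>\<in>\<Sigma>. z \<in> chart_points \<Sigma> \<sigma> \<and> (\<exists>g. chart_regular \<Sigma> \<sigma> g \<and> (\<exists>h. chart_regular \<Sigma> \<sigma> h \<and>
        h z \<noteq> 0 \<and> (\<forall>y\<in>V \<inter> chart_points \<Sigma> \<sigma>. h y \<noteq> 0 \<longrightarrow> f y = g y / h y))))"
  unfolding regular_on_def toric_atlas_Bex
proof (intro conj_cong refl ball_cong bex_cong)
  fix z :: "('n, 'k) toric_point" and \<sigma> assume z: "z \<in> chart_points \<Sigma> \<sigma>"
  have inner: "(\<exists>h\<in>snd (toric_chart \<Sigma> \<sigma>). h z \<noteq> 0 \<and> (\<forall>y\<in>V \<inter> chart_points \<Sigma> \<sigma>. h y \<noteq> 0 \<longrightarrow> f y = g y / h y)) \<longleftrightarrow>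
      (\<exists>h. chart_regular \<Sigma> \<sigma> h \<and> h z \<noteq> 0 \<and> (\<forall>y\<in>V \<inter> chart_points \<Sigma> \<sigma>. h y \<noteq> 0 \<longrightarrow> f y = g y / h y))" for g
    by (subst Bex_toric_chart_iff) (use z in auto)
  show "(\<exists>g\<in>snd (toric_chart \<Sigma> \<sigma>). \<exists>h\<in>snd (toric_chart \<Sigma> \<sigma>). h z \<noteq> 0 \<and>
         (\<forall>y\<in>V \<inter> chart_points \<Sigma> \<sigma>. h y \<noteq> 0 \<longrightarrow> f y = g y / h y)) \<longleftrightarrow>
      (\<exists>g. chart_regular \<Sigma> \<sigma> g \<and> (\<exists>h. chart_regular \<Sigma> \<sigma> h \<and>
        h z \<noteq> 0 \<and> (\<forall>y\<in>V \<inter> chart_points \<Sigma> \<sigma>. h y \<noteq> 0 \<longrightarrow> f y = g y / h y)))"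
    unfolding inner by (subst Bex_toric_chart_iff) auto
qed

text \<open>The pullback of each character of the target chart is a regular function divided by a power of a function \<open>h\<close> that
  does not vanish at the given point.\<close>

definition locally_monomial ::
    "(real ^ 'n) set set \<Rightarrow> (('n, 'k::field) toric_point \<Rightarrow> ('n, 'k) toric_point) \<Rightarrow> bool" where
  "locally_monomial \<Sigma> \<phi> \<longleftrightarrow> (\<forall>z\<in>toric_variety \<Sigma>. \<forall>\<sigma>'\<in>\<Sigma>. \<phi> z \<in> chart_points \<Sigma> \<sigma>' \<longrightarrow>
     (\<exists>\<sigma>\<in>\<Sigma>. \<exists>h. chart_regular \<Sigma> \<sigma> h \<and> z \<in> chart_points \<Sigma> \<sigma> \<and> h z \<noteq> 0 \<and>
        (\<forall>y\<in>chart_points \<Sigma> \<sigma>. h y \<noteq> 0 \<longrightarrow> \<phi> y \<in> chart_points \<Sigma> \<sigma>') \<and>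
        (\<forall>u\<in>dual_semigroup \<sigma>'. \<exists>k g. chart_regular \<Sigma> \<sigma> g \<and>
           (\<forall>y\<in>chart_points \<Sigma> \<sigma>. h y \<noteq> 0 \<longrightarrow> snd (\<phi> y) u * h y ^ k = g y))))"

text \<open>A regular function is a finite sum of characters; the powers of \<open>h\<close> are brought to a common exponent.\<close>

lemma pullback_chart_regular:
  assumes h: "chart_regular \<Sigma> \<sigma> h"
    and maps: "\<And>y. y \<in> chart_points \<Sigma> \<sigma> \<Longrightarrow> h y \<noteq> 0 \<Longrightarrow> \<phi> y \<in> chart_points \<Sigma> \<sigma>'"
    and chars: "\<And>u. u \<in> dual_semigroup \<sigma>' \<Longrightarrow> \<exists>k g. chart_regular \<Sigma> \<sigma> g \<and>
           (\<forall>y\<in>chart_points \<Sigma> \<sigma>. h y \<noteq> 0 \<longrightarrow> snd (\<phi> y) u * h y ^ k = g y)"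
    and b: "chart_regular \<Sigma> \<sigma>' b"
  shows "\<exists>k g. chart_regular \<Sigma> \<sigma> g \<and>
           (\<forall>y\<in>chart_points \<Sigma> \<sigma>. h y \<noteq> 0 \<longrightarrow> b (\<phi> y) * h y ^ k = g y)"
proof -
  obtain A c where A: "finite A" "A \<subseteq> dual_semigroup \<sigma>'"
    "\<forall>z\<in>chart_points \<Sigma> \<sigma>'. b z = (\<Sum>u\<in>A. c u * snd z u)" using b by (auto simp: chart_regular_def)
  have "\<exists>k g. chart_regular \<Sigma> \<sigma> g \<and>
      (\<forall>y\<in>chart_points \<Sigma> \<sigma>. h y \<noteq> 0 \<longrightarrow> (\<Sum>u\<in>A. c u * snd (\<phi> y) u) * h y ^ k = g y)"
    using A(1,2)
  proof (induction A rule: finite_induct)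
    case empty
    show ?case by (intro exI[of _ 0] exI[of _ "\<lambda>_. 0"]) (auto intro: chart_regular_const)
  next
    case (insert u A)
    obtain k g where k: "chart_regular \<Sigma> \<sigma> g"
      "\<And>y. y \<in> chart_points \<Sigma> \<sigma> \<Longrightarrow> h y \<noteq> 0 \<Longrightarrow> (\<Sum>u\<in>A. c u * snd (\<phi> y) u) * h y ^ k = g y"
      using insert by auto
    obtain k' g' where k': "chart_regular \<Sigma> \<sigma> g'"
      "\<And>y. y \<in> chart_points \<Sigma> \<sigma> \<Longrightarrow> h y \<noteq> 0 \<Longrightarrow> snd (\<phi> y) u * h y ^ k' = g' y"
      using chars[of u] insert.prems by auto
    have "chart_regular \<Sigma> \<sigma> (\<lambda>y. c u * g' y * h y ^ k + g y * h y ^ k')"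
      using h k(1) k'(1) by (intro chart_regular_add chart_regular_mult chart_regular_power chart_regular_const)
    moreover have "(\<Sum>u\<in>insert u A. c u * snd (\<phi> y) u) * h y ^ (k + k') =
        c u * g' y * h y ^ k + g y * h y ^ k'" if "y \<in> chart_points \<Sigma> \<sigma>" "h y \<noteq> 0" for y
      using insert.hyps by (simp add: k(2)[OF that, symmetric] k'(2)[OF that, symmetric] power_add algebra_simps)
    ultimately show ?case by blast
  qed
  then obtain k g where "chart_regular \<Sigma> \<sigma> g"
      "\<forall>y\<in>chart_points \<Sigma> \<sigma>. h y \<noteq> 0 \<longrightarrow> (\<Sum>u\<in>A. c u * snd (\<phi> y) u) * h y ^ k = g y" by blast
  then show ?thesis using A(3) maps by (intro exI[of _ k] exI[of _ g]) auto
qed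

lemma morphism_if_locally_monomial:
  fixes \<phi> :: "('n::finite, 'k::field) toric_point \<Rightarrow> ('n, 'k) toric_point"
  assumes maps: "\<And>z. z \<in> toric_variety \<Sigma> \<Longrightarrow> \<phi> z \<in> toric_variety \<Sigma>" and loc: "locally_monomial \<Sigma> \<phi>"
  shows "morphism (toric_atlas \<Sigma>) (toric_atlas \<Sigma>) \<phi>"
  unfolding morphism_def
proof (intro conjI allI impI)
  let ?X = "toric_variety \<Sigma> :: ('n, 'k) toric_point set"
  show "\<phi> ` ?X \<subseteq> ?X" using maps by blast
  fix V :: "('n, 'k) toric_point set" assume V: "zariski_open (toric_atlas \<Sigma>) V"
  show "zariski_open (toric_atlas \<Sigma>) (?X \<inter> \<phi> -` V)"
    unfolding toric_zariski_open_iff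
  proof (intro conjI ballI)
    fix z assume z: "z \<in> ?X \<inter> \<phi> -` V"
    then have zV: "z \<in> ?X" "\<phi> z \<in> V" by auto
    then obtain \<sigma>' h' where h': "\<sigma>' \<in> \<Sigma>" "\<phi> z \<in> chart_points \<Sigma> \<sigma>'" "chart_regular \<Sigma> \<sigma>' h'" "h' (\<phi> z) \<noteq> 0"
        "\<And>y. y \<in> chart_points \<Sigma> \<sigma>' \<Longrightarrow> h' y \<noteq> 0 \<Longrightarrow> y \<in> V"
      using V unfolding toric_zariski_open_iff by blast
    obtain \<sigma> h where h: "\<sigma> \<in> \<Sigma>" "chart_regular \<Sigma> \<sigma> h" "z \<in> chart_points \<Sigma> \<sigma>" "h z \<noteq> 0"
        "\<And>y. y \<in> chart_points \<Sigma> \<sigma> \<Longrightarrow> h y \<noteq> 0 \<Longrightarrow> \<phi> y \<in> chart_points \<Sigma> \<sigma>'"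
        "\<And>u. u \<in> dual_semigroup \<sigma>' \<Longrightarrow> \<exists>k g. chart_regular \<Sigma> \<sigma> g \<and>
           (\<forall>y\<in>chart_points \<Sigma> \<sigma>. h y \<noteq> 0 \<longrightarrow> snd (\<phi> y) u * h y ^ k = g y)"
      using loc[unfolded locally_monomial_def, rule_format, OF zV(1) h'(1,2)] by blast
    obtain k g where g: "chart_regular \<Sigma> \<sigma> g"
        "\<And>y. y \<in> chart_points \<Sigma> \<sigma> \<Longrightarrow> h y \<noteq> 0 \<Longrightarrow> h' (\<phi> y) * h y ^ k = g y"
      using pullback_chart_regular[OF h(2,5,6) h'(3)] by blast
    have "chart_regular \<Sigma> \<sigma> (\<lambda>y. g y * h y)" using g(1) h(2) by (rule chart_regular_mult)
    moreover have "g z * h z \<noteq> 0" using g(2)[OF h(3,4)] h' h by (metis mult_eq_0_iff power_not_zero)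
    moreover have "y \<in> ?X \<inter> \<phi> -` V" if "y \<in> chart_points \<Sigma> \<sigma>" "g y * h y \<noteq> 0" for y
    proof -
      have "h y \<noteq> 0" "h' (\<phi> y) \<noteq> 0" using that g(2)[of y] by auto
      then have "\<phi> y \<in> V" using h'(5) h(5) that by blast
      then show ?thesis using chart_in_variety[OF h(1)] that by blast
    qed
    ultimately show "\<exists>\<sigma>\<in>\<Sigma>. z \<in> chart_points \<Sigma> \<sigma> \<and> (\<exists>h. chart_regular \<Sigma> \<sigma> h \<and> h z \<noteq> 0 \<and>
        (\<forall>y\<in>chart_points \<Sigma> \<sigma>. h y \<noteq> 0 \<longrightarrow> y \<in> ?X \<inter> \<phi> -` V))"
      by (intro bexI[OF _ h(1)] conjI exI[of _ "\<lambda>y. g y * h y"] h(3)) blast+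
  qed auto
  fix f assume f: "regular_on (toric_atlas \<Sigma>) V f"
  show "regular_on (toric_atlas \<Sigma>) (?X \<inter> \<phi> -` V) (\<lambda>x. f (\<phi> x))"
    unfolding toric_regular_on_iff
  proof
    fix z assume z: "z \<in> ?X \<inter> \<phi> -` V"
    then have zV: "z \<in> ?X" "\<phi> z \<in> V" by auto
    from f[unfolded toric_regular_on_iff, rule_format, OF zV(2)]
    obtain \<sigma>' g' h' where h': "\<sigma>' \<in> \<Sigma>" "\<phi> z \<in> chart_points \<Sigma> \<sigma>'" "chart_regular \<Sigma> \<sigma>' g'"
        "chart_regular \<Sigma> \<sigma>' h'" "h' (\<phi> z) \<noteq> 0"
        "\<forall>y\<in>V \<inter> chart_points \<Sigma> \<sigma>'. h' y \<noteq> 0 \<longrightarrow> f y = g' y / h' y"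
      by (elim bexE conjE exE) (rule that; assumption)
    obtain \<sigma> h where h: "\<sigma> \<in> \<Sigma>" "chart_regular \<Sigma> \<sigma> h" "z \<in> chart_points \<Sigma> \<sigma>" "h z \<noteq> 0"
        "\<And>y. y \<in> chart_points \<Sigma> \<sigma> \<Longrightarrow> h y \<noteq> 0 \<Longrightarrow> \<phi> y \<in> chart_points \<Sigma> \<sigma>'"
        "\<And>u. u \<in> dual_semigroup \<sigma>' \<Longrightarrow> \<exists>k g. chart_regular \<Sigma> \<sigma> g \<and>
           (\<forall>y\<in>chart_points \<Sigma> \<sigma>. h y \<noteq> 0 \<longrightarrow> snd (\<phi> y) u * h y ^ k = g y)"
      using loc[unfolded locally_monomial_def, rule_format, OF zV(1) h'(1,2)] by blast
    obtain k g where g: "chart_regular \<Sigma> \<sigma> g"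
        "\<And>y. y \<in> chart_points \<Sigma> \<sigma> \<Longrightarrow> h y \<noteq> 0 \<Longrightarrow> g' (\<phi> y) * h y ^ k = g y"
      using pullback_chart_regular[OF h(2,5,6) h'(3)] by blast
    obtain l b where b: "chart_regular \<Sigma> \<sigma> b"
        "\<And>y. y \<in> chart_points \<Sigma> \<sigma> \<Longrightarrow> h y \<noteq> 0 \<Longrightarrow> h' (\<phi> y) * h y ^ l = b y"
      using pullback_chart_regular[OF h(2,5,6) h'(4)] by blast
    let ?G = "\<lambda>y. g y * h y ^ Suc l" and ?H = "\<lambda>y. b y * h y ^ Suc k"
    have "chart_regular \<Sigma> \<sigma> ?G" "chart_regular \<Sigma> \<sigma> ?H"
      using g(1) b(1) h(2) by (auto intro!: chart_regular_mult chart_regular_power simp del: power_Suc)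
    moreover have "?H z \<noteq> 0" using b(2)[OF h(3,4)] h' h by (metis mult_eq_0_iff power_not_zero)
    moreover have "f (\<phi> y) = ?G y / ?H y"
      if y: "y \<in> (?X \<inter> \<phi> -` V) \<inter> chart_points \<Sigma> \<sigma>" "?H y \<noteq> 0" for y
    proof -
      have hy: "y \<in> chart_points \<Sigma> \<sigma>" "h y \<noteq> 0" "b y \<noteq> 0" using y by auto
      then have "h' (\<phi> y) \<noteq> 0" using b(2)[of y] by auto
      then have "f (\<phi> y) = g' (\<phi> y) / h' (\<phi> y)" using h'(6) h(5)[OF hy(1,2)] y by auto
      also have "\<dots> = ?G y / ?H y"
        unfolding g(2)[OF hy(1,2), symmetric] b(2)[OF hy(1,2), symmetric]
        using hy \<open>h' (\<phi> y) \<noteq> 0\<close> by (simp add: field_simps)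
      finally show ?thesis .
    qed
    ultimately show "\<exists>\<sigma>\<in>\<Sigma>. z \<in> chart_points \<Sigma> \<sigma> \<and> (\<exists>g. chart_regular \<Sigma> \<sigma> g \<and> (\<exists>h. chart_regular \<Sigma> \<sigma> h \<and>
        h z \<noteq> 0 \<and> (\<forall>y\<in>(?X \<inter> \<phi> -` V) \<inter> chart_points \<Sigma> \<sigma>. h y \<noteq> 0 \<longrightarrow> f (\<phi> y) = g y / h y)))"
      by (intro bexI[OF _ h(1)] conjI exI[of _ ?G] exI[of _ ?H] h(3)) blast+
  qed
qed

section \<open>The automorphism group\<close>

lemma regular_on_cong:
  assumes "\<And>x. x \<in> V \<Longrightarrow> f x = g x"
  shows "regular_on \<A> V f \<longleftrightarrow> regular_on \<A> V g"
proof -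
  have "(\<forall>y\<in>V \<inter> P. b y \<noteq> 0 \<longrightarrow> f y = a y / b y) \<longleftrightarrow> (\<forall>y\<in>V \<inter> P. b y \<noteq> 0 \<longrightarrow> g y = a y / b y)"
    for P a b using assms by auto
  then show ?thesis by (simp only: regular_on_def)
qed

lemma morphism_cong:
  assumes "\<And>x. x \<in> points \<A> \<Longrightarrow> \<phi> x = \<psi> x" "morphism \<A> \<B> \<phi>"
  shows "morphism \<A> \<B> \<psi>"
proof -
  have v: "points \<A> \<inter> \<psi> -` V = points \<A> \<inter> \<phi> -` V" for V using assms(1) by auto
  have r: "regular_on \<A> (points \<A> \<inter> \<phi> -` V) (\<lambda>x. f (\<psi> x)) \<longleftrightarrow>
      regular_on \<A> (points \<A> \<inter> \<phi> -` V) (\<lambda>x. f (\<phi> x))" for V f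
    by (rule regular_on_cong) (use assms(1) in auto)
  show ?thesis using assms(2) unfolding morphism_def v r using assms(1) by auto
qed

lemma morphism_comp:
  assumes "morphism \<A> \<B> \<phi>" "morphism \<B> \<C> \<psi>"
  shows "morphism \<A> \<C> (\<lambda>x. \<psi> (\<phi> x))"
proof -
  have v: "points \<A> \<inter> (\<lambda>x. \<psi> (\<phi> x)) -` V = points \<A> \<inter> \<phi> -` (points \<B> \<inter> \<psi> -` V)" for V
    using assms(1) by (auto simp: morphism_def)
  show ?thesis using assms unfolding morphism_def v by fastforce
qed

lemma morphism_id: "morphism \<A> \<A> (\<lambda>x. x)"
proof -
  have "V \<subseteq> points \<A>" if "zariski_open \<A> V" for V using that by (simp add: zariski_open_def)
  then have "points \<A> \<inter> (\<lambda>x. x) -` V = V" if "zariski_open \<A> V" for V using that by auto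
  then show ?thesis unfolding morphism_def by auto
qed

text \<open>Hence \<open>Aut \<Sigma>\<close>, which has the operations of the group of all bijections, is a group.\<close>

lemma Aut_subgroup:
  fixes \<Sigma> :: "(real ^ 'n) set set"
  shows "subgroup (carrier (Aut \<Sigma> :: ('n, 'k::field) toric_map monoid)) (BijGroup (toric_variety \<Sigma>))"
proof -
  let ?X = "toric_variety \<Sigma> :: ('n, 'k) toric_point set"
  let ?m = "morphism (toric_atlas \<Sigma> :: (('n, 'k) toric_point, 'k) atlas) (toric_atlas \<Sigma>)"
  have inv: "\<phi> \<in> Bij ?X \<Longrightarrow> inv\<^bsub>BijGroup ?X\<^esub> \<phi> = (\<lambda>x\<in>?X. inv_into ?X \<phi> x)" for \<phi>
    by (rule inv_BijGroup)
  interpret group "BijGroup ?X" by (rule group_BijGroup)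
  have carrier: "carrier (Aut \<Sigma>) = {\<phi> \<in> carrier (BijGroup ?X). ?m \<phi> \<and> ?m (inv\<^bsub>BijGroup ?X\<^esub> \<phi>)}"
  proof -
    have "?m (inv_into ?X \<phi>) \<longleftrightarrow> ?m (inv\<^bsub>BijGroup ?X\<^esub> \<phi>)" if "\<phi> \<in> Bij ?X" for \<phi>
      unfolding inv[OF that] by (auto elim: morphism_cong[rotated])
    then show ?thesis by (auto simp: Aut_def BijGroup_def)
  qed
  have comp: "?m (\<phi> \<otimes>\<^bsub>BijGroup ?X\<^esub> \<psi>)"
    if "\<phi> \<in> carrier (BijGroup ?X)" "\<psi> \<in> carrier (BijGroup ?X)" "?m \<phi>" "?m \<psi>" for \<phi> \<psi>
  proof (rule morphism_cong[OF _ morphism_comp[OF that(4,3)]])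
    show "\<phi> (\<psi> x) = (\<phi> \<otimes>\<^bsub>BijGroup ?X\<^esub> \<psi>) x" if "x \<in> ?X" for x
      using \<open>\<phi> \<in> carrier (BijGroup ?X)\<close> \<open>\<psi> \<in> carrier (BijGroup ?X)\<close> that
      by (simp add: BijGroup_def compose_eq)
  qed
  have one: "?m \<one>\<^bsub>BijGroup ?X\<^esub>"
    by (rule morphism_cong[OF _ morphism_id]) (simp add: BijGroup_def)
  show ?thesis unfolding carrier
    by (rule subgroupI) (use comp one in \<open>auto simp: inv_mult_group intro: exI[of _ "\<one>\<^bsub>BijGroup ?X\<^esub>"]\<close>)
qed

lemma Aut_group:
  fixes \<Sigma> :: "(real ^ 'n) set set"
  shows "group (Aut \<Sigma> :: ('n, 'k::field) toric_map monoid)"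
proof -
  have "Aut \<Sigma> = BijGroup (toric_variety \<Sigma>) \<lparr>carrier := carrier (Aut \<Sigma> :: ('n, 'k) toric_map monoid)\<rparr>"
    by (simp add: Aut_def)
  then show ?thesis using subgroup.subgroup_is_group[OF Aut_subgroup group_BijGroup] by metis
qed

lemma Aut_mult_apply:
  "\<phi> \<in> carrier (Aut \<Sigma>) \<Longrightarrow> \<psi> \<in> carrier (Aut \<Sigma>) \<Longrightarrow> z \<in> toric_variety \<Sigma> \<Longrightarrow>
    (\<phi> \<otimes>\<^bsub>Aut \<Sigma>\<^esub> \<psi>) z = \<phi> (\<psi> z)"
  by (simp add: Aut_def BijGroup_def compose_eq)

lemma Aut_one_apply: "z \<in> toric_variety \<Sigma> \<Longrightarrow> \<one>\<^bsub>Aut \<Sigma>\<^esub> z = z"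
  by (simp add: Aut_def BijGroup_def)

lemma Aut_ext:
  "\<phi> \<in> carrier (Aut \<Sigma>) \<Longrightarrow> \<psi> \<in> carrier (Aut \<Sigma>) \<Longrightarrow>
    (\<And>z. z \<in> toric_variety \<Sigma> \<Longrightarrow> \<phi> z = \<psi> z) \<Longrightarrow> \<phi> = \<psi>"
  by (auto simp: Aut_def dest!: Bij_imp_extensional intro: extensionalityI)

lemma AutI:
  fixes \<phi> \<psi> :: "('n::finite, 'k::field) toric_map"
  assumes "\<phi> \<in> extensional (toric_variety \<Sigma>)"
    and "\<And>z. z \<in> toric_variety \<Sigma> \<Longrightarrow> \<phi> z \<in> toric_variety \<Sigma>" "\<And>z. z \<in> toric_variety \<Sigma> \<Longrightarrow> \<psi> z \<in> toric_variety \<Sigma>"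
    and "\<And>z. z \<in> toric_variety \<Sigma> \<Longrightarrow> \<phi> (\<psi> z) = z" "\<And>z. z \<in> toric_variety \<Sigma> \<Longrightarrow> \<psi> (\<phi> z) = z"
    and "morphism (toric_atlas \<Sigma>) (toric_atlas \<Sigma>) \<phi>" "morphism (toric_atlas \<Sigma>) (toric_atlas \<Sigma>) \<psi>"
  shows "\<phi> \<in> carrier (Aut \<Sigma>)"
proof -
  let ?X = "toric_variety \<Sigma> :: ('n, 'k) toric_point set"
  have bij: "bij_betw \<phi> ?X ?X"
    by (rule bij_betw_byWitness[of _ \<psi>]) (use assms in auto)
  have "inv_into ?X \<phi> z = \<psi> z" if "z \<in> ?X" for z
    using inv_into_f_f[OF bij_betw_imp_inj_on[OF bij] assms(3)[OF that]] assms(4)[OF that] by simp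
  then have "morphism (toric_atlas \<Sigma>) (toric_atlas \<Sigma>) (inv_into ?X \<phi>)"
    by (intro morphism_cong[OF _ assms(7)]) auto
  then show ?thesis using bij assms(1,6) by (simp add: Aut_def Bij_def)
qed

section \<open>The Cox quotient\<close>

context toric_fan
begin

abbreviation cox :: "(nat \<Rightarrow> 'k::field) set" where "cox \<equiv> cox_space \<Sigma> m p"

abbreviation quot :: "(nat \<Rightarrow> 'k::field) \<Rightarrow> ('n, 'k) toric_point" where "quot \<equiv> cox_quotient \<Sigma> m p"

definition zeros :: "(nat \<Rightarrow> 'k::field) \<Rightarrow> nat set" where
  "zeros y = {s \<in> {1..m}. y s = 0}"

text \<open>The cone whose orbit contains the image of \<open>y\<close>. For a cone that is not simplicial it can have more rays than those
  with a vanishing coordinate.\<close>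

definition cone_of :: "(nat \<Rightarrow> 'k::field) \<Rightarrow> (real ^ 'n) set" where
  "cone_of y = \<Inter>{\<sigma> \<in> \<Sigma>. zeros y \<subseteq> rays \<sigma>}"

text \<open>The value at the image of \<open>y\<close> of the character \<open>\<chi>\<^sup>u\<close>.\<close>

definition char_monomial :: "int ^ 'n \<Rightarrow> (nat \<Rightarrow> 'k::field) \<Rightarrow> 'k" where
  "char_monomial u y = (\<Prod>s\<in>{1..m}. y s powi pairing u (p s))"

lemma zeros_rays_iff: "zeros y \<subseteq> rays \<sigma> \<longleftrightarrow> (\<forall>s\<in>{1..m}. y s = 0 \<longrightarrow> real_vec (p s) \<in> \<sigma>)"
  by (auto simp: zeros_def rays_def)

lemma cox_iff: "y \<in> cox \<longleftrightarrow> (\<forall>s. s \<notin> {1..m} \<longrightarrow> y s = 0) \<and> (\<exists>\<sigma>\<in>\<Sigma>. zeros y \<subseteq> rays \<sigma>)"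
  by (simp add: cox_space_def zeros_rays_iff)

lemma quot_eq: "quot y = (cone_of y, \<lambda>u. if u \<in> dual_semigroup (cone_of y) then char_monomial u y else 0)"
  unfolding cox_quotient_def cone_of_def zeros_rays_iff char_monomial_def Let_def by (rule refl)

lemma fst_quot: "fst (quot y) = cone_of y"
  by (simp add: quot_eq)

lemma Inter_in_fan: "finite S \<Longrightarrow> S \<noteq> {} \<Longrightarrow> S \<subseteq> \<Sigma> \<Longrightarrow> \<Inter>S \<in> \<Sigma>"
  by (induction S rule: finite_ne_induct) (auto intro: Int_in_fan)

lemma finite_fan: "finite \<Sigma>"
  using fan by (simp add: is_fan_def)

lemma cone_of_in: "y \<in> cox \<Longrightarrow> cone_of y \<in> \<Sigma>"
  unfolding cone_of_def cox_iff using finite_fan by (intro Inter_in_fan) auto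

lemma zeros_subset: "zeros y \<subseteq> rays (cone_of y)"
  unfolding cone_of_def by (auto simp: rays_def zeros_def)

lemma cone_of_subset_iff:
  assumes "y \<in> cox" "\<sigma> \<in> \<Sigma>"
  shows "cone_of y \<subseteq> \<sigma> \<longleftrightarrow> zeros y \<subseteq> rays \<sigma>"
proof
  assume "cone_of y \<subseteq> \<sigma>"
  then have "rays (cone_of y) \<subseteq> rays \<sigma>" by (auto simp: rays_def)
  then show "zeros y \<subseteq> rays \<sigma>" using zeros_subset[of y] by blast
next
  assume "zeros y \<subseteq> rays \<sigma>"
  then show "cone_of y \<subseteq> \<sigma>" unfolding cone_of_def using assms(2) by blast
qed

lemma perp_subset_dual: "perp \<tau> \<subseteq> dual_semigroup \<tau>"
  by (auto simp: perp_def dual_semigroup_def)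

text \<open>A character of the dual cone that vanishes on the rays with a zero coordinate cuts out a face containing these rays, and
  \<open>cone_of y\<close> is the smallest such cone.\<close>

lemma cone_of_perp:
  assumes y: "y \<in> cox" and u: "u \<in> dual_semigroup (cone_of y)"
    and z: "\<And>s. s \<in> zeros y \<Longrightarrow> pairing u (p s) = 0"
  shows "u \<in> perp (cone_of y)"
proof -
  let ?F = "cone_of y \<inter> {w. real_vec u \<bullet> w = 0}"
  have "?F \<in> \<Sigma>" by (rule supporting_face[OF cone_of_in[OF y] u])
  moreover have "zeros y \<subseteq> rays ?F"
    using zeros_subset[of y] z by (auto simp: rays_def real_vec_inner)
  ultimately have "cone_of y \<subseteq> ?F" using cone_of_subset_iff[OF y] by blast
  then show ?thesis by (auto simp: perp_def)
qed

lemma char_monomial_0: "char_monomial 0 y = 1"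
  by (simp add: char_monomial_def pairing_zero_left)

lemma char_monomial_add:
  assumes \<sigma>: "\<sigma> \<in> \<Sigma>" "zeros y \<subseteq> rays \<sigma>" and u: "u \<in> dual_semigroup \<sigma>" "u' \<in> dual_semigroup \<sigma>"
  shows "char_monomial (u + u') y = char_monomial u y * char_monomial u' y"
proof -
  have "y s powi pairing (u + u') (p s) = y s powi pairing u (p s) * y s powi pairing u' (p s)"
    if s: "s \<in> {1..m}" for s
  proof (cases "y s = 0")
    case False
    then show ?thesis by (simp add: pairing_add_left power_int_add)
  next
    case True
    then have "0 \<le> pairing u (p s)" "0 \<le> pairing u' (p s)"
      using \<sigma> u s dual_semigroup_iff[OF \<sigma>(1)] by (auto simp: zeros_def)
    then show ?thesis using True by (auto simp: pairing_add_left power_int_0_left_if)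
  qed
  then show ?thesis unfolding char_monomial_def by (simp add: prod.distrib)
qed

lemma char_monomial_nonzero_iff:
  assumes y: "y \<in> cox" and u: "u \<in> dual_semigroup (cone_of y)"
  shows "char_monomial u y \<noteq> 0 \<longleftrightarrow> u \<in> perp (cone_of y)"
proof -
  have "char_monomial u y \<noteq> 0 \<longleftrightarrow> (\<forall>s\<in>zeros y. pairing u (p s) = 0)"
    by (auto simp: char_monomial_def zeros_def)
  also have "\<dots> \<longleftrightarrow> u \<in> perp (cone_of y)"
    using cone_of_perp[OF y u] perp_iff[OF cone_of_in[OF y]] zeros_subset[of y] by blast
  finally show ?thesis .
qed

lemma quot_in_orbit:
  assumes y: "y \<in> cox"
  shows "quot y \<in> orbit (cone_of y)"
proof -
  have "char_monomial (u + u') y = char_monomial u y * char_monomial u' y"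
    if "u \<in> dual_semigroup (cone_of y)" "u' \<in> dual_semigroup (cone_of y)" for u u'
    using char_monomial_add[OF cone_of_in[OF y] zeros_subset that] .
  moreover have "u + u' \<in> dual_semigroup (cone_of y)"
    if "u \<in> dual_semigroup (cone_of y)" "u' \<in> dual_semigroup (cone_of y)" for u u'
    using that by (rule dual_semigroup_add)
  moreover have "(if u \<in> dual_semigroup (cone_of y) then char_monomial u y else 0) \<noteq> 0 \<longleftrightarrow> u \<in> perp (cone_of y)" for u
    using char_monomial_nonzero_iff[OF y, of u] perp_subset_dual[of "cone_of y"] by auto
  ultimately show ?thesis unfolding quot_eq orbit_def
    using dual_semigroup_0[of "cone_of y"] by (simp add: char_monomial_0)
qed

lemma quot_in_variety: "y \<in> cox \<Longrightarrow> quot y \<in> toric_variety \<Sigma>"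
  unfolding toric_variety_orbits using quot_in_orbit cone_of_in by blast

lemma quot_in_chart_iff:
  assumes y: "y \<in> cox" and \<sigma>: "\<sigma> \<in> \<Sigma>"
  shows "quot y \<in> chart_points \<Sigma> \<sigma> \<longleftrightarrow> zeros y \<subseteq> rays \<sigma>"
proof -
  have "quot y \<in> orbit \<tau> \<longleftrightarrow> \<tau> = cone_of y" for \<tau>
    using quot_in_orbit[OF y] fst_quot[of y] by (auto simp: orbit_def)
  then show ?thesis
    unfolding chart_points_def using cone_of_in[OF y] cone_of_subset_iff[OF y \<sigma>] by auto
qed

lemma quot_char:
  assumes "y \<in> cox" "\<sigma> \<in> \<Sigma>" "zeros y \<subseteq> rays \<sigma>" "u \<in> dual_semigroup \<sigma>"
  shows "snd (quot y) u = char_monomial u y"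
proof -
  have "cone_of y \<subseteq> \<sigma>" using cone_of_subset_iff assms by blast
  then have "u \<in> dual_semigroup (cone_of y)" using dual_semigroup_antimono assms(4) by blast
  then show ?thesis by (simp add: quot_eq)
qed

section \<open>Root actions on the Cox space\<close>

definition root_monomial :: "nat \<Rightarrow> int ^ 'n \<Rightarrow> (nat \<Rightarrow> 'k::field) \<Rightarrow> 'k" where
  "root_monomial i e y = (\<Prod>s\<in>{1..m} - {i}. y s ^ nat (pairing e (p s)))"

lemma root_action_upd: "root_action m p i e \<alpha> y = y(i := y i + \<alpha> * root_monomial i e y)"
  by (simp add: root_action_eq root_monomial_def)

lemma root_monomial_upd: "root_monomial i e (y(i := c)) = root_monomial i e y"
  unfolding root_monomial_def by (rule prod.cong) auto

lemma root_action_add: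
  "root_action m p i e \<alpha> (root_action m p i e \<beta> y) = root_action m p i e (\<alpha> + \<beta>) y"
  by (simp add: root_action_upd root_monomial_upd algebra_simps)

lemma root_action_0: "root_action m p i e 0 y = y"
  by (simp add: root_action_upd)

context
  fixes i :: nat and e :: "int ^ 'n"
  assumes i: "i \<in> {1..m}" and e: "e \<in> roots_at m p i"
begin

lemma pairing_root: "pairing e (p i) = -1" "s \<in> {1..m} \<Longrightarrow> s \<noteq> i \<Longrightarrow> 0 \<le> pairing e (p s)"
  using e by (auto simp: roots_at_def)

lemma root_monomial_nonzero_iff:
  "root_monomial i e y \<noteq> 0 \<longleftrightarrow> (\<forall>s\<in>zeros y - {i}. pairing e (p s) = 0)"
proof -
  have "root_monomial i e y \<noteq> 0 \<longleftrightarrow> (\<forall>s\<in>{1..m}-{i}. y s = 0 \<longrightarrow> nat (pairing e (p s)) = 0)"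
    by (auto simp: root_monomial_def)
  also have "\<dots> \<longleftrightarrow> (\<forall>s\<in>zeros y - {i}. pairing e (p s) = 0)"
    using pairing_root(2) by (fastforce simp: zeros_def)
  finally show ?thesis .
qed

lemma zeros_root_action: "zeros (root_action m p i e \<alpha> y) - {i} = zeros y - {i}"
  by (auto simp: zeros_def root_action_upd)

lemma root_dual_semigroup:
  "\<tau> \<in> \<Sigma> \<Longrightarrow> i \<notin> rays \<tau> \<Longrightarrow> e \<in> dual_semigroup \<tau>"
  using dual_semigroup_iff pairing_root(2) rays_subset[of \<tau>] by (metis subsetD)

text \<open>The only new zero can be that of \<open>y i\<close>. It requires that the monomial is nonzero, that is, that \<open>e\<close> vanishes on the
  rays with a zero coordinate; then \<open>root_extension\<close> provides a cone containing \<open>p i\<close> as well.\<close>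

lemma root_action_cox:
  assumes y: "y \<in> cox"
  shows "root_action m p i e \<alpha> y \<in> cox"
proof -
  let ?y' = "root_action m p i e \<alpha> y"
  have "\<exists>\<sigma>\<in>\<Sigma>. zeros ?y' \<subseteq> rays \<sigma>"
  proof (cases "i \<in> zeros y \<or> i \<notin> zeros ?y' \<or> i \<in> rays (cone_of y)")
    case True
    have "zeros ?y' \<subseteq> rays (cone_of y)"
      using zeros_root_action[of \<alpha> y] zeros_subset[of y] True by blast
    then show ?thesis using cone_of_in[OF y] by blast
  next
    case False
    then have nz: "y i \<noteq> 0" "y i + \<alpha> * root_monomial i e y = 0" and ir: "i \<notin> rays (cone_of y)"
      using i by (auto simp: zeros_def root_action_upd)
    then have "root_monomial i e y \<noteq> 0" by auto
    then have "\<forall>s\<in>zeros y - {i}. pairing e (p s) = 0" using root_monomial_nonzero_iff by blast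
    then have "\<And>s. s \<in> zeros y \<Longrightarrow> pairing e (p s) = 0" using nz by (auto simp: zeros_def)
    then have "e \<in> perp (cone_of y)"
      using cone_of_perp[OF y root_dual_semigroup[OF cone_of_in[OF y] ir]] by blast
    then obtain \<tau>' where "\<tau>' \<in> \<Sigma>" "rays \<tau>' = insert i (rays (cone_of y))"
      using root_extension[OF i e cone_of_in[OF y]] by blast
    then show ?thesis using zeros_root_action[of \<alpha> y] zeros_subset[of y] by blast
  qed
  then show ?thesis using y i unfolding cox_iff by (auto simp: root_action_upd)
qed

text \<open>The part of \<open>char_monomial u y\<close> that is invariant under the action of the root at \<open>i\<close>.\<close>

definition rest_monomial :: "int ^ 'n \<Rightarrow> (nat \<Rightarrow> 'k::field) \<Rightarrow> 'k" where
  "rest_monomial u y = (\<Prod>s\<in>{1..m} - {i}. y s powi pairing u (p s))"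

lemma char_monomial_split: "char_monomial u y = y i powi pairing u (p i) * rest_monomial u y"
  unfolding char_monomial_def rest_monomial_def using i by (subst prod.remove[of _ i]) auto

lemma rest_monomial_upd: "rest_monomial u (y(i := c)) = rest_monomial u y"
  unfolding rest_monomial_def by (rule prod.cong) auto

lemma rest_monomial_shift:
  assumes "\<And>s. s \<in> {1..m} - {i} \<Longrightarrow> y s = 0 \<Longrightarrow> 0 \<le> pairing u (p s)"
  shows "rest_monomial (u + int k *s e) y = rest_monomial u y * root_monomial i e y ^ k"
proof -
  have "y s powi pairing (u + int k *s e) (p s) =
      y s powi pairing u (p s) * (y s ^ nat (pairing e (p s))) ^ k" if s: "s \<in> {1..m} - {i}" for s
  proof -
    have "0 \<le> pairing e (p s)" using pairing_root(2) s by auto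
    then have "(y s ^ nat (pairing e (p s))) ^ k = y s powi (int k * pairing e (p s))"
      by (simp add: power_int_nonneg_exp nat_mult_distrib mult.commute flip: power_mult)
    moreover have "y s powi (pairing u (p s) + int k * pairing e (p s)) =
        y s powi pairing u (p s) * y s powi (int k * pairing e (p s))"
    proof (cases "y s = 0")
      case False then show ?thesis by (simp add: power_int_add)
    next
      case True
      then have "0 \<le> pairing u (p s)" "0 \<le> int k * pairing e (p s)"
        using assms s \<open>0 \<le> pairing e (p s)\<close> by auto
      then show ?thesis
        using True add_nonneg_eq_0_iff[of "pairing u (p s)" "int k * pairing e (p s)"]
        by (auto simp: power_int_0_left_if simp del: mult_eq_0_iff)
    qed
    ultimately show ?thesis by (simp add: pairing_add_left pairing_scale_left)
  qed
  then show ?thesis unfolding rest_monomial_def root_monomial_def by (simp add: prod.distrib prod_power_distrib)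
qed

text \<open>Formally \<open>\<chi>\<^sup>u (1 + \<alpha> \<chi>\<^sup>e)\<^sup>N\<close>, expanded; each term stays regular because \<open>u + k e\<close> takes the value
  \<open>N - k\<close> on \<open>p i\<close>. The identity holds also where coordinates vanish.\<close>

lemma char_monomial_root_action_binomial:
  assumes \<sigma>: "\<sigma> \<in> \<Sigma>" "zeros y \<subseteq> rays \<sigma>" and u: "u \<in> dual_semigroup \<sigma>" and N: "pairing u (p i) = int N"
  shows "char_monomial u (root_action m p i e \<alpha> y) =
    (\<Sum>k\<le>N. of_nat (N choose k) * \<alpha> ^ k * char_monomial (u + int k *s e) y)"
proof -
  have nonneg: "0 \<le> pairing u (p s)" if "s \<in> {1..m} - {i}" "y s = 0" for s
    using dual_semigroup_iff[OF \<sigma>(1)] u \<sigma>(2) that by (auto simp: zeros_def)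
  have summand: "char_monomial (u + int k *s e) y = y i ^ (N - k) * rest_monomial u y * root_monomial i e y ^ k" if "k \<le> N" for k
  proof -
    have "pairing (u + int k *s e) (p i) = int (N - k)"
      using N that pairing_root(1) by (simp add: pairing_add_left pairing_scale_left)
    moreover have "rest_monomial (u + int k *s e) y = rest_monomial u y * root_monomial i e y ^ k"
      by (rule rest_monomial_shift) (rule nonneg)
    ultimately show ?thesis by (simp add: char_monomial_split)
  qed
  have "char_monomial u (root_action m p i e \<alpha> y) = (\<alpha> * root_monomial i e y + y i) ^ N * rest_monomial u y"
    unfolding char_monomial_split root_action_upd rest_monomial_upd N by (simp add: add.commute)
  also have "\<dots> = (\<Sum>k\<le>N. of_nat (N choose k) * (\<alpha> * root_monomial i e y) ^ k * y i ^ (N - k) * rest_monomial u y)"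
    by (simp add: binomial_ring sum_distrib_right)
  also have "\<dots> = (\<Sum>k\<le>N. of_nat (N choose k) * \<alpha> ^ k * char_monomial (u + int k *s e) y)"
    by (rule sum.cong) (auto simp: summand power_mult_distrib)
  finally show ?thesis .
qed

lemma root_string_dual:
  assumes "\<sigma> \<in> \<Sigma>" "u \<in> dual_semigroup \<sigma>" "int k \<le> pairing u (p i)"
  shows "u + int k *s e \<in> dual_semigroup \<sigma>"
  unfolding dual_semigroup_iff[OF assms(1)]
proof
  fix s assume s: "s \<in> rays \<sigma>"
  then have "0 \<le> pairing u (p s)" using dual_semigroup_iff assms by blast
  then show "0 \<le> pairing (u + int k *s e) (p s)"
    using pairing_root s rays_subset[of \<sigma>] assms(3)
    by (cases "s = i") (auto simp: pairing_add_left pairing_scale_left subset_iff)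
qed

lemma regular_binomial:
  assumes \<sigma>: "\<sigma> \<in> \<Sigma>" and u: "u \<in> dual_semigroup \<sigma>" and N: "0 \<le> pairing u (p i)"
  shows "\<exists>g. chart_regular \<Sigma> \<sigma> g \<and>
    (\<forall>y\<in>cox. zeros y \<subseteq> rays \<sigma> \<longrightarrow> char_monomial u (root_action m p i e (\<alpha> :: 'k::field_char_0) y) = g (quot y))"
proof -
  let ?N = "nat (pairing u (p i))"
  let ?g = "\<lambda>z :: ('n, 'k) toric_point.
     \<Sum>k\<le>?N. of_nat (?N choose k) * \<alpha> ^ k * snd z (u + int k *s e)"
  have N: "pairing u (p i) = int ?N" using N by simp
  have in_dual: "u + int k *s e \<in> dual_semigroup \<sigma>" if "k \<le> ?N" for k
    using root_string_dual[OF \<sigma> u, of k] that N by linarith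
  have "chart_regular \<Sigma> \<sigma> ?g"
    using in_dual by (intro chart_regular_sum chart_regular_scaled_char) auto
  moreover have "char_monomial u (root_action m p i e \<alpha> y) = ?g (quot y)" if "y \<in> cox" "zeros y \<subseteq> rays \<sigma>" for y
    unfolding char_monomial_root_action_binomial[OF \<sigma> that(2) u N]
    by (rule sum.cong) (auto simp: quot_char[OF that(1) \<sigma> that(2) in_dual])
  ultimately show ?thesis by blast
qed

text \<open>This single statement yields both that the action descends to the quotient, and that the descended map is a
  morphism: the values of characters at the image are expressed by regular functions at the original point.\<close>

lemma root_action_locally_monomial:
  fixes y :: "nat \<Rightarrow> 'k::field_char_0"
  assumes y: "y \<in> cox" and \<sigma>': "\<sigma>' \<in> \<Sigma>" "zeros (root_action m p i e \<alpha> y) \<subseteq> rays \<sigma>'"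
  shows "\<exists>\<sigma>\<in>\<Sigma>. \<exists>h. chart_regular \<Sigma> \<sigma> h \<and> zeros y \<subseteq> rays \<sigma> \<and> h (quot y) \<noteq> 0 \<and>
     (\<forall>y'\<in>cox. zeros y' \<subseteq> rays \<sigma> \<and> h (quot y') \<noteq> 0 \<longrightarrow> zeros (root_action m p i e \<alpha> y') \<subseteq> rays \<sigma>') \<and>
     (\<forall>u\<in>dual_semigroup \<sigma>'. \<exists>k g. chart_regular \<Sigma> \<sigma> g \<and>
        (\<forall>y'\<in>cox. zeros y' \<subseteq> rays \<sigma> \<and> h (quot y') \<noteq> 0 \<longrightarrow>
           char_monomial u (root_action m p i e \<alpha> y') * h (quot y') ^ k = g (quot y')))"
    (is "\<exists>\<sigma>\<in>\<Sigma>. \<exists>h. ?L \<sigma> h")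
proof -
  let ?R = "root_action m p i e \<alpha>"
  note zR = zeros_root_action[of \<alpha>]
  consider (stable) "i \<in> rays \<sigma>'" | (units) "i \<notin> rays \<sigma>'" "y i \<noteq> 0" | (leaving) "i \<notin> rays \<sigma>'" "y i = 0"
    by blast
  then show ?thesis
  proof cases
    case stable
    \<comment> \<open>The source chart is the target chart, which the action preserves.\<close>
    have "?L \<sigma>' (\<lambda>_. 1)"
    proof (intro conjI ballI impI)
      show "zeros y \<subseteq> rays \<sigma>'" using zR[of y] \<sigma>'(2) stable by blast
      show "zeros (?R y') \<subseteq> rays \<sigma>'" if "zeros y' \<subseteq> rays \<sigma>' \<and> (1 :: 'k) \<noteq> 0" for y' :: "nat \<Rightarrow> 'k"
        using zR[of y'] that stable by blast
      fix u assume u: "u \<in> dual_semigroup \<sigma>'"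
      then have "0 \<le> pairing u (p i)" using dual_semigroup_iff[OF \<sigma>'(1)] stable by blast
      then obtain g where "chart_regular \<Sigma> \<sigma>' g"
        "\<forall>y\<in>cox. zeros y \<subseteq> rays \<sigma>' \<longrightarrow> char_monomial u (?R y) = g (quot y)"
        using regular_binomial[OF \<sigma>'(1) u] by blast
      then show "\<exists>k g. chart_regular \<Sigma> \<sigma>' g \<and>
        (\<forall>y'\<in>cox. zeros y' \<subseteq> rays \<sigma>' \<and> (1 :: 'k) \<noteq> 0 \<longrightarrow> char_monomial u (?R y') * 1 ^ k = g (quot y'))"
        by (intro exI[of _ 0] exI[of _ g]) auto
    qed (simp_all add: chart_regular_const)
    then show ?thesis using \<sigma>'(1) by blast
  next
    case units
    \<comment> \<open>Here \<open>y i\<close> is invertible and \<open>e\<close> is a regular character, so \<open>y i\<close> gets multiplied by \<open>1 + \<alpha> \<chi>\<^sup>e\<close>, which is inverted.\<close>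
    have ed: "e \<in> dual_semigroup \<sigma>'" by (rule root_dual_semigroup[OF \<sigma>'(1) units(1)])
    let ?h = "\<lambda>z :: ('n, 'k) toric_point. 1 + \<alpha> * snd z e"
    have hreg: "chart_regular \<Sigma> \<sigma>' ?h"
      by (intro chart_regular_add chart_regular_const chart_regular_scaled_char ed)
    have inz: "y' i \<noteq> 0" if "zeros y' \<subseteq> rays \<sigma>'" for y' :: "nat \<Rightarrow> 'k"
      using units(1) that i by (auto simp: zeros_def)
    have Ri: "?R y' i = y' i * ?h (quot y')" if y': "y' \<in> cox" "zeros y' \<subseteq> rays \<sigma>'" for y'
    proof -
      have "rest_monomial (0 + int 1 *s e) y' = rest_monomial 0 y' * root_monomial i e y' ^ 1"
        by (rule rest_monomial_shift) (simp add: pairing_zero_left)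
      then have "rest_monomial e y' = root_monomial i e y'" by (simp add: rest_monomial_def pairing_zero_left)
      then have "snd (quot y') e = y' i powi -1 * root_monomial i e y'"
        using quot_char[OF y'(1) \<sigma>'(1) y'(2) ed] pairing_root(1) by (simp add: char_monomial_split)
      then show ?thesis using inz[OF y'(2)] by (simp add: root_action_upd field_simps power_int_minus)
    qed
    have zy: "zeros y \<subseteq> rays \<sigma>'" using zR[of y] \<sigma>'(2) units i by (auto simp: zeros_def)
    have "?L \<sigma>' ?h"
    proof (intro conjI ballI impI)
      show "?h (quot y) \<noteq> 0" using Ri[OF y zy] \<sigma>'(2) units(1) i by (auto simp: zeros_def)
      fix y' assume y': "y' \<in> cox" "zeros y' \<subseteq> rays \<sigma>' \<and> ?h (quot y') \<noteq> 0"
      then have "?R y' i \<noteq> 0" using Ri[of y'] inz[of y'] by simp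
      then show "zeros (?R y') \<subseteq> rays \<sigma>'" using zR[of y'] y' by (auto simp: zeros_def)
    next
      fix u assume u: "u \<in> dual_semigroup \<sigma>'"
      let ?a = "pairing u (p i)"
      let ?k = "nat (- ?a)"
      let ?g = "\<lambda>z. snd z u * ?h z ^ nat ?a"
      have "chart_regular \<Sigma> \<sigma>' ?g" using u hreg by (intro chart_regular_mult chart_regular_char chart_regular_power)
      moreover have "char_monomial u (?R y') * ?h (quot y') ^ ?k = ?g (quot y')"
        if y': "y' \<in> cox" "zeros y' \<subseteq> rays \<sigma>'" "?h (quot y') \<noteq> 0" for y'
      proof -
        have "char_monomial u (?R y') = (y' i * ?h (quot y')) powi ?a * rest_monomial u y'"
          unfolding char_monomial_split Ri[OF y'(1,2)] by (simp add: root_action_upd rest_monomial_upd)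
        also have "\<dots> = char_monomial u y' * ?h (quot y') powi ?a"
          by (simp add: char_monomial_split power_int_mult_distrib)
        finally have "char_monomial u (?R y') * ?h (quot y') ^ ?k = char_monomial u y' * (?h (quot y') powi ?a * ?h (quot y') powi int ?k)"
          unfolding power_int_of_nat by (simp only: mult.assoc)
        also have "?h (quot y') powi ?a * ?h (quot y') powi int ?k = ?h (quot y') powi (?a + int ?k)"
          using y'(3) by (simp add: power_int_add)
        also have "?a + int ?k = int (nat ?a)" by simp
        also have "?h (quot y') powi int (nat ?a) = ?h (quot y') ^ nat ?a" by (rule power_int_of_nat)
        finally show ?thesis using quot_char[OF y'(1) \<sigma>'(1) y'(2) u] by (simp only:)
      qed
      ultimately show "\<exists>k g. chart_regular \<Sigma> \<sigma>' g \<and> (\<forall>y'\<in>cox. zeros y' \<subseteq> rays \<sigma>' \<and> ?h (quot y') \<noteq> 0 \<longrightarrow>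
           char_monomial u (?R y') * ?h (quot y') ^ k = g (quot y'))" by blast
    qed (use hreg zy in auto)
    then show ?thesis using \<sigma>'(1) by blast
  next
    case leaving
    \<comment> \<open>The action moves the point off the divisor of \<open>p i\<close>. The chart of the cone spanned by the new cone and \<open>p i\<close> is preserved, and its part with \<open>y i \<noteq> 0\<close> after the action is given by \<open>\<alpha> + \<chi>\<^sup>-\<^sup>e \<noteq> 0\<close>.\<close>
    have Ry: "?R y \<in> cox" by (rule root_action_cox[OF y])
    let ?\<tau>' = "cone_of (?R y)"
    have \<tau>': "?\<tau>' \<in> \<Sigma>" "?\<tau>' \<subseteq> \<sigma>'" using cone_of_in[OF Ry] cone_of_subset_iff[OF Ry \<sigma>'(1)] \<sigma>'(2) by auto
    then have i\<tau>': "i \<notin> rays ?\<tau>'" using subcone_iff[OF \<tau>'(1) \<sigma>'(1)] leaving(1) by blast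
    have Riy: "?R y i \<noteq> 0" using leaving(1) \<sigma>'(2) i by (auto simp: zeros_def)
    then have "\<alpha> \<noteq> 0" "root_monomial i e y \<noteq> 0" using leaving(2) by (auto simp: root_action_upd)
    then have e0: "\<forall>s\<in>zeros y - {i}. pairing e (p s) = 0" using root_monomial_nonzero_iff by blast
    have zRy: "zeros (?R y) = zeros y - {i}" using zR[of y] Riy by (auto simp: zeros_def)
    have eperp: "e \<in> perp ?\<tau>'"
      using cone_of_perp[OF Ry root_dual_semigroup[OF \<tau>'(1) i\<tau>']] e0 zRy by blast
    obtain \<tau> where \<tau>: "\<tau> \<in> \<Sigma>" "rays \<tau> = insert i (rays ?\<tau>')"
      using root_extension[OF i e \<tau>'(1) eperp] by blast
    have e\<tau>: "pairing e (p s) = 0" if "s \<in> rays \<tau>" "s \<noteq> i" for s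
      using eperp perp_iff[OF \<tau>'(1)] \<tau>(2) that by blast
    have neg: "- e \<in> dual_semigroup \<tau>" unfolding dual_semigroup_iff[OF \<tau>(1)]
    proof
      fix s assume "s \<in> rays \<tau>"
      then show "0 \<le> pairing (- e) (p s)" using e\<tau>[of s] pairing_root(1) by (cases "s = i") (auto simp: pairing_minus_left)
    qed
    let ?h = "\<lambda>z :: ('n, 'k) toric_point. snd z (- e) + \<alpha>"
    have hreg: "chart_regular \<Sigma> \<tau> ?h"
      by (intro chart_regular_add chart_regular_const chart_regular_char neg)
    have mono_nz: "root_monomial i e y' \<noteq> 0" if "zeros y' \<subseteq> rays \<tau>" for y' :: "nat \<Rightarrow> 'k"
      using root_monomial_nonzero_iff e\<tau> that by blast
    have inv: "rest_monomial (- e) y' = inverse (root_monomial i e y')" if y': "zeros y' \<subseteq> rays \<tau>" for y' :: "nat \<Rightarrow> 'k"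
    proof -
      have "rest_monomial (- e + int 1 *s e) y' = rest_monomial (- e) y' * root_monomial i e y' ^ 1"
      proof (rule rest_monomial_shift)
        fix s assume "s \<in> {1..m} - {i}" "y' s = 0"
        then have "s \<in> rays \<tau>" "s \<noteq> i" using y' by (auto simp: zeros_def)
        then show "0 \<le> pairing (- e) (p s)" using e\<tau> by (simp add: pairing_minus_left)
      qed
      then have "1 = rest_monomial (- e) y' * root_monomial i e y'"
        by (simp add: rest_monomial_def pairing_zero_left)
      then show ?thesis using mono_nz[OF y'] by (metis inverse_unique mult.commute)
    qed
    have h: "?h (quot y') = ?R y' i / root_monomial i e y'" if y': "y' \<in> cox" "zeros y' \<subseteq> rays \<tau>" for y'
    proof -
      have "snd (quot y') (- e) = y' i * inverse (root_monomial i e y')"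
        using quot_char[OF y'(1) \<tau>(1) y'(2) neg] inv[OF y'(2)] pairing_root(1)
        by (simp add: char_monomial_split pairing_minus_left)
      then show ?thesis using mono_nz[OF y'(2)] by (simp add: root_action_upd field_simps)
    qed
    have zy: "zeros y \<subseteq> rays \<tau>" using zRy zeros_subset[of "?R y"] \<tau>(2) by blast
    have "?L \<tau> ?h"
    proof (intro conjI ballI impI)
      show "?h (quot y) \<noteq> 0" using h[OF y zy] Riy mono_nz[OF zy] by simp
      fix y' assume y': "y' \<in> cox" "zeros y' \<subseteq> rays \<tau> \<and> ?h (quot y') \<noteq> 0"
      then have "?R y' i \<noteq> 0" using h by auto
      then have "zeros (?R y') = zeros y' - {i}" using zR[of y'] by (auto simp: zeros_def)
      then have "zeros (?R y') \<subseteq> rays ?\<tau>'" using y' \<tau>(2) by blast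
      then show "zeros (?R y') \<subseteq> rays \<sigma>'" using subcone_iff[OF \<tau>'(1) \<sigma>'(1)] \<tau>'(2) by blast
    next
      fix u assume u: "u \<in> dual_semigroup \<sigma>'"
      define k where "k = nat (- pairing u (p i))"
      let ?u = "u + int k *s (- e)"
      have u\<tau>': "0 \<le> pairing u (p s)" if "s \<in> rays ?\<tau>'" for s
        using u dual_semigroup_iff[OF \<sigma>'(1)] subcone_iff[OF \<tau>'(1) \<sigma>'(1)] \<tau>'(2) that by blast
      have ui: "pairing ?u (p i) = pairing u (p i) + int k"
        unfolding pairing_add_left pairing_scale_left pairing_minus_left pairing_root(1) by simp
      have udual: "?u \<in> dual_semigroup \<tau>" unfolding dual_semigroup_iff[OF \<tau>(1)]
      proof
        fix s assume s: "s \<in> rays \<tau>"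
        show "0 \<le> pairing ?u (p s)"
        proof (cases "s = i")
          case True then show ?thesis using ui k_def by simp
        next
          case False
          then show ?thesis unfolding pairing_add_left pairing_scale_left pairing_minus_left
            using e\<tau>[OF s False] u\<tau>'[of s] s \<tau>(2) by auto
        qed
      qed
      have "0 \<le> pairing ?u (p i)" using ui k_def by simp
      then obtain g where g: "chart_regular \<Sigma> \<tau> g"
        "\<forall>y\<in>cox. zeros y \<subseteq> rays \<tau> \<longrightarrow> char_monomial ?u (?R y) = g (quot y)"
        using regular_binomial[OF \<tau>(1) udual] by blast
      have "char_monomial u (?R y') * ?h (quot y') ^ k = g (quot y')"
        if y': "y' \<in> cox" "zeros y' \<subseteq> rays \<tau>" "?h (quot y') \<noteq> 0" for y'
      proof -
        let ?m = "root_monomial i e y'"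
        have nz: "?R y' i \<noteq> 0" "?m \<noteq> 0" using h[OF y'(1,2)] y'(3) mono_nz[OF y'(2)] by auto
        have "rest_monomial (?u + int k *s e) y' = rest_monomial ?u y' * ?m ^ k"
        proof (rule rest_monomial_shift)
          fix s assume "s \<in> {1..m} - {i}" "y' s = 0"
          then have "s \<in> rays \<tau>" using y' by (auto simp: zeros_def)
          then show "0 \<le> pairing ?u (p s)" using udual dual_semigroup_iff[OF \<tau>(1)] by blast
        qed
        moreover have "?u + int k *s e = u" by (simp add: vec_eq_iff)
        ultimately have ru: "rest_monomial u y' = rest_monomial ?u y' * ?m ^ k" by simp
        have "char_monomial u (?R y') * ?h (quot y') ^ k =
            ?R y' i powi pairing u (p i) * rest_monomial u y' * (?R y' i / ?m) ^ k"
          unfolding h[OF y'(1,2)] char_monomial_split by (simp add: root_action_upd rest_monomial_upd)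
        also have "\<dots> = ?R y' i powi pairing u (p i) * ?R y' i powi int k * rest_monomial ?u y'"
          unfolding ru using nz by (simp add: power_divide field_simps)
        also have "\<dots> = ?R y' i powi pairing ?u (p i) * rest_monomial ?u y'"
          unfolding ui using nz by (simp add: power_int_add)
        also have "\<dots> = char_monomial ?u (?R y')" unfolding char_monomial_split by (simp add: root_action_upd rest_monomial_upd)
        also have "\<dots> = g (quot y')" using g(2) y' by blast
        finally show ?thesis .
      qed
      then show "\<exists>k g. chart_regular \<Sigma> \<tau> g \<and> (\<forall>y'\<in>cox. zeros y' \<subseteq> rays \<tau> \<and> ?h (quot y') \<noteq> 0 \<longrightarrow>
           char_monomial u (?R y') * ?h (quot y') ^ k = g (quot y'))" using g(1) by blast
    qed (use hreg zy in auto)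
    then show ?thesis using \<tau>(1) by blast
  qed
qed

text \<open>Points with the same image agree in all regular functions, hence by
  \<open>root_action_locally_monomial\<close> their translates have the same smallest cone and the same character values.\<close>

lemma quot_root_action_cong:
  fixes y y' :: "nat \<Rightarrow> 'k::field_char_0"
  assumes y: "y \<in> cox" "y' \<in> cox" "quot y = quot y'"
  shows "quot (root_action m p i e \<alpha> y) = quot (root_action m p i e \<alpha> y')"
proof -
  let ?R = "root_action m p i e \<alpha>"
  have same: "zeros (?R y') \<subseteq> rays \<sigma>' \<and> (\<forall>u\<in>dual_semigroup \<sigma>'. char_monomial u (?R y) = char_monomial u (?R y'))"
    if y: "y \<in> cox" "y' \<in> cox" "quot y = quot y'" and \<sigma>': "\<sigma>' \<in> \<Sigma>" "zeros (?R y) \<subseteq> rays \<sigma>'"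
    for y y' :: "nat \<Rightarrow> 'k" and \<sigma>'
  proof -
    from root_action_locally_monomial[OF y(1) \<sigma>']
    obtain \<sigma> h where \<sigma>: "\<sigma> \<in> \<Sigma>" "chart_regular \<Sigma> \<sigma> h" "zeros y \<subseteq> rays \<sigma>" "h (quot y) \<noteq> 0"
     and maps: "\<forall>y'\<in>cox. zeros y' \<subseteq> rays \<sigma> \<and> h (quot y') \<noteq> 0 \<longrightarrow> zeros (?R y') \<subseteq> rays \<sigma>'"
     and ex: "\<forall>u\<in>dual_semigroup \<sigma>'. \<exists>k g. chart_regular \<Sigma> \<sigma> g \<and>
        (\<forall>y'\<in>cox. zeros y' \<subseteq> rays \<sigma> \<and> h (quot y') \<noteq> 0 \<longrightarrow> char_monomial u (?R y') * h (quot y') ^ k = g (quot y'))"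
      by (elim bexE exE conjE) (rule that; assumption)
    have "cone_of y = cone_of y'" using y(3) fst_quot by metis
    then have zy': "zeros y' \<subseteq> rays \<sigma>" using cone_of_subset_iff y(1,2) \<sigma>(1,3) by metis
    have "char_monomial u (?R y) = char_monomial u (?R y')" if u: "u \<in> dual_semigroup \<sigma>'" for u
    proof -
      obtain k g where "\<forall>y'\<in>cox. zeros y' \<subseteq> rays \<sigma> \<and> h (quot y') \<noteq> 0 \<longrightarrow> char_monomial u (?R y') * h (quot y') ^ k = g (quot y')"
        using bspec[OF ex u] by blast
      then have "char_monomial u (?R y) * h (quot y) ^ k = g (quot y)" "char_monomial u (?R y') * h (quot y') ^ k = g (quot y')"
        using y \<sigma> zy' by auto
      moreover have "h (quot y) ^ k \<noteq> 0" using \<sigma>(4) by simp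
      ultimately show ?thesis unfolding y(3) by (metis mult_right_cancel)
    qed
    then show ?thesis using bspec[OF maps y(2)] zy' y(3) \<sigma>(4) by simp
  qed
  have R: "?R y \<in> cox" "?R y' \<in> cox" using root_action_cox y by auto
  have sub: "cone_of (?R y') \<subseteq> cone_of (?R y)" if "y \<in> cox" "y' \<in> cox" "quot y = quot y'" for y y' :: "nat \<Rightarrow> 'k"
    using same[OF that cone_of_in[OF root_action_cox[OF that(1)]] zeros_subset]
      cone_of_subset_iff[OF root_action_cox[OF that(2)] cone_of_in[OF root_action_cox[OF that(1)]]] by blast
  have "cone_of (?R y) = cone_of (?R y')" using sub[OF y] sub[OF y(2,1) y(3)[symmetric]] by blast
  moreover have "\<forall>u\<in>dual_semigroup (cone_of (?R y)). char_monomial u (?R y) = char_monomial u (?R y')"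
    using same[OF y cone_of_in[OF R(1)] zeros_subset] by blast
  ultimately show ?thesis unfolding quot_eq by auto
qed

end
end

section \<open>Surjectivity of the Cox quotient\<close>

definition lattice_subgroup :: "(int ^ 'n) set \<Rightarrow> bool" where
  "lattice_subgroup H \<longleftrightarrow> 0 \<in> H \<and> (\<forall>u\<in>H. - u \<in> H) \<and> (\<forall>u\<in>H. \<forall>w\<in>H. u + w \<in> H)"

definition character_on :: "(int ^ 'n) set \<Rightarrow> (int ^ 'n \<Rightarrow> 'k::field) \<Rightarrow> bool" where
  "character_on H t \<longleftrightarrow> (\<forall>u\<in>H. t u \<noteq> 0) \<and> (\<forall>u\<in>H. \<forall>w\<in>H. t (u + w) = t u * t w)"

lemma character_0:
  assumes "lattice_subgroup H" "character_on H t" shows "t 0 = 1"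
proof -
  have "t (0 + 0) = t 0 * t 0" "t 0 \<noteq> 0" using assms unfolding lattice_subgroup_def character_on_def by blast+
  then show ?thesis by simp
qed

lemma character_minus:
  assumes "lattice_subgroup H" "character_on H t" "u \<in> H" shows "t (- u) = inverse (t u)"
proof -
  have "t (- u + u) = t (- u) * t u" using assms unfolding lattice_subgroup_def character_on_def by blast
  then have "t (- u) * t u = 1" using character_0[OF assms(1,2)] by simp
  then show ?thesis by (metis inverse_unique mult.commute)
qed

lemma character_scale:
  assumes H: "lattice_subgroup H" "character_on H t" "u \<in> H"
  shows "k *s u \<in> H \<and> t (k *s u) = t u powi k"
proof -
  have nat: "int j *s u \<in> H \<and> t (int j *s u) = t u ^ j" for j
  proof (induction j)
    case 0 then show ?case using H(1) character_0[OF H(1,2)] by (simp add: lattice_subgroup_def)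
  next
    case (Suc j)
    have "int (Suc j) *s u = u + int j *s u" by (simp add: vec_eq_iff algebra_simps)
    moreover have "u + int j *s u \<in> H" "t (u + int j *s u) = t u * t (int j *s u)"
      using Suc H unfolding lattice_subgroup_def character_on_def by blast+
    ultimately show ?case using Suc by simp
  qed
  show ?thesis
  proof (cases "0 \<le> k")
    case True
    then show ?thesis using nat[of "nat k"] by (simp add: power_int_nonneg_exp)
  next
    case False
    then obtain j where k: "k = - int j" by (metis nonpos_int_cases linorder_le_cases)
    have "- (int j *s u) \<in> H" using nat[of j] H(1) unfolding lattice_subgroup_def by blast
    moreover have "t (- (int j *s u)) = inverse (t u ^ j)"
      using character_minus[OF H(1,2)] nat[of j] by simp
    moreover have "k *s u = - (int j *s u)" by (simp add: k vec_eq_iff)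
    moreover have "t u powi k = inverse (t u ^ j)" by (simp add: k power_int_minus)
    ultimately show ?thesis by simp
  qed
qed

text \<open>If a positive multiple of \<open>g\<close> lies in \<open>H\<close>, take the least such multiple \<open>d\<close> and a \<open>d\<close>-th root of the prescribed
  value; otherwise any value will do.\<close>

lemma character_extension_value:
  fixes t :: "int ^ 'n \<Rightarrow> 'k::alg_closed_field"
  assumes H: "lattice_subgroup H" "character_on H t"
  shows "\<exists>\<rho>. \<rho> \<noteq> 0 \<and> (\<forall>k. k *s g \<in> H \<longrightarrow> t (k *s g) = \<rho> powi k)"
proof (cases "\<exists>j>0. int j *s g \<in> H")
  case False
  have "k = 0" if "k *s g \<in> H" for k
  proof (rule ccontr)
    assume "k \<noteq> 0"
    then consider "k = int (nat k)" "nat k > 0" | "k = - int (nat (- k))" "nat (- k) > 0" by linarith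
    then show False
    proof cases
      case 1 then show False using False that by metis
    next
      case 2
      have "int (nat (- k)) *s g = - (k *s g)" using 2 by (simp add: vec_eq_iff)
      then show False using False that 2 H(1) unfolding lattice_subgroup_def by metis
    qed
  qed
  then have "t (k *s g) = 1 powi k" if "k *s g \<in> H" for k
    using that character_0[OF H] by fastforce
  then show ?thesis by (intro exI[of _ 1]) auto
next
  case True
  \<comment> \<open>By division with remainder, every multiple of \<open>g\<close> in \<open>H\<close> is a multiple of \<open>d\<close> times \<open>g\<close>.\<close>
  define d where "d = (LEAST j. j > 0 \<and> int j *s g \<in> H)"
  have d: "d > 0" "int d *s g \<in> H" using LeastI_ex[OF True] unfolding d_def by auto
  obtain \<rho> where \<rho>: "\<rho> ^ d = t (int d *s g)" using nth_root_exists[OF d(1)] by blast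
  have nz: "\<rho> \<noteq> 0"
  proof
    assume "\<rho> = 0"
    then have "t (int d *s g) = 0" using \<rho>[symmetric] d(1) by simp
    then show False using H(2) d(2) unfolding character_on_def by blast
  qed
  have "t (k *s g) = \<rho> powi k" if k: "k *s g \<in> H" for k
  proof -
    let ?r = "k mod int d" and ?j = "k div int d"
    have r: "?r *s g = k *s g + (- ?j) *s (int d *s g)"
      by (simp add: vec_eq_iff minus_div_mult_eq_mod algebra_simps flip: minus_mult_div_eq_mod)
    have "(- ?j) *s (int d *s g) \<in> H" using character_scale[OF H d(2)] by blast
    then have "?r *s g \<in> H" using r k H(1) unfolding lattice_subgroup_def by simp
    moreover have r0: "0 \<le> ?r" "?r < int d" using d(1) by auto
    ultimately have "?r = 0"
      using not_less_Least[of "nat ?r" "\<lambda>j. j > 0 \<and> int j *s g \<in> H"] unfolding d_def[symmetric]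
      by (metis int_nat_eq nat_0_iff nat_less_iff not_gr_zero order_antisym)
    then have kd: "k = int d * ?j" by (metis add.right_neutral mult_div_mod_eq)
    then have "k *s g = ?j *s (int d *s g)" by (metis vector_smult_assoc mult.commute)
    then have "t (k *s g) = t (int d *s g) powi ?j" using character_scale[OF H d(2)] by metis
    also have "\<dots> = \<rho> powi (int d * ?j)" by (simp add: power_int_power flip: \<rho>)
    finally show ?thesis using kd by simp
  qed
  then show ?thesis using nz by blast
qed

lemma character_extension_step:
  fixes t :: "int ^ 'n \<Rightarrow> 'k::alg_closed_field"
  assumes H: "lattice_subgroup H" "character_on H t"
  shows "\<exists>H' t'. lattice_subgroup H' \<and> H \<subseteq> H' \<and> g \<in> H' \<and> character_on H' t' \<and> (\<forall>u\<in>H. t' u = t u)"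
proof -
  obtain \<rho> where \<rho>: "\<rho> \<noteq> 0" "\<And>k. k *s g \<in> H \<Longrightarrow> t (k *s g) = \<rho> powi k"
    using character_extension_value[OF H] by blast
  define H' where "H' = {h + k *s g | h k. h \<in> H}"
  define rep where "rep u = (SOME hk. fst hk \<in> H \<and> u = fst hk + snd hk *s g)" for u
  define t' where "t' u = t (fst (rep u)) * \<rho> powi snd (rep u)" for u
  \<comment> \<open>The value does not depend on the chosen representation, since the difference of two representations is a multiple of \<open>g\<close> in \<open>H\<close>.\<close>
  have t': "t' (h + k *s g) = t h * \<rho> powi k" if h: "h \<in> H" for h k
  proof -
    have "\<exists>hk. fst hk \<in> H \<and> h + k *s g = fst hk + snd hk *s g" using h by (intro exI[of _ "(h, k)"]) simp
    then have some: "fst (rep (h + k *s g)) \<in> H \<and>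
        h + k *s g = fst (rep (h + k *s g)) + snd (rep (h + k *s g)) *s g"
      unfolding rep_def by (rule someI_ex)
    obtain h' k' where hk: "rep (h + k *s g) = (h', k')" by (rule prod.exhaust)
    then have r: "rep (h + k *s g) = (h', k')" "h' \<in> H" "h + k *s g = h' + k' *s g"
      using some by simp_all
    have eq: "(k - k') *s g = h' + - h" using r(3) by (simp add: vec_eq_iff algebra_simps)
    have "h' + - h \<in> H" using h r(2) H(1) unfolding lattice_subgroup_def by blast
    then have "t (h' + - h) = \<rho> powi (k - k')" using \<rho>(2)[of "k - k'"] eq by simp
    moreover have "t (h' + - h) = t h' * inverse (t h)"
    proof -
      have "- h \<in> H" using H(1) h by (simp add: lattice_subgroup_def)
      then have "t (h' + - h) = t h' * t (- h)" using H(2) r(2) unfolding character_on_def by blast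
      then show ?thesis using character_minus[OF H h] by simp
    qed
    moreover have "t h \<noteq> 0" using H(2) h unfolding character_on_def by blast
    ultimately have "t h' = t h * \<rho> powi (k - k')" by (simp add: field_simps)
    then show ?thesis unfolding t'_def r(1) using \<rho>(1) by (simp add: power_int_diff field_simps)
  qed
  have sub: "lattice_subgroup H'" unfolding lattice_subgroup_def
  proof (intro conjI ballI)
    have "0 = 0 + 0 *s g" "(0 :: int ^ 'n) \<in> H" using H(1) by (auto simp: lattice_subgroup_def)
    then show "0 \<in> H'" unfolding H'_def by blast
    fix u assume "u \<in> H'"
    then obtain h k where u: "u = h + k *s g" "h \<in> H" unfolding H'_def by blast
    have "- u = - h + (- k) *s g" "- h \<in> H" using u H(1) by (auto simp: lattice_subgroup_def vec_eq_iff)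
    then show "- u \<in> H'" unfolding H'_def by blast
    fix w assume "w \<in> H'"
    then obtain h' k' where w: "w = h' + k' *s g" "h' \<in> H" unfolding H'_def by blast
    have "u + w = (h + h') + (k + k') *s g" "h + h' \<in> H"
      using u w H(1) by (auto simp: lattice_subgroup_def vec_eq_iff algebra_simps)
    then show "u + w \<in> H'" unfolding H'_def by blast
  qed
  have char: "character_on H' t'" unfolding character_on_def
  proof (intro conjI ballI)
    fix u assume "u \<in> H'"
    then obtain h k where u: "u = h + k *s g" "h \<in> H" unfolding H'_def by blast
    show "t' u \<noteq> 0" using H(2) u \<rho>(1) by (simp add: t' character_on_def)
    fix w assume "w \<in> H'"
    then obtain h' k' where w: "w = h' + k' *s g" "h' \<in> H" unfolding H'_def by blast
    have "u + w = (h + h') + (k + k') *s g" "h + h' \<in> H"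
      using u w H(1) by (auto simp: lattice_subgroup_def vec_eq_iff algebra_simps)
    moreover have "t (h + h') = t h * t h'" using H(2) u w by (simp add: character_on_def)
    ultimately have "t' (u + w) = t h * t h' * \<rho> powi (k + k')" by (simp only: t')
    then show "t' (u + w) = t' u * t' w" using u w \<rho>(1) by (simp add: t' power_int_add)
  qed
  have ext: "u \<in> H' \<and> t' u = t u" if "u \<in> H" for u
  proof -
    have "u = u + 0 *s g" by simp
    then have "u \<in> H'" using that unfolding H'_def by blast
    then show ?thesis using t'[OF that, of 0] by simp
  qed
  have "g = 0 + 1 *s g" "(0 :: int ^ 'n) \<in> H" using H(1) by (auto simp: lattice_subgroup_def)
  then have "g \<in> H'" unfolding H'_def by blast
  then show ?thesis using sub char ext by (intro exI[of _ H'] exI[of _ t']) auto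
qed

text \<open>The multiplicative group of an algebraically closed field is divisible, so characters extend from a subgroup to
  generators of the lattice one by one.\<close>

lemma character_extension:
  fixes t :: "int ^ 'n \<Rightarrow> 'k::alg_closed_field"
  assumes "lattice_subgroup H" "character_on H t" "finite J"
  shows "\<exists>H' t'. lattice_subgroup H' \<and> H \<subseteq> H' \<and> J \<subseteq> H' \<and> character_on H' t' \<and> (\<forall>u\<in>H. t' u = t u)"
  using assms(3)
proof (induction J rule: finite_induct)
  case empty then show ?case using assms by blast
next
  case (insert g J)
  then obtain H' t' where H': "lattice_subgroup H'" "H \<subseteq> H'" "J \<subseteq> H'" "character_on H' t'" "\<forall>u\<in>H. t' u = t u"
    by blast
  obtain H'' t'' where H'': "lattice_subgroup H''" "H' \<subseteq> H''" "g \<in> H''" "character_on H'' t''" "\<forall>u\<in>H'. t'' u = t' u"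
    using character_extension_step[OF H'(1,4)] by blast
  have "\<forall>u\<in>H. t'' u = t u" using H'(2,5) H''(5) by (metis subsetD)
  then show ?case using H' H'' by (intro exI[of _ H''] exI[of _ t'']) auto
qed

lemma character_sum:
  assumes "character_on UNIV t"
  shows "t (\<Sum>j\<in>J. k j *s g j) = (\<Prod>j\<in>J. t (g j) powi k j)"
proof -
  have sub: "lattice_subgroup (UNIV :: (int ^ 'n) set)" by (simp add: lattice_subgroup_def)
  show ?thesis
  proof (induction J rule: infinite_finite_induct)
    case (insert j J)
    then show ?case using assms character_scale[OF sub assms] by (simp add: character_on_def)
  qed (simp_all add: character_0[OF sub assms])
qed

context bilateral_fan
begin

text \<open>A point of the orbit of \<open>\<tau>\<close> is a character of the lattice orthogonal to \<open>\<tau>\<close>. Extended to the whole lattice as \<open>t\<close>,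
  it comes from the point with coordinates \<open>t (q s)\<close> for \<open>s \<le> n\<close> and \<open>1\<close> for \<open>s > n\<close>, except for zeros at the rays of
  \<open>\<tau>\<close>.\<close>

lemma quot_surj:
  fixes z :: "('n, 'k::alg_closed_field) toric_point"
  assumes "z \<in> toric_variety \<Sigma>"
  shows "\<exists>y\<in>cox. quot y = z"
proof -
  obtain \<tau> x where \<tau>: "\<tau> \<in> \<Sigma>" and z: "z = (\<tau>, x)" and
    x: "x 0 = 1" "\<And>u u'. u \<in> dual_semigroup \<tau> \<Longrightarrow> u' \<in> dual_semigroup \<tau> \<Longrightarrow> x (u + u') = x u * x u'"
      "\<And>u. x u \<noteq> 0 \<longleftrightarrow> u \<in> perp \<tau>"
    using assms unfolding toric_variety_orbits orbit_def by auto
  have "lattice_subgroup (perp \<tau>)"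
    by (auto simp: lattice_subgroup_def perp_def real_vec_0 real_vec_minus real_vec_add inner_add_left)
  moreover have "character_on (perp \<tau>) x" unfolding character_on_def using x perp_subset_dual by blast
  ultimately obtain H t where H: "lattice_subgroup H" "q ` {1..n} \<subseteq> H" "character_on H t"
    and tx: "\<forall>u\<in>perp \<tau>. t u = x u"
    using character_extension[of "perp \<tau>" x "q ` {1..n}"] by blast
  have "u \<in> H" for u
  proof -
    have "(\<Sum>j\<in>J. pairing u (p j) *s q j) \<in> H" if J: "finite J" "J \<subseteq> {1..n}" for J
      using J
    proof (induction J rule: finite_induct)
      case empty then show ?case using H(1) by (simp add: lattice_subgroup_def)
    next
      case (insert j J)
      have "q j \<in> H" using H(2) insert.prems by auto
      then have "pairing u (p j) *s q j \<in> H" using character_scale[OF H(1,3)] by blast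
      then show ?case using insert H(1) by (simp add: lattice_subgroup_def)
    qed
    from this[of "{1..n}"] show ?thesis using lattice_expand[of u] by simp
  qed
  then have t: "character_on UNIV t" using H(3) by (metis UNIV_eq_I)
  define y where "y s = (if s \<in> {1..m} - rays \<tau> then if s \<le> n then t (q s) else 1 else 0)" for s
  have tq: "t u \<noteq> 0" for u using t by (simp add: character_on_def)
  have zy: "zeros y = rays \<tau>" using tq rays_subset[of \<tau>] by (auto simp: zeros_def y_def)
  have y: "y \<in> cox" unfolding cox_iff using zy \<tau> by (auto simp: y_def)
  have cone: "cone_of y = \<tau>"
    using cone_of_subset_iff[OF y \<tau>] zeros_subset[of y] zy subcone_iff[OF \<tau> cone_of_in[OF y]] by auto
  have "char_monomial u y = x u" if u: "u \<in> perp \<tau>" for u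
  proof -
    have u0: "pairing u (p s) = 0" if "s \<in> rays \<tau>" for s using u perp_iff[OF \<tau>] that by blast
    have "char_monomial u y = (\<Prod>s\<in>{1..m}. (if s \<in> {1..n} then t (q s) powi pairing u (p s) else 1))"
      unfolding char_monomial_def by (rule prod.cong) (auto simp: y_def u0)
    also have "\<dots> = (\<Prod>s\<in>{1..n}. t (q s) powi pairing u (p s))"
      using n_le_m by (intro prod.mono_neutral_cong_right) auto
    also have "\<dots> = t u" using character_sum[OF t, of "\<lambda>s. pairing u (p s)" q "{1..n}"] lattice_expand[of u] by simp
    finally show ?thesis using tx u by simp
  qed
  moreover have "char_monomial u y = x u" if "u \<in> dual_semigroup \<tau>" "u \<notin> perp \<tau>" for u
    using char_monomial_nonzero_iff[OF y, of u] x(3)[of u] that cone by auto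
  moreover have "x u = 0" if "u \<notin> dual_semigroup \<tau>" for u
    using x(3)[of u] perp_subset_dual that by blast
  ultimately have "(\<lambda>u. if u \<in> dual_semigroup \<tau> then char_monomial u y else 0) = x" by (intro ext) metis
  then have "quot y = z" unfolding quot_eq cone z by simp
  then show ?thesis using y by blast
qed

section \<open>Root automorphisms\<close>

definition root_index :: "int ^ 'n \<Rightarrow> nat" where
  "root_index e = (THE i. i \<in> {1..m} \<and> e \<in> roots_at m p i)"

definition root_map :: "int ^ 'n \<Rightarrow> 'k::field_char_0 \<Rightarrow> ('n, 'k) toric_map" where
  "root_map e \<alpha> = (\<lambda>z\<in>toric_variety \<Sigma>.
     quot (root_action m p (root_index e) e \<alpha> (SOME y. y \<in> cox \<and> quot y = z)))"

text \<open>The map of the Cox space need not be bijective there; by surjectivity of the quotient it still determines the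
  automorphism.\<close>

definition lifts :: "('n, 'k::field) toric_map \<Rightarrow> ((nat \<Rightarrow> 'k) \<Rightarrow> nat \<Rightarrow> 'k) \<Rightarrow> bool" where
  "lifts \<phi> \<rho> \<longleftrightarrow> \<phi> \<in> carrier (Aut \<Sigma>) \<and> (\<forall>y\<in>cox. \<rho> y \<in> cox \<and> \<phi> (quot y) = quot (\<rho> y))"

lemma root_index_eq: "i \<in> {1..m} \<Longrightarrow> e \<in> roots_at m p i \<Longrightarrow> root_index e = i"
  unfolding root_index_def by (rule the_equality) (use roots_at_index_unique in auto)

lemma root_indexD: "e \<in> roots m p \<Longrightarrow> root_index e \<in> {1..m} \<and> e \<in> roots_at m p (root_index e)"
  using root_index_eq unfolding roots_def by auto

lemma root_map_quot:
  assumes e: "e \<in> roots m p" and y: "y \<in> cox"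
  shows "root_map e \<alpha> (quot y) = quot (root_action m p (root_index e) e \<alpha> y)"
proof -
  let ?y = "SOME y'. y' \<in> cox \<and> quot y' = quot y"
  have "?y \<in> cox \<and> quot ?y = quot y" by (rule someI[of _ y]) (use y in simp)
  then have "quot (root_action m p (root_index e) e \<alpha> ?y) = quot (root_action m p (root_index e) e \<alpha> y)"
    using quot_root_action_cong root_indexD[OF e] y by blast
  then show ?thesis using quot_in_variety[OF y] by (simp add: root_map_def)
qed

lemma root_map_locally_monomial:
  fixes \<alpha> :: "'k::{alg_closed_field, field_char_0}"
  assumes e: "e \<in> roots m p"
  shows "locally_monomial \<Sigma> (root_map e \<alpha>)"
  unfolding locally_monomial_def
proof (intro ballI impI)
  fix z :: "('n, 'k) toric_point" and \<sigma>'
  assume z: "z \<in> toric_variety \<Sigma>" and \<sigma>': "\<sigma>' \<in> \<Sigma>" "root_map e \<alpha> z \<in> chart_points \<Sigma> \<sigma>'"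
  let ?i = "root_index e"
  let ?R = "root_action m p ?i e \<alpha>"
  have i: "?i \<in> {1..m}" "e \<in> roots_at m p ?i" using root_indexD[OF e] by auto
  obtain y where y: "y \<in> cox" "z = quot y" using quot_surj[OF z] by blast
  have Ry: "?R y \<in> cox" by (rule root_action_cox[OF i y(1)])
  have "zeros (?R y) \<subseteq> rays \<sigma>'"
    using \<sigma>' quot_in_chart_iff[OF Ry \<sigma>'(1)] root_map_quot[OF e y(1)] y(2) by simp
  then have zRy: "zeros (?R y) \<subseteq> rays \<sigma>'" .
  from root_action_locally_monomial[OF i y(1) \<sigma>'(1) zRy]
  obtain \<sigma> h where \<sigma>: "\<sigma> \<in> \<Sigma>" "chart_regular \<Sigma> \<sigma> h" "zeros y \<subseteq> rays \<sigma>" "h (quot y) \<noteq> 0"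
     and maps: "\<forall>y'\<in>cox. zeros y' \<subseteq> rays \<sigma> \<and> h (quot y') \<noteq> 0 \<longrightarrow> zeros (?R y') \<subseteq> rays \<sigma>'"
     and chars: "\<forall>u\<in>dual_semigroup \<sigma>'. \<exists>k g. chart_regular \<Sigma> \<sigma> g \<and>
        (\<forall>y'\<in>cox. zeros y' \<subseteq> rays \<sigma> \<and> h (quot y') \<noteq> 0 \<longrightarrow> char_monomial u (?R y') * h (quot y') ^ k = g (quot y'))"
    by (elim bexE exE conjE) (rule that; assumption)
  have pre: "\<exists>y'\<in>cox. w = quot y' \<and> zeros y' \<subseteq> rays \<sigma>" if w: "w \<in> chart_points \<Sigma> \<sigma>" for w :: "('n, 'k) toric_point"
  proof -
    obtain y' where y': "y' \<in> cox" "quot y' = w" using quot_surj chart_in_variety[OF \<sigma>(1)] w by blast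
    then show ?thesis using quot_in_chart_iff[OF y'(1) \<sigma>(1)] w by auto
  qed
  have 1: "root_map e \<alpha> w \<in> chart_points \<Sigma> \<sigma>'" if w: "w \<in> chart_points \<Sigma> \<sigma>" "h w \<noteq> 0" for w
  proof -
    obtain y' where y': "y' \<in> cox" "w = quot y'" "zeros y' \<subseteq> rays \<sigma>" using pre[OF w(1)] by blast
    then have "zeros (?R y') \<subseteq> rays \<sigma>'" using maps w by blast
    then show ?thesis
      using quot_in_chart_iff[OF root_action_cox[OF i y'(1)] \<sigma>'(1)] root_map_quot[OF e y'(1)] y'(2) by simp
  qed
  have 2: "\<exists>k g. chart_regular \<Sigma> \<sigma> g \<and>
      (\<forall>w\<in>chart_points \<Sigma> \<sigma>. h w \<noteq> 0 \<longrightarrow> snd (root_map e \<alpha> w) u * h w ^ k = g w)"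
    if u: "u \<in> dual_semigroup \<sigma>'" for u
  proof -
    obtain k g where g: "chart_regular \<Sigma> \<sigma> g"
      "\<forall>y'\<in>cox. zeros y' \<subseteq> rays \<sigma> \<and> h (quot y') \<noteq> 0 \<longrightarrow> char_monomial u (?R y') * h (quot y') ^ k = g (quot y')"
      using bspec[OF chars u] by blast
    have "snd (root_map e \<alpha> w) u * h w ^ k = g w" if w: "w \<in> chart_points \<Sigma> \<sigma>" "h w \<noteq> 0" for w
    proof -
      obtain y' where y': "y' \<in> cox" "w = quot y'" "zeros y' \<subseteq> rays \<sigma>" using pre[OF w(1)] by blast
      then have "zeros (?R y') \<subseteq> rays \<sigma>'" using maps w by blast
      then have "snd (root_map e \<alpha> w) u = char_monomial u (?R y')"
        using quot_char[OF root_action_cox[OF i y'(1)] \<sigma>'(1) _ u] root_map_quot[OF e y'(1)] y'(2) by simp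
      then show ?thesis using bspec[OF g(2) y'(1)] y' w by simp
    qed
    then show ?thesis using g(1) by blast
  qed
  have "z \<in> chart_points \<Sigma> \<sigma>" "h z \<noteq> 0" using quot_in_chart_iff[OF y(1) \<sigma>(1)] \<sigma> y(2) by auto
  then show "\<exists>\<sigma>\<in>\<Sigma>. \<exists>h. chart_regular \<Sigma> \<sigma> h \<and> z \<in> chart_points \<Sigma> \<sigma> \<and> h z \<noteq> 0 \<and>
      (\<forall>y\<in>chart_points \<Sigma> \<sigma>. h y \<noteq> 0 \<longrightarrow> root_map e \<alpha> y \<in> chart_points \<Sigma> \<sigma>') \<and>
      (\<forall>u\<in>dual_semigroup \<sigma>'. \<exists>k g. chart_regular \<Sigma> \<sigma> g \<and>
         (\<forall>y\<in>chart_points \<Sigma> \<sigma>. h y \<noteq> 0 \<longrightarrow> snd (root_map e \<alpha> y) u * h y ^ k = g y))"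
    using 1 2 by (intro bexI[OF _ \<sigma>(1)] exI[of _ h] conjI \<sigma>(2) ballI impI) auto
qed

text \<open>The parameter \<open>- \<alpha>\<close> gives the inverse.\<close>

lemma root_map_lifts:
  fixes \<alpha> :: "'k::{alg_closed_field, field_char_0}"
  assumes e: "e \<in> roots m p"
  shows "lifts (root_map e \<alpha>) (root_action m p (root_index e) e \<alpha>)"
proof -
  let ?i = "root_index e"
  have i: "?i \<in> {1..m}" "e \<in> roots_at m p ?i" using root_indexD[OF e] by auto
  have maps: "root_map e \<alpha> z \<in> toric_variety \<Sigma>" if z: "z \<in> toric_variety \<Sigma>" for z and \<alpha> :: 'k
    using quot_surj[OF z] root_map_quot[OF e] quot_in_variety root_action_cox[OF i] by metis
  have inv: "root_map e \<alpha> (root_map e \<beta> z) = z" if z: "z \<in> toric_variety \<Sigma>" "\<alpha> + \<beta> = 0" for z and \<alpha> \<beta> :: 'k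
  proof -
    obtain y where y: "y \<in> cox" "quot y = z" using quot_surj[OF z(1)] by blast
    have "root_map e \<alpha> (root_map e \<beta> z) = quot (root_action m p ?i e \<alpha> (root_action m p ?i e \<beta> y))"
      using root_map_quot[OF e] root_action_cox[OF i y(1)] y by metis
    then show ?thesis using y z by (simp add: root_action_add root_action_0)
  qed
  have mor: "morphism (toric_atlas \<Sigma>) (toric_atlas \<Sigma>) (root_map e \<alpha>)" for \<alpha> :: 'k
    by (rule morphism_if_locally_monomial[OF maps root_map_locally_monomial[OF e]])
  have "root_map e \<alpha> \<in> carrier (Aut \<Sigma>)"
  proof (rule AutI[of _ _ "root_map e (- \<alpha>)"])
    show "root_map e \<alpha> \<in> extensional (toric_variety \<Sigma>)" by (simp add: root_map_def)
  qed (use maps inv mor in simp_all)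
  then show ?thesis using root_map_quot[OF e] root_action_cox[OF i] by (auto simp: lifts_def)
qed

lemma lifts_unique:
  fixes \<phi> :: "('n, 'k::{alg_closed_field, field_char_0}) toric_map"
  assumes "lifts \<phi> \<rho>" "lifts \<psi> \<rho>'" "\<And>y. y \<in> cox \<Longrightarrow> \<rho> y = \<rho>' y"
  shows "\<phi> = \<psi>"
proof (rule Aut_ext)
  show "\<phi> z = \<psi> z" if z: "z \<in> toric_variety \<Sigma>" for z
    using quot_surj[OF z] assms unfolding lifts_def by metis
qed (use assms in \<open>auto simp: lifts_def\<close>)

lemma lifts_mult:
  fixes \<phi> :: "('n, 'k::{alg_closed_field, field_char_0}) toric_map"
  assumes "lifts \<phi> \<rho>" "lifts \<psi> \<rho>'"
  shows "lifts (\<phi> \<otimes>\<^bsub>Aut \<Sigma>\<^esub> \<psi>) (\<lambda>y. \<rho> (\<rho>' y))"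
proof -
  interpret group "Aut \<Sigma> :: ('n, 'k) toric_map monoid" by (rule Aut_group)
  show ?thesis using assms unfolding lifts_def by (auto simp: Aut_mult_apply quot_in_variety)
qed

lemma lifts_one: "lifts (\<one>\<^bsub>Aut \<Sigma>\<^esub> :: ('n, 'k::{alg_closed_field, field_char_0}) toric_map) (\<lambda>y. y)"
proof -
  interpret group "Aut \<Sigma> :: ('n, 'k) toric_map monoid" by (rule Aut_group)
  show ?thesis unfolding lifts_def by (auto simp: Aut_one_apply quot_in_variety)
qed

lemma root_subgroup_eq:
  assumes e: "e \<in> roots m p"
  shows "root_subgroup \<Sigma> m p e = range (root_map e :: 'k::{alg_closed_field, field_char_0} \<Rightarrow> ('n, 'k) toric_map)"
proof
  have i: "root_index e \<in> {1..m}" "e \<in> roots_at m p (root_index e)" using root_indexD[OF e] by auto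
  show "root_subgroup \<Sigma> m p e \<subseteq> range (root_map e :: 'k \<Rightarrow> ('n, 'k) toric_map)"
  proof
    fix \<phi> :: "('n, 'k) toric_map" assume "\<phi> \<in> root_subgroup \<Sigma> m p e"
    then obtain j \<alpha> where j: "\<phi> \<in> carrier (Aut \<Sigma>)" "j \<in> {1..m}" "e \<in> roots_at m p j"
      "\<forall>y\<in>cox. \<phi> (quot y) = quot (root_action m p j e \<alpha> y)" unfolding root_subgroup_def by blast
    then have "lifts \<phi> (root_action m p (root_index e) e \<alpha>)"
      unfolding lifts_def using root_index_eq[of j e] by (auto intro: root_action_cox[OF i])
    then have "\<phi> = root_map e \<alpha>" using lifts_unique[OF _ root_map_lifts[OF e]] by blast
    then show "\<phi> \<in> range (root_map e)" by simp
  qed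
  show "range (root_map e :: 'k \<Rightarrow> ('n, 'k) toric_map) \<subseteq> root_subgroup \<Sigma> m p e"
    using root_map_lifts[OF e] i unfolding lifts_def root_subgroup_def by blast
qed

section \<open>The torus\<close>

definition torus_map :: "(int ^ 'n \<Rightarrow> 'k::field) \<Rightarrow> ('n, 'k) toric_map" where
  "torus_map t = (\<lambda>(\<tau>, x)\<in>toric_variety \<Sigma>. (\<tau>, \<lambda>u. t u * x u))"

text \<open>The torus acts on the Cox space through the basis \<open>q 1, \<dots>, q n\<close> of its character lattice.\<close>

definition torus_lift :: "(int ^ 'n \<Rightarrow> 'k::field) \<Rightarrow> (nat \<Rightarrow> 'k) \<Rightarrow> nat \<Rightarrow> 'k" where
  "torus_lift t y = (\<lambda>s. if s \<in> {1..n} then t (q s) * y s else y s)"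

lemma torus_eq: "torus \<Sigma> = {torus_map t | t. character_on UNIV t}"
  by (auto simp: torus_def torus_map_def character_on_def)

lemma torus_map_orbit:
  assumes t: "character_on UNIV t" and z: "(\<tau>, x) \<in> orbit \<tau>"
  shows "(\<tau>, \<lambda>u. t u * x u) \<in> orbit \<tau>"
proof -
  have "t 0 = 1" by (rule character_0[OF _ t]) (simp add: lattice_subgroup_def)
  then show ?thesis using z t unfolding orbit_def character_on_def by auto
qed

lemma torus_map_apply: "(\<tau>, x) \<in> toric_variety \<Sigma> \<Longrightarrow> torus_map t (\<tau>, x) = (\<tau>, \<lambda>u. t u * x u)"
  by (simp add: torus_map_def)

lemma orbit_fst: "z \<in> orbit \<tau> \<Longrightarrow> z = (\<tau>, snd z)"
  by (auto simp: orbit_def)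

lemma torus_map_chart:
  assumes t: "character_on UNIV t" and \<sigma>: "\<sigma> \<in> \<Sigma>" and z: "z \<in> chart_points \<Sigma> \<sigma>"
  shows "torus_map t z \<in> chart_points \<Sigma> \<sigma>" "snd (torus_map t z) u = t u * snd z u"
proof -
  obtain \<tau> where \<tau>: "\<tau> \<in> \<Sigma>" "\<tau> \<subseteq> \<sigma>" "z \<in> orbit \<tau>" using z by (auto simp: chart_points_def)
  then have z': "z = (\<tau>, snd z)" "(\<tau>, snd z) \<in> toric_variety \<Sigma>"
    using orbit_fst[OF \<tau>(3)] chart_in_variety[OF \<sigma>] z by auto
  then have "torus_map t z = (\<tau>, \<lambda>u. t u * snd z u)" using torus_map_apply by metis
  then show "torus_map t z \<in> chart_points \<Sigma> \<sigma>" "snd (torus_map t z) u = t u * snd z u"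
    using torus_map_orbit[OF t, of \<tau> "snd z"] z' \<tau> unfolding chart_points_def by auto
qed

lemma torus_map_Aut:
  fixes t :: "int ^ 'n \<Rightarrow> 'k::field"
  assumes t: "character_on UNIV t"
  shows "torus_map t \<in> carrier (Aut \<Sigma>)"
proof -
  have t': "character_on UNIV (\<lambda>u. inverse (t u))" using t by (simp add: character_on_def)
  have nz: "\<And>u. t u \<noteq> 0" using t by (simp add: character_on_def)
  have maps: "torus_map t z \<in> toric_variety \<Sigma>" if "z \<in> toric_variety \<Sigma>" "character_on UNIV t"
    for z and t :: "int ^ 'n \<Rightarrow> 'k"
    using that torus_map_chart(1) unfolding toric_variety_eq by blast
  have mor: "morphism (toric_atlas \<Sigma>) (toric_atlas \<Sigma>) (torus_map t)" if t: "character_on UNIV t"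
    for t :: "int ^ 'n \<Rightarrow> 'k"
  proof (rule morphism_if_locally_monomial[OF maps[OF _ t]])
    show "locally_monomial \<Sigma> (torus_map t)" unfolding locally_monomial_def
    proof (intro ballI impI)
      fix z :: "('n, 'k) toric_point" and \<sigma>'
      assume z: "z \<in> toric_variety \<Sigma>" and \<sigma>': "\<sigma>' \<in> \<Sigma>" "torus_map t z \<in> chart_points \<Sigma> \<sigma>'"
      obtain \<tau> where \<tau>: "\<tau> \<in> \<Sigma>" "z \<in> orbit \<tau>" using z unfolding toric_variety_orbits by blast
      have "torus_map t z = (\<tau>, \<lambda>u. t u * snd z u)" using orbit_fst[OF \<tau>(2)] z torus_map_apply by metis
      then have "\<tau> \<subseteq> \<sigma>'" using \<sigma>'(2) by (auto simp: chart_points_def orbit_def)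
      then have zc: "z \<in> chart_points \<Sigma> \<sigma>'" using \<tau> unfolding chart_points_def by blast
      have "\<exists>k g. chart_regular \<Sigma> \<sigma>' g \<and>
          (\<forall>y\<in>chart_points \<Sigma> \<sigma>'. (1 :: 'k) \<noteq> 0 \<longrightarrow> snd (torus_map t y) u * 1 ^ k = g y)"
        if u: "u \<in> dual_semigroup \<sigma>'" for u
        using torus_map_chart(2)[OF t \<sigma>'(1)] u
        by (intro exI[of _ 0] exI[of _ "\<lambda>z. t u * snd z u"]) (auto intro: chart_regular_scaled_char)
      then show "\<exists>\<sigma>\<in>\<Sigma>. \<exists>h. chart_regular \<Sigma> \<sigma> h \<and> z \<in> chart_points \<Sigma> \<sigma> \<and> h z \<noteq> 0 \<and>
        (\<forall>y\<in>chart_points \<Sigma> \<sigma>. h y \<noteq> 0 \<longrightarrow> torus_map t y \<in> chart_points \<Sigma> \<sigma>') \<and>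
        (\<forall>u\<in>dual_semigroup \<sigma>'. \<exists>k g. chart_regular \<Sigma> \<sigma> g \<and>
         (\<forall>y\<in>chart_points \<Sigma> \<sigma>. h y \<noteq> 0 \<longrightarrow> snd (torus_map t y) u * h y ^ k = g y))"
        using zc torus_map_chart(1)[OF t \<sigma>'(1)] chart_regular_const[of \<Sigma> \<sigma>' 1]
        by (intro bexI[OF _ \<sigma>'(1)] exI[of _ "\<lambda>_. 1"]) auto
    qed
  qed
  have inv: "torus_map t1 (torus_map t2 z) = z"
    if z: "z \<in> toric_variety \<Sigma>" and t: "character_on UNIV t2" "\<And>u. t1 u * t2 u = 1"
    for z and t1 t2 :: "int ^ 'n \<Rightarrow> 'k"
  proof -
    obtain \<tau> where \<tau>: "\<tau> \<in> \<Sigma>" "z \<in> orbit \<tau>" using z unfolding toric_variety_orbits by blast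
    have z2: "torus_map t2 z = (\<tau>, \<lambda>u. t2 u * snd z u)" using orbit_fst[OF \<tau>(2)] z torus_map_apply by metis
    then have "torus_map t1 (torus_map t2 z) = (\<tau>, \<lambda>u. t1 u * (t2 u * snd z u))"
      using maps[OF z t(1)] torus_map_apply by metis
    then show ?thesis using orbit_fst[OF \<tau>(2)] t(2) by (simp flip: mult.assoc)
  qed
  show ?thesis
  proof (rule AutI[of _ _ "torus_map (\<lambda>u. inverse (t u))"])
    show "torus_map t \<in> extensional (toric_variety \<Sigma>)" by (simp add: torus_map_def)
    show "torus_map t (torus_map (\<lambda>u. inverse (t u)) z) = z" if "z \<in> toric_variety \<Sigma>" for z
      using inv[OF that t'] nz by simp
    show "torus_map (\<lambda>u. inverse (t u)) (torus_map t z) = z" if "z \<in> toric_variety \<Sigma>" for z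
      using inv[OF that t] nz by simp
  qed (use maps mor t t' in blast)+
qed

lemma torus_map_lifts:
  fixes t :: "int ^ 'n \<Rightarrow> 'k::field"
  assumes t: "character_on UNIV t"
  shows "lifts (torus_map t) (torus_lift t)"
  unfolding lifts_def
proof (intro conjI ballI)
  show "torus_map t \<in> carrier (Aut \<Sigma>)" by (rule torus_map_Aut[OF t])
  fix y :: "nat \<Rightarrow> 'k" assume y: "y \<in> cox"
  have tq: "\<And>u. t u \<noteq> 0" using t by (simp add: character_on_def)
  have z: "zeros (torus_lift t y) = zeros y" using tq by (auto simp: zeros_def torus_lift_def)
  show ly: "torus_lift t y \<in> cox" using y n_le_m unfolding cox_iff z by (auto simp: torus_lift_def)
  have cone: "cone_of (torus_lift t y) = cone_of y" by (simp add: cone_of_def z)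
  have "char_monomial u (torus_lift t y) = t u * char_monomial u y" for u
  proof -
    have "char_monomial u (torus_lift t y) =
        (\<Prod>s\<in>{1..m}. (if s \<in> {1..n} then t (q s) powi pairing u (p s) else 1) * y s powi pairing u (p s))"
      unfolding char_monomial_def by (rule prod.cong) (auto simp: torus_lift_def power_int_mult_distrib)
    also have "\<dots> = (\<Prod>s\<in>{1..m}. (if s \<in> {1..n} then t (q s) powi pairing u (p s) else 1)) * char_monomial u y"
      by (simp add: prod.distrib char_monomial_def)
    also have "(\<Prod>s\<in>{1..m}. (if s \<in> {1..n} then t (q s) powi pairing u (p s) else 1)) =
        (\<Prod>s\<in>{1..n}. t (q s) powi pairing u (p s))"
      using n_le_m by (intro prod.mono_neutral_cong_right) auto
    also have "\<dots> = t u" using character_sum[OF t, of "\<lambda>s. pairing u (p s)" q "{1..n}"] lattice_expand[of u] by simp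
    finally show ?thesis .
  qed
  then show "torus_map t (quot y) = quot (torus_lift t y)"
    using torus_map_apply[of "cone_of y" _ t] quot_in_variety[OF y] unfolding quot_eq cone by auto
qed

end

context bilateral_fan
begin

section \<open>Commutator relations\<close>

lemma triangular_root_is_root: "e \<in> triangular_roots \<Longrightarrow> e \<in> roots m p" using triangular_roots_subset by blast

lemma triangular_root_index_props:
  assumes "e \<in> triangular_roots"
  shows "root_index e \<in> {1..n}" "root_index e \<in> {1..m}" "e \<in> roots_at m p (root_index e)"
    "\<And>j. j \<in> {1..<root_index e} \<Longrightarrow> pairing e (p j) = 0"
proof -
  obtain i where i: "i \<in> {1..n}" "e \<in> roots_at m p i" "\<And>j. j \<in> {1..<i} \<Longrightarrow> pairing e (p j) = 0"
    using triangular_root_index[OF assms] by blast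
  have "root_index e = i" using root_index_eq[of i e] i n_le_m by auto
  then show "root_index e \<in> {1..n}" "root_index e \<in> {1..m}" "e \<in> roots_at m p (root_index e)"
    "\<And>j. j \<in> {1..<root_index e} \<Longrightarrow> pairing e (p j) = 0" using i n_le_m by auto
qed

lemma root_map_add:
  fixes s t :: "'k::{alg_closed_field, field_char_0}"
  assumes "e \<in> roots m p"
  shows "root_map e (s + t) = root_map e s \<otimes>\<^bsub>Aut \<Sigma>\<^esub> root_map e t"
  by (rule lifts_unique[OF root_map_lifts[OF assms] lifts_mult[OF root_map_lifts[OF assms] root_map_lifts[OF assms]]])
    (simp add: root_action_add)

lemma root_map_closed:
  "e \<in> roots m p \<Longrightarrow> (root_map e s :: ('n, 'k::{alg_closed_field, field_char_0}) toric_map) \<in> carrier (Aut \<Sigma>)"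
  using root_map_lifts[of e s] by (simp add: lifts_def)

lemma root_map_inverse:
  fixes s :: "'k::{alg_closed_field, field_char_0}"
  assumes "g \<in> roots m p"
  shows "inv\<^bsub>Aut \<Sigma>\<^esub> (root_map g s) = root_map g (- s)"
proof -
  interpret group "Aut \<Sigma> :: ('n, 'k) toric_map monoid" by (rule Aut_group)
  have "root_map g (- s) \<otimes>\<^bsub>Aut \<Sigma>\<^esub> root_map g s = \<one>\<^bsub>Aut \<Sigma>\<^esub>"
    by (rule lifts_unique[OF lifts_mult[OF root_map_lifts[OF assms] root_map_lifts[OF assms]] lifts_one])
      (simp add: root_action_add root_action_0)
  then show ?thesis using root_map_closed[OF assms] by (intro inv_equality) auto
qed

context
  fixes e f :: "int ^ 'n" and i j :: nat
  assumes i: "i \<in> {1..m}" "e \<in> roots_at m p i" and j: "j \<in> {1..m}" "f \<in> roots_at m p j"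
    and ij: "i \<noteq> j" and f_i: "pairing f (p i) = 0"
begin

lemma pairing_e_j: "0 \<le> pairing e (p j)"
  using i(2) j(1) ij by (auto simp: roots_at_def)

lemma root_string:
  assumes "int r \<le> pairing e (p j)"
  shows "e + int r *s f \<in> roots_at m p i"
proof -
  have "0 \<le> pairing (e + int r *s f) (p s)" if s: "s \<in> {1..m}" "s \<noteq> i" for s
  proof (cases "s = j")
    case True
    then show ?thesis using assms j(2) by (simp add: roots_at_def pairing_add_left pairing_scale_left)
  next
    case False
    then show ?thesis using i(2) j(2) s by (auto simp: roots_at_def pairing_add_left pairing_scale_left)
  qed
  then show ?thesis using i(2) f_i by (auto simp: roots_at_def pairing_add_left pairing_scale_left)
qed

text \<open>The monomial of \<open>e\<close> contains the \<open>N\<close>-th power of \<open>y j\<close>; adding to \<open>y j\<close> a multiple of the monomial of \<open>f\<close> and expanding gives the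
  monomials of the roots \<open>e + r f\<close>.\<close>

lemma root_monomial_root_action:
  assumes N: "pairing e (p j) = int N"
  shows "root_monomial i e (y(j := y j + c * root_monomial j f y)) =
    (\<Sum>r\<le>N. of_nat (N choose r) * c ^ r * root_monomial i (e + int r *s f) (y :: nat \<Rightarrow> 'k::field))"
proof -
  let ?S = "{1..m} - {i} - {j}"
  define A where "A = (\<Prod>s\<in>?S. y s ^ nat (pairing e (p s)))"
  have nonneg: "0 \<le> pairing e (p s)" "0 \<le> pairing f (p s)" if "s \<in> ?S" for s
    using i(2) j(2) that by (auto simp: roots_at_def)
  have jS: "j \<in> {1..m} - {i}" "i \<in> {1..m} - {j}" using i j ij by auto
  have m_f: "root_monomial j f y = (\<Prod>s\<in>?S. y s ^ nat (pairing f (p s)))"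
  proof -
    have "{1..m} - {j} - {i} = ?S" by auto
    then show ?thesis unfolding root_monomial_def by (subst prod.remove[OF _ jS(2)]) (simp_all add: f_i)
  qed
  have m_string: "root_monomial i (e + int r *s f) y = y j ^ (N - r) * A * root_monomial j f y ^ r"
    if r: "r \<le> N" for r
  proof -
    have "pairing (e + int r *s f) (p j) = int (N - r)"
      using N j(2) r by (simp add: roots_at_def pairing_add_left pairing_scale_left)
    then have "root_monomial i (e + int r *s f) y =
        y j ^ (N - r) * (\<Prod>s\<in>?S. y s ^ nat (pairing (e + int r *s f) (p s)))"
      unfolding root_monomial_def by (subst prod.remove[OF _ jS(1)]) simp_all
    also have "(\<Prod>s\<in>?S. y s ^ nat (pairing (e + int r *s f) (p s))) =
        (\<Prod>s\<in>?S. y s ^ nat (pairing e (p s)) * (y s ^ nat (pairing f (p s))) ^ r)"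
    proof (rule prod.cong[OF refl])
      fix s assume s: "s \<in> ?S"
      have "nat (pairing (e + int r *s f) (p s)) = nat (pairing e (p s)) + nat (pairing f (p s)) * r"
        using nonneg[OF s] by (simp add: pairing_add_left pairing_scale_left nat_add_distrib nat_mult_distrib)
      then show "y s ^ nat (pairing (e + int r *s f) (p s)) = y s ^ nat (pairing e (p s)) * (y s ^ nat (pairing f (p s))) ^ r"
        by (simp add: power_add power_mult)
    qed
    also have "\<dots> = A * root_monomial j f y ^ r"
      unfolding m_f A_def by (simp add: prod.distrib prod_power_distrib)
    finally show ?thesis by (simp add: mult.assoc)
  qed
  let ?y = "y(j := y j + c * root_monomial j f y)"
  have "root_monomial i e ?y = (y j + c * root_monomial j f y) ^ N * (\<Prod>s\<in>?S. ?y s ^ nat (pairing e (p s)))"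
    unfolding root_monomial_def by (subst prod.remove[OF _ jS(1)]) (simp_all add: N)
  also have "(\<Prod>s\<in>?S. ?y s ^ nat (pairing e (p s))) = A"
    unfolding A_def by (rule prod.cong) auto
  also have "(y j + c * root_monomial j f y) ^ N * A =
      (\<Sum>r\<le>N. of_nat (N choose r) * (c * root_monomial j f y) ^ r * y j ^ (N - r) * A)"
    by (simp add: add.commute[of "y j"] binomial_ring sum_distrib_right)
  also have "\<dots> = (\<Sum>r\<le>N. of_nat (N choose r) * c ^ r * root_monomial i (e + int r *s f) y)"
    by (rule sum.cong) (auto simp: m_string power_mult_distrib)
  finally show ?thesis .
qed

lemma root_monomial_f_upd: "root_monomial j f (y(i := c)) = root_monomial j f y"
  unfolding root_monomial_def using f_i by (intro prod.cong) auto

text \<open>Root elements for roots at the same index \<open>i\<close> change only \<open>y i\<close>, by monomials without \<open>y i\<close>, so in a product the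
  contributions add up.\<close>

lemma string_element:
  fixes c :: "nat \<Rightarrow> 'k::{alg_closed_field, field_char_0}"
  assumes N: "1 \<le> N" "int N \<le> pairing e (p j)"
  shows "\<exists>z\<in>generate (Aut \<Sigma>) {root_map (e + int r *s f) u | r u. r \<in> {2..N}}.
    lifts (root_map (e + f) (c 1) \<otimes>\<^bsub>Aut \<Sigma>\<^esub> z)
      (\<lambda>y. y(i := y i + (\<Sum>r\<in>{1..N}. c r * root_monomial i (e + int r *s f) y)))"
  using N
proof (induction N)
  case (Suc N)
  interpret group "Aut \<Sigma> :: ('n, 'k) toric_map monoid" by (rule Aut_group)
  have root: "e + int (Suc N) *s f \<in> roots_at m p i" by (rule root_string[OF Suc.prems(2)])
  then have "e + int (Suc N) *s f \<in> roots m p" using i(1) by (auto simp: roots_def)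
  from root_map_lifts[OF this]
  have lift: "lifts (root_map (e + int (Suc N) *s f) (c (Suc N)))
      (\<lambda>y. y(i := y i + c (Suc N) * root_monomial i (e + int (Suc N) *s f) y))"
    unfolding root_index_eq[OF i(1) root] root_action_upd by simp
  show ?case
  proof (cases "N = 0")
    case True
    then have "lifts (root_map (e + f) (c 1) \<otimes>\<^bsub>Aut \<Sigma>\<^esub> \<one>\<^bsub>Aut \<Sigma>\<^esub>)
      (\<lambda>y. y(i := y i + (\<Sum>r\<in>{1..Suc N}. c r * root_monomial i (e + int r *s f) y)))"
      using lift unfolding lifts_def by simp
    then show ?thesis using generate.one by blast
  next
    case False
    then have "1 \<le> N" "int N \<le> pairing e (p j)" using Suc.prems by auto
    from Suc.IH[OF this]
    obtain z where z: "z \<in> generate (Aut \<Sigma>) {root_map (e + int r *s f) u | r u. r \<in> {2..N}}"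
      "lifts (root_map (e + f) (c 1) \<otimes>\<^bsub>Aut \<Sigma>\<^esub> z)
        (\<lambda>y. y(i := y i + (\<Sum>r\<in>{1..N}. c r * root_monomial i (e + int r *s f) y)))"
      by blast
    let ?x = "root_map (e + int (Suc N) *s f) (c (Suc N))"
    have sub: "generate (Aut \<Sigma>) {root_map (e + int r *s f) u | r u. r \<in> {2..N}} \<subseteq>
        generate (Aut \<Sigma>) {root_map (e + int r *s f) (u :: 'k) | r u. r \<in> {2..Suc N}}"
      by (rule mono_generate) force
    have "Suc N \<in> {2..Suc N}" using False by auto
    then have "?x \<in> generate (Aut \<Sigma>) {root_map (e + int r *s f) u | r u. r \<in> {2..Suc N}}"
      by (intro generate.incl) blast
    then have zx: "z \<otimes>\<^bsub>Aut \<Sigma>\<^esub> ?x \<in> generate (Aut \<Sigma>) {root_map (e + int r *s f) u | r u. r \<in> {2..Suc N}}"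
      using z(1) sub by (intro generate.eng) auto
    have gens: "{root_map (e + int r *s f) (u :: 'k) | r u. r \<in> {2..N}} \<subseteq> carrier (Aut \<Sigma>)"
    proof
      fix g :: "('n, 'k) toric_map" assume "g \<in> {root_map (e + int r *s f) u | r u. r \<in> {2..N}}"
      then obtain r u where r: "g = root_map (e + int r *s f) u" "r \<in> {2..N}" by blast
      have "int r \<le> pairing e (p j)" using r(2) Suc.prems by auto
      then have "e + int r *s f \<in> roots m p" unfolding roots_def using root_string i(1) by blast
      then show "g \<in> carrier (Aut \<Sigma>)" using r(1) root_map_closed by blast
    qed
    have zc: "z \<in> carrier (Aut \<Sigma>)" using generate_in_carrier[OF gens z(1)] .
    have "e + int 1 *s f \<in> roots_at m p i" by (rule root_string) (use Suc.prems in linarith)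
    then have "e + f \<in> roots m p" using i(1) by (auto simp: roots_def)
    then have xc: "root_map (e + f) (c 1) \<in> carrier (Aut \<Sigma>)" by (rule root_map_closed)
    have x2c: "?x \<in> carrier (Aut \<Sigma>)" using lift by (simp add: lifts_def)
    have upd: "root_monomial i g (y(i := b)) = root_monomial i g y" for g and y :: "nat \<Rightarrow> 'k" and b
      by (rule root_monomial_upd)
    have "lifts (root_map (e + f) (c 1) \<otimes>\<^bsub>Aut \<Sigma>\<^esub> z \<otimes>\<^bsub>Aut \<Sigma>\<^esub> ?x)
        (\<lambda>y. y(i := y i + (\<Sum>r\<in>{1..Suc N}. c r * root_monomial i (e + int r *s f) y)))"
      using lifts_mult[OF z(2) lift] by (simp add: upd add.assoc add.commute)
    then have "lifts (root_map (e + f) (c 1) \<otimes>\<^bsub>Aut \<Sigma>\<^esub> (z \<otimes>\<^bsub>Aut \<Sigma>\<^esub> ?x))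
        (\<lambda>y. y(i := y i + (\<Sum>r\<in>{1..Suc N}. c r * root_monomial i (e + int r *s f) y)))"
      using m_assoc[OF xc zc x2c] by simp
    then show ?thesis using zx by blast
  qed
qed simp

text \<open>Conjugating the root element of \<open>e\<close> by that of \<open>f\<close> subtracts \<open>t\<close> times the monomial of \<open>f\<close> from \<open>y j\<close> in the monomial of
  \<open>e\<close>; the term without \<open>f\<close> cancels in the commutator.\<close>

lemma commutator_lifts:
  fixes s t :: "'k::{alg_closed_field, field_char_0}"
  assumes N: "pairing e (p j) = int N"
  shows "lifts (commutator (Aut \<Sigma>) (root_map e s) (root_map f t))
    (\<lambda>y. y(i := y i + (\<Sum>r\<in>{1..N}. (- s * of_nat (N choose r) * (- t) ^ r) * root_monomial i (e + int r *s f) y)))"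
proof -
  have er: "e \<in> roots m p" and fr: "f \<in> roots m p" using i j by (auto simp: roots_def)
  have ri: "root_index e = i" "root_index f = j" using root_index_eq i j by auto
  have "lifts (commutator (Aut \<Sigma>) (root_map e s) (root_map f t))
      (\<lambda>y. root_action m p i e s (root_action m p j f t (root_action m p i e (- s) (root_action m p j f (- t) y))))"
    unfolding commutator_def root_map_inverse[OF er] root_map_inverse[OF fr]
    using lifts_mult[OF lifts_mult[OF lifts_mult[OF root_map_lifts[OF er, of s] root_map_lifts[OF fr, of t]]
      root_map_lifts[OF er, of "- s"]] root_map_lifts[OF fr, of "- t"]] unfolding ri .
  moreover have "root_action m p i e s (root_action m p j f t (root_action m p i e (- s) (root_action m p j f (- t) y))) =
      y(i := y i + (\<Sum>r\<in>{1..N}. (- s * of_nat (N choose r) * (- t) ^ r) * root_monomial i (e + int r *s f) y))"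
    for y :: "nat \<Rightarrow> 'k"
  proof -
    let ?mf = "root_monomial j f y" and ?me = "root_monomial i e"
    let ?y1 = "y(j := y j + (- t) * ?mf)"
    have expand: "?me ?y1 = ?me y + (\<Sum>r\<in>{1..N}. of_nat (N choose r) * (- t) ^ r * root_monomial i (e + int r *s f) y)"
    proof -
      have "{..N} = insert 0 {1..N}" by auto
      then show ?thesis unfolding root_monomial_root_action[OF N] by simp
    qed
    have 1: "root_action m p j f (- t) y = ?y1" by (simp add: root_action_upd)
    have 2: "root_action m p i e (- s) ?y1 = ?y1(i := y i - s * ?me ?y1)"
      using ij by (simp add: root_action_upd)
    have 3: "root_action m p j f t (?y1(i := y i - s * ?me ?y1)) = y(i := y i - s * ?me ?y1)"
      using ij by (auto simp: root_action_upd root_monomial_f_upd root_monomial_upd fun_eq_iff)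
    have 4: "root_action m p i e s (y(i := y i - s * ?me ?y1)) = y(i := y i - s * ?me ?y1 + s * ?me y)"
      by (simp add: root_action_upd root_monomial_upd)
    have eq: "y i - s * ?me ?y1 + s * ?me y =
        y i + (\<Sum>r\<in>{1..N}. (- s * of_nat (N choose r) * (- t) ^ r) * root_monomial i (e + int r *s f) y)"
      unfolding expand by (simp add: algebra_simps sum_distrib_left sum_negf)
    show ?thesis unfolding 1 2 3 4 eq ..
  qed
  ultimately show ?thesis by (simp add: lifts_def)
qed

text \<open>The coefficient at \<open>e + f\<close> is \<open>N = \<langle>e, p j\<rangle>\<close>, nonzero in characteristic \<open>0\<close>. The second commutator is the
  inverse of the first one, where all contributions change sign.\<close>

lemma string_commutator:
  fixes s t :: "'k::{alg_closed_field, field_char_0}"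
  assumes N: "pairing e (p j) = int N" "1 \<le> N"
  shows "\<exists>z\<in>generate (Aut \<Sigma>) {root_map (e + int r *s f) u | r u. r \<in> {2..N}}.
      commutator (Aut \<Sigma>) (root_map e s) (root_map f t) = root_map (e + f) (of_nat N * s * t) \<otimes>\<^bsub>Aut \<Sigma>\<^esub> z"
    "\<exists>z\<in>generate (Aut \<Sigma>) {root_map (e + int r *s f) u | r u. r \<in> {2..N}}.
      commutator (Aut \<Sigma>) (root_map f t) (root_map e s) = root_map (e + f) (- of_nat N * s * t) \<otimes>\<^bsub>Aut \<Sigma>\<^esub> z"
proof -
  interpret group "Aut \<Sigma> :: ('n, 'k) toric_map monoid" by (rule Aut_group)
  let ?c = "\<lambda>r. - s * of_nat (N choose r) * (- t) ^ r :: 'k"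
  note comm = commutator_lifts[OF N(1), of s t]
  obtain z where z: "z \<in> generate (Aut \<Sigma>) {root_map (e + int r *s f) u | r u. r \<in> {2..N}}"
    "lifts (root_map (e + f) (?c 1) \<otimes>\<^bsub>Aut \<Sigma>\<^esub> z)
      (\<lambda>y. y(i := y i + (\<Sum>r\<in>{1..N}. ?c r * root_monomial i (e + int r *s f) y)))"
    using string_element[of N ?c] N by auto
  have c1: "?c 1 = of_nat N * s * t" by simp
  have "commutator (Aut \<Sigma>) (root_map e s) (root_map f t) = root_map (e + f) (?c 1) \<otimes>\<^bsub>Aut \<Sigma>\<^esub> z"
    by (rule lifts_unique[OF comm z(2)]) simp
  then have "commutator (Aut \<Sigma>) (root_map e s) (root_map f t) =
      root_map (e + f) (of_nat N * s * t) \<otimes>\<^bsub>Aut \<Sigma>\<^esub> z" unfolding c1 .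
  then show "\<exists>z\<in>generate (Aut \<Sigma>) {root_map (e + int r *s f) u | r u. r \<in> {2..N}}.
      commutator (Aut \<Sigma>) (root_map e s) (root_map f t) = root_map (e + f) (of_nat N * s * t) \<otimes>\<^bsub>Aut \<Sigma>\<^esub> z"
    using z(1) by blast
  obtain z' where z': "z' \<in> generate (Aut \<Sigma>) {root_map (e + int r *s f) u | r u. r \<in> {2..N}}"
    "lifts (root_map (e + f) (- ?c 1) \<otimes>\<^bsub>Aut \<Sigma>\<^esub> z')
      (\<lambda>y. y(i := y i + (\<Sum>r\<in>{1..N}. - ?c r * root_monomial i (e + int r *s f) y)))"
    using string_element[of N "\<lambda>r. - ?c r"] N by auto
  let ?g = "commutator (Aut \<Sigma>) (root_map e s) (root_map f t)" and ?h = "root_map (e + f) (- ?c 1) \<otimes>\<^bsub>Aut \<Sigma>\<^esub> z'"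
  have "?h \<otimes>\<^bsub>Aut \<Sigma>\<^esub> ?g = \<one>\<^bsub>Aut \<Sigma>\<^esub>"
    by (rule lifts_unique[OF lifts_mult[OF z'(2) comm] lifts_one])
      (auto simp: root_monomial_upd sum_negf fun_eq_iff)
  moreover have gc: "?g \<in> carrier (Aut \<Sigma>)" "?h \<in> carrier (Aut \<Sigma>)" using comm z'(2) by (auto simp: lifts_def)
  ultimately have "inv\<^bsub>Aut \<Sigma>\<^esub> ?g = ?h" by (intro inv_equality) auto
  moreover have "e \<in> roots m p" "f \<in> roots m p" using i j by (auto simp: roots_def)
  then have "inv\<^bsub>Aut \<Sigma>\<^esub> ?g = commutator (Aut \<Sigma>) (root_map f t) (root_map e s)"
    by (simp add: commutator_def inv_mult_group m_assoc root_map_closed)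
  ultimately have "commutator (Aut \<Sigma>) (root_map f t) (root_map e s) = ?h" by simp
  moreover have "- ?c 1 = - of_nat N * s * t" by simp
  ultimately have "commutator (Aut \<Sigma>) (root_map f t) (root_map e s) =
      root_map (e + f) (- of_nat N * s * t) \<otimes>\<^bsub>Aut \<Sigma>\<^esub> z'" by (simp only:)
  then show "\<exists>z\<in>generate (Aut \<Sigma>) {root_map (e + int r *s f) u | r u. r \<in> {2..N}}.
      commutator (Aut \<Sigma>) (root_map f t) (root_map e s) = root_map (e + f) (- of_nat N * s * t) \<otimes>\<^bsub>Aut \<Sigma>\<^esub> z"
    using z'(1) by blast
qed

lemma no_string_commute:
  fixes s t :: "'k::{alg_closed_field, field_char_0}"
  assumes "pairing e (p j) = 0"
  shows "root_map e s \<otimes>\<^bsub>Aut \<Sigma>\<^esub> root_map f t = root_map f t \<otimes>\<^bsub>Aut \<Sigma>\<^esub> root_map e s"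
proof -
  have er: "e \<in> roots m p" and fr: "f \<in> roots m p" using i j by (auto simp: roots_def)
  have ri: "root_index e = i" "root_index f = j" using root_index_eq i j by auto
  have upd: "root_monomial i e (y(j := c)) = root_monomial i e y" for y :: "nat \<Rightarrow> 'k" and c
    unfolding root_monomial_def using assms by (intro prod.cong) auto
  show ?thesis
    by (rule lifts_unique[OF lifts_mult[OF root_map_lifts[OF er] root_map_lifts[OF fr]]
      lifts_mult[OF root_map_lifts[OF fr] root_map_lifts[OF er]]])
      (use ij in \<open>auto simp: ri root_action_upd upd root_monomial_f_upd fun_eq_iff\<close>)
qed

end

lemma same_index_commute:
  fixes s t :: "'k::{alg_closed_field, field_char_0}"
  assumes "e \<in> roots m p" "f \<in> roots m p" "root_index e = root_index f"
  shows "root_map e s \<otimes>\<^bsub>Aut \<Sigma>\<^esub> root_map f t = root_map f t \<otimes>\<^bsub>Aut \<Sigma>\<^esub> root_map e s"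
  by (rule lifts_unique[OF lifts_mult[OF root_map_lifts[OF assms(1)] root_map_lifts[OF assms(2)]]
      lifts_mult[OF root_map_lifts[OF assms(2)] root_map_lifts[OF assms(1)]]])
    (simp add: assms(3) root_action_upd root_monomial_upd algebra_simps)

lemma two_negative_not_root:
  assumes "i \<in> {1..m}" "j \<in> {1..m}" "i \<noteq> j" "pairing e (p i) < 0" "pairing e (p j) < 0"
  shows "e \<notin> roots m p"
proof
  assume "e \<in> roots m p"
  then obtain k where "k \<in> {1..m}" "e \<in> roots_at m p k" by (auto simp: roots_def)
  then have "0 \<le> pairing e (p s)" if "s \<in> {1..m}" "s \<noteq> k" for s
    using that by (auto simp: roots_at_def)
  from this[of i] this[of j] show False using assms by (cases "i = k") auto
qed

text \<open>For \<open>\<langle>e, p j\<rangle> = 0\<close> the sum takes the value \<open>-1\<close> on two rays, so it is not a root.\<close>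

lemma triangular_root_sum:
  assumes e: "e \<in> triangular_roots" and f: "f \<in> triangular_roots" and less: "root_index e < root_index f"
  shows "pairing f (p (root_index e)) = 0" "0 \<le> pairing e (p (root_index f))"
    "e + f \<in> triangular_roots \<longleftrightarrow> 1 \<le> pairing e (p (root_index f))"
    "\<And>r. int r \<le> pairing e (p (root_index f)) \<Longrightarrow> e + int r *s f \<in> triangular_roots"
proof -
  let ?i = "root_index e" and ?j = "root_index f"
  note ei = triangular_root_index_props[OF e] and fj = triangular_root_index_props[OF f]
  show f_i: "pairing f (p ?i) = 0" using fj(4)[of ?i] ei(1) less by auto
  have ne: "?i \<noteq> ?j" using less by simp
  show "0 \<le> pairing e (p ?j)" by (rule pairing_e_j[OF ei(2,3) fj(2,3) ne f_i])
  show string: "e + int r *s f \<in> triangular_roots" if "int r \<le> pairing e (p ?j)" for r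
    unfolding triangular_roots_def
    using root_string[OF ei(2,3) fj(2,3) ne f_i that] ei(1,4) fj(4) less
    by (auto simp: pairing_add_left pairing_scale_left intro!: bexI[of _ ?i])
  show "e + f \<in> triangular_roots \<longleftrightarrow> 1 \<le> pairing e (p ?j)"
  proof
    assume "1 \<le> pairing e (p ?j)"
    then show "e + f \<in> triangular_roots" using string[of 1] by simp
  next
    assume sum: "e + f \<in> triangular_roots"
    show "1 \<le> pairing e (p ?j)"
    proof (rule ccontr)
      assume "\<not> 1 \<le> pairing e (p ?j)"
      then have "pairing (e + f) (p ?j) < 0" "pairing (e + f) (p ?i) < 0"
        using ei(3) fj(3) f_i by (auto simp: pairing_add_left roots_at_def)
      then show False using two_negative_not_root[OF ei(2) fj(2) ne] triangular_root_is_root[OF sum] by blast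
    qed
  qed
qed

lemma string_in_sums_above:
  assumes "\<And>r. r \<in> {1..N} \<Longrightarrow> e + int r *s f \<in> R" "r \<in> {1..N}"
  shows "e + int r *s f \<in> sums_above R e f" "e + int r *s f \<in> sums_above R f e"
proof -
  have "r \<le> N \<Longrightarrow> 1 \<le> r \<Longrightarrow> e + int r *s f \<in> sums_above R e f \<and> e + int r *s f \<in> sums_above R f e" for r
  proof (induction r)
    case (Suc r)
    have nxt: "e + int (Suc r) *s f \<in> R" using assms(1)[of "Suc r"] Suc.prems by auto
    show ?case
    proof (cases "r = 0")
      case True
      then show ?thesis using nxt sums_above.base[of e f R] sums_above.base[of f e R] by (simp add: add.commute)
    next
      case False
      have eq: "e + int (Suc r) *s f = (e + int r *s f) + f" by (simp add: vec_eq_iff algebra_simps)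
      show ?thesis using Suc False nxt sums_above.right[of "e + int r *s f" R e f]
          sums_above.left[of "e + int r *s f" R f e] unfolding eq by auto
    qed
  qed simp
  then show "e + int r *s f \<in> sums_above R e f" "e + int r *s f \<in> sums_above R f e" using assms(2) by auto
qed

lemma string_generate_sums_above:
  assumes "\<And>r. r \<in> {1..N} \<Longrightarrow> e + int r *s f \<in> triangular_roots" "f \<in> triangular_roots"
  shows "generate (Aut \<Sigma>) {root_map (e + int r *s f) u | r u. r \<in> {2..N}} \<subseteq>
      generate (Aut \<Sigma>) {root_map g (u :: 'k::{alg_closed_field, field_char_0}) | g u. g \<in> sums_above triangular_roots e f - {e + f}}"
    "generate (Aut \<Sigma>) {root_map (e + int r *s f) u | r u. r \<in> {2..N}} \<subseteq>
      generate (Aut \<Sigma>) {root_map g (u :: 'k) | g u. g \<in> sums_above triangular_roots f e - {f + e}}"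
proof -
  interpret group "Aut \<Sigma> :: ('n, 'k) toric_map monoid" by (rule Aut_group)
  have ne: "e + int r *s f \<noteq> e + f" if "r \<in> {2..N}" for r
  proof
    assume "e + int r *s f = e + f"
    then have "pairing (e + int r *s f) (p (root_index f)) = pairing (e + f) (p (root_index f))" by simp
    then show False using triangular_root_index_props(3)[OF assms(2)] that
      by (auto simp: pairing_add_left pairing_scale_left roots_at_def)
  qed
  have "\<exists>g. g \<in> sums_above triangular_roots e f - {e + f} \<and> g \<in> sums_above triangular_roots f e - {f + e} \<and> g = e + int r *s f"
    if "r \<in> {2..N}" for r
    using string_in_sums_above[of N e f triangular_roots r, OF assms(1)] ne[OF that] that by (auto simp: add.commute)
  then show "generate (Aut \<Sigma>) {root_map (e + int r *s f) u | r u. r \<in> {2..N}} \<subseteq>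
      generate (Aut \<Sigma>) {root_map g (u :: 'k) | g u. g \<in> sums_above triangular_roots e f - {e + f}}"
    "generate (Aut \<Sigma>) {root_map (e + int r *s f) u | r u. r \<in> {2..N}} \<subseteq>
      generate (Aut \<Sigma>) {root_map g (u :: 'k) | g u. g \<in> sums_above triangular_roots f e - {f + e}}"
    by (intro mono_generate; blast)+
qed

lemma root_maps_commute:
  fixes s t :: "'k::{alg_closed_field, field_char_0}"
  assumes e: "e \<in> triangular_roots" and f: "f \<in> triangular_roots" and sum: "e + f \<notin> triangular_roots"
  shows "root_map e s \<otimes>\<^bsub>Aut \<Sigma>\<^esub> root_map f t = root_map f t \<otimes>\<^bsub>Aut \<Sigma>\<^esub> root_map e s"
proof -
  note ei = triangular_root_index_props[OF e] and fj = triangular_root_index_props[OF f]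
  consider "root_index e = root_index f" | "root_index e < root_index f" | "root_index f < root_index e" by linarith
  then show ?thesis
  proof cases
    case 1 then show ?thesis using same_index_commute triangular_root_is_root e f by blast
  next
    case 2
    note sums = triangular_root_sum[OF e f 2]
    show ?thesis using no_string_commute[OF ei(2,3) fj(2,3) _ sums(1)] sums(2,3) sum 2 by force
  next
    case 3
    note sums = triangular_root_sum[OF f e 3]
    have "f + e \<notin> triangular_roots" using sum by (simp add: add.commute)
    then show ?thesis using no_string_commute[OF fj(2,3) ei(2,3) _ sums(1), of t s] sums(2,3) 3 by force
  qed
qed

lemma root_maps_commutator:
  assumes e: "e \<in> triangular_roots" and f: "f \<in> triangular_roots" and sum: "e + f \<in> triangular_roots"
  shows "\<exists>\<kappa> :: 'k::{alg_closed_field, field_char_0}. \<kappa> \<noteq> 0 \<and>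
    (\<forall>s t. \<exists>z\<in>generate (Aut \<Sigma>) {root_map g u | g u. g \<in> sums_above triangular_roots e f - {e + f}}.
      commutator (Aut \<Sigma>) (root_map e s) (root_map f t) = root_map (e + f) (\<kappa> * s * t) \<otimes>\<^bsub>Aut \<Sigma>\<^esub> z)"
proof -
  note ei = triangular_root_index_props[OF e] and fj = triangular_root_index_props[OF f]
  have "root_index e \<noteq> root_index f"
  proof
    assume eq: "root_index e = root_index f"
    have "pairing (e + f) (p (root_index e)) = -2" using ei(3) fj(3) eq by (simp add: roots_at_def pairing_add_left)
    moreover obtain k where "k \<in> {1..m}" "e + f \<in> roots_at m p k" using triangular_root_is_root[OF sum] by (auto simp: roots_def)
    ultimately show False using ei(2) by (cases "k = root_index e") (auto simp: roots_at_def dest!: bspec[of _ _ "root_index e"])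
  qed
  then consider "root_index e < root_index f" | "root_index f < root_index e" by linarith
  then show ?thesis
  proof cases
    case 1
    note sums = triangular_root_sum[OF e f 1]
    let ?N = "nat (pairing e (p (root_index f)))"
    have N: "pairing e (p (root_index f)) = int ?N" "1 \<le> ?N" using sums(2,3) sum by auto
    have ne: "root_index e \<noteq> root_index f" using 1 by simp
    have string: "\<And>r. r \<in> {1..?N} \<Longrightarrow> e + int r *s f \<in> triangular_roots" using sums(4) N by auto
    show ?thesis
    proof (intro exI[of _ "of_nat ?N"] conjI allI)
      show "of_nat ?N \<noteq> (0 :: 'k)" using N by simp
      fix s t :: 'k
      show "\<exists>z\<in>generate (Aut \<Sigma>) {root_map g u | g u. g \<in> sums_above triangular_roots e f - {e + f}}.
        commutator (Aut \<Sigma>) (root_map e s) (root_map f t) = root_map (e + f) (of_nat ?N * s * t) \<otimes>\<^bsub>Aut \<Sigma>\<^esub> z"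
        using string_commutator(1)[OF ei(2,3) fj(2,3) ne sums(1) N, of s t]
        by (elim bexE) (rule bexI, assumption, rule subsetD[OF string_generate_sums_above(1)[OF string f]])
    qed
  next
    case 2
    note sums = triangular_root_sum[OF f e 2]
    let ?N = "nat (pairing f (p (root_index e)))"
    have fe: "f + e \<in> triangular_roots" using sum by (simp add: add.commute)
    have N: "pairing f (p (root_index e)) = int ?N" "1 \<le> ?N" using sums(2,3) fe by auto
    have ne: "root_index f \<noteq> root_index e" using 2 by simp
    have string: "\<And>r. r \<in> {1..?N} \<Longrightarrow> f + int r *s e \<in> triangular_roots" using sums(4) N by auto
    show ?thesis
    proof (intro exI[of _ "- of_nat ?N"] conjI allI)
      show "- of_nat ?N \<noteq> (0 :: 'k)" using N by simp
      fix s t :: 'k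
      have "\<exists>z\<in>generate (Aut \<Sigma>) {root_map g u | g u. g \<in> sums_above triangular_roots e f - {e + f}}.
        commutator (Aut \<Sigma>) (root_map e s) (root_map f t) = root_map (f + e) (- of_nat ?N * t * s) \<otimes>\<^bsub>Aut \<Sigma>\<^esub> z"
        using string_commutator(2)[OF fj(2,3) ei(2,3) ne sums(1) N, where s = t and t = s]
        by (elim bexE) (rule bexI, assumption, rule subsetD[OF string_generate_sums_above(2)[OF string e]])
      then show "\<exists>z\<in>generate (Aut \<Sigma>) {root_map g u | g u. g \<in> sums_above triangular_roots e f - {e + f}}.
        commutator (Aut \<Sigma>) (root_map e s) (root_map f t) = root_map (e + f) (- of_nat ?N * s * t) \<otimes>\<^bsub>Aut \<Sigma>\<^esub> z"
        by (simp add: add.commute[of f e] ac_simps)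
    qed
  qed
qed

end

section \<open>Independence of the root elements\<close>

text \<open>The bound is an integer; for a negative bound only the zero polynomial remains.\<close>

definition degree_le :: "'k::comm_ring_1 poly \<Rightarrow> int \<Rightarrow> bool" where
  "degree_le Q b \<longleftrightarrow> (\<forall>k. b < int k \<longrightarrow> coeff Q k = 0)"

lemma degree_le_0: "degree_le 0 b"
  by (simp add: degree_le_def)

lemma degree_le_add: "degree_le Q b \<Longrightarrow> degree_le Q' b \<Longrightarrow> degree_le (Q + Q') b"
  by (simp add: degree_le_def)

lemma degree_le_smult: "degree_le Q b \<Longrightarrow> degree_le (smult c Q) b"
  by (simp add: degree_le_def)

lemma degree_le_mono: "degree_le Q b \<Longrightarrow> b \<le> b' \<Longrightarrow> degree_le Q b'"
  by (simp add: degree_le_def)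

lemma degree_le_monom: "int k \<le> b \<Longrightarrow> degree_le (monom c k) b"
  by (auto simp: degree_le_def)

lemma degree_le_1: "degree_le 1 0"
  by (simp add: degree_le_def)

lemma degree_le_mult:
  assumes "degree_le Q b" "degree_le Q' b'"
  shows "degree_le (Q * Q') (b + b')"
  unfolding degree_le_def
proof (intro allI impI)
  fix k assume k: "b + b' < int k"
  have "coeff Q i * coeff Q' (k - i) = 0" if "i \<le> k" for i
  proof (cases "b < int i")
    case True then show ?thesis using assms(1) by (simp add: degree_le_def)
  next
    case False
    then have "b' < int (k - i)" using k that by linarith
    then show ?thesis using assms(2) by (simp add: degree_le_def)
  qed
  then show "coeff (Q * Q') k = 0" by (simp add: coeff_mult)
qed

lemma degree_le_power: "degree_le Q b \<Longrightarrow> degree_le (Q ^ k) (int k * b)"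
proof (induction k)
  case (Suc k)
  then show ?case using degree_le_mult[of Q b "Q ^ k" "int k * b"] by (simp add: algebra_simps)
qed (simp add: degree_le_1)

lemma degree_le_prod:
  "(\<And>s. s \<in> S \<Longrightarrow> degree_le (F s) (b s)) \<Longrightarrow> degree_le (\<Prod>s\<in>S. F s) (\<Sum>s\<in>S. b s)"
  by (induction S rule: infinite_finite_induct) (auto intro: degree_le_1 degree_le_mult)

context bilateral_fan
begin

text \<open>Curves in the open cell that agree with \<open>s \<mapsto> (s ^ cell_weight j)\<close> up to terms whose degree drops by at least
  \<open>d\<close>. A root element whose weight is at least \<open>d\<close> preserves this class, since its monomial lowers the degree by the
  weight of the root; this detects the filtration by weight.\<close>

definition curves :: "int \<Rightarrow> ('k::field \<Rightarrow> nat \<Rightarrow> 'k) set" where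
  "curves d = {Y. (\<forall>s k. k \<notin> {1..m} \<longrightarrow> Y s k = 0) \<and> (\<forall>s. \<forall>k\<in>{n<..m}. Y s k = 1) \<and>
     (\<forall>j\<in>{1..n}. \<exists>Q. degree_le Q (cell_weight j - d) \<and> (\<forall>s. Y s j = s ^ nat (cell_weight j) + poly Q s))}"

definition weight_curve :: "'k::field \<Rightarrow> nat \<Rightarrow> 'k" where
  "weight_curve s k = (if k \<in> {1..n} then s ^ nat (cell_weight k) else if k \<in> {n<..m} then 1 else 0)"

lemma weight_curve_in: "weight_curve \<in> curves d"
  unfolding curves_def weight_curve_def using n_le_m
  by (auto intro!: exI[of _ 0] simp: degree_le_0)

text \<open>On the chart of the cone spanned by \<open>p 1, \<dots>, p n\<close> the character of \<open>q j\<close> is the \<open>j\<close>-th coordinate. So points of the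
  open cell can be recovered from their images.\<close>

lemma cell_coordinate:
  assumes y: "\<And>k. k \<notin> {1..m} \<Longrightarrow> y k = 0" "\<And>k. k \<in> {n<..m} \<Longrightarrow> y k = (1 :: 'k::field)"
  shows "y \<in> cox" "zeros y \<subseteq> {1..n}" "j \<in> {1..n} \<Longrightarrow> snd (quot y) (q j) = y j"
proof -
  obtain \<sigma> where \<sigma>: "\<sigma> \<in> \<Sigma>" "rays \<sigma> = {1..n}" using basis_cone by blast
  show z: "zeros y \<subseteq> {1..n}" using y(2) indices_split by (fastforce simp: zeros_def)
  then show yc: "y \<in> cox" unfolding cox_iff using \<sigma> y(1) by auto
  assume j: "j \<in> {1..n}"
  have qd: "q j \<in> dual_semigroup \<sigma>" unfolding dual_semigroup_iff[OF \<sigma>(1)] \<sigma>(2) using q_p[OF j] by auto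
  have "char_monomial (q j) y = (\<Prod>s\<in>{1..m}. if s = j then y j else 1)"
    unfolding char_monomial_def
  proof (rule prod.cong[OF refl])
    fix s assume s: "s \<in> {1..m}"
    show "y s powi pairing (q j) (p s) = (if s = j then y j else 1)"
      using indices_split[OF s] q_p[OF j, of s] y(2)[of s] j by auto
  qed
  then have "char_monomial (q j) y = y j" using j n_le_m by simp
  then show "snd (quot y) (q j) = y j" using quot_char[OF yc \<sigma>(1) _ qd] z \<sigma>(2) by simp
qed

lemma curve_point:
  assumes "Y \<in> curves d"
  shows "Y s \<in> cox" "zeros (Y s) \<subseteq> {1..n}" "j \<in> {1..n} \<Longrightarrow> snd (quot (Y s)) (q j) = Y s j"
  using cell_coordinate[of "Y s"] assms by (auto simp: curves_def)

lemma root_weight_root: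
  assumes "i \<in> {1..n}" "e \<in> roots_at m p i"
  shows "root_weight e = cell_weight i - (\<Sum>l\<in>{1..n}-{i}. cell_weight l * pairing e (p l))"
  unfolding root_weight_def using assms by (subst sum.remove[of _ i]) (auto simp: roots_at_def)

lemma root_weight_sum_nonneg:
  assumes "i \<in> {1..n}" "e \<in> roots_at m p i"
  shows "0 \<le> (\<Sum>l\<in>{1..n}-{i}. cell_weight l * pairing e (p l))"
  using assms n_le_m cell_weight_pos by (intro sum_nonneg mult_nonneg_nonneg) (auto simp: roots_at_def less_imp_le)

lemma root_monomial_weight_curve:
  assumes i: "i \<in> {1..n}" and e: "e \<in> roots_at m p i"
  shows "root_monomial i e (weight_curve s) = s ^ nat (\<Sum>l\<in>{1..n}-{i}. cell_weight l * pairing e (p l))"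
proof -
  have nonneg: "0 \<le> pairing e (p l)" if "l \<in> {1..n} - {i}" for l
    using e that n_le_m by (auto simp: roots_at_def)
  have "root_monomial i e (weight_curve s) = (\<Prod>l\<in>{1..n}-{i}. s ^ nat (cell_weight l * pairing e (p l)))"
    unfolding root_monomial_def
  proof (rule prod.mono_neutral_cong_right)
    fix l assume "l \<in> {1..n} - {i}"
    then show "weight_curve s l ^ nat (pairing e (p l)) = s ^ nat (cell_weight l * pairing e (p l))"
      using cell_weight_pos[of l] by (simp add: weight_curve_def nat_mult_distrib power_mult)
  next
    show "\<forall>l\<in>{1..m} - {i} - ({1..n} - {i}). weight_curve s l ^ nat (pairing e (p l)) = 1"
      using indices_split by (auto simp: weight_curve_def)
  qed (use n_le_m in auto)
  also have "\<dots> = s ^ (\<Sum>l\<in>{1..n}-{i}. nat (cell_weight l * pairing e (p l)))" by (simp add: power_sum)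
  also have "(\<Sum>l\<in>{1..n}-{i}. nat (cell_weight l * pairing e (p l))) = nat (\<Sum>l\<in>{1..n}-{i}. cell_weight l * pairing e (p l))"
  proof -
    have "int (\<Sum>l\<in>{1..n}-{i}. nat (cell_weight l * pairing e (p l))) = (\<Sum>l\<in>{1..n}-{i}. cell_weight l * pairing e (p l))"
      unfolding of_nat_sum using nonneg cell_weight_pos by (intro sum.cong) (auto simp: less_imp_le)
    then show ?thesis by (metis nat_int)
  qed
  finally show ?thesis .
qed

lemma root_action_curve:
  assumes e: "e \<in> triangular_roots" and d: "0 \<le> d" "d \<le> root_weight e" and Y: "Y \<in> curves d"
  shows "(\<lambda>s. root_action m p (root_index e) e \<alpha> (Y s)) \<in> curves d"
proof -
  let ?i = "root_index e"
  note i = triangular_root_index_props[OF e]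
  have Y0: "\<And>s k. k \<notin> {1..m} \<Longrightarrow> Y s k = 0" and Y1: "\<And>s k. k \<in> {n<..m} \<Longrightarrow> Y s k = 1"
    and YQ: "\<And>j. j \<in> {1..n} \<Longrightarrow> \<exists>Q. degree_le Q (cell_weight j - d) \<and> (\<forall>s. Y s j = s ^ nat (cell_weight j) + poly Q s)"
    using Y by (auto simp: curves_def)
  have nonneg: "0 \<le> pairing e (p l)" if "l \<in> {1..m} - {?i}" for l
    using i(3) that by (auto simp: roots_at_def)
  let ?b = "\<lambda>l. if l \<in> {1..n} then cell_weight l else 0"
  have "\<forall>l\<in>{1..m}. \<exists>F. degree_le F (?b l) \<and> (\<forall>s. Y s l = poly F s)"
  proof
    fix l assume l: "l \<in> {1..m}"
    show "\<exists>F. degree_le F (?b l) \<and> (\<forall>s. Y s l = poly F s)"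
    proof (cases "l \<in> {1..n}")
      case True
      then obtain Q where Q: "degree_le Q (cell_weight l - d)" "\<forall>s. Y s l = s ^ nat (cell_weight l) + poly Q s" using YQ by blast
      have "degree_le (monom 1 (nat (cell_weight l)) + Q) (cell_weight l)"
        using cell_weight_pos[of l] d(1) degree_le_mono[OF Q(1), of "cell_weight l"] by (intro degree_le_add degree_le_monom) auto
      then show ?thesis using Q(2) True by (intro exI[of _ "monom 1 (nat (cell_weight l)) + Q"]) (simp add: poly_monom)
    next
      case False
      then show ?thesis using Y1[of l] l degree_le_1 by (intro exI[of _ 1]) auto
    qed
  qed
  then obtain F where F: "\<And>l. l \<in> {1..m} \<Longrightarrow> degree_le (F l) (?b l)" "\<And>l s. l \<in> {1..m} \<Longrightarrow> Y s l = poly (F l) s"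
    by metis
  let ?M = "\<Prod>l\<in>{1..m}-{?i}. F l ^ nat (pairing e (p l))"
  have M: "root_monomial ?i e (Y s) = poly ?M s" for s
    unfolding root_monomial_def poly_prod poly_power using F(2) by (intro prod.cong) auto
  have "degree_le ?M (\<Sum>l\<in>{1..m}-{?i}. int (nat (pairing e (p l))) * ?b l)"
    using F(1) by (intro degree_le_prod degree_le_power) auto
  also have "(\<Sum>l\<in>{1..m}-{?i}. int (nat (pairing e (p l))) * ?b l) = (\<Sum>l\<in>{1..n}-{?i}. cell_weight l * pairing e (p l))"
    using n_le_m nonneg by (intro sum.mono_neutral_cong_right) auto
  also have "\<dots> = cell_weight ?i - root_weight e" using root_weight_root[OF i(1,3)] by simp
  finally have M_deg: "degree_le ?M (cell_weight ?i - d)" by (rule degree_le_mono) (use d(2) in simp)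
  obtain Q where Q: "degree_le Q (cell_weight ?i - d)" "\<forall>s. Y s ?i = s ^ nat (cell_weight ?i) + poly Q s" using YQ[OF i(1)] by blast
  have new: "degree_le (Q + smult \<alpha> ?M) (cell_weight ?i - d)" using Q(1) M_deg by (intro degree_le_add degree_le_smult)
  have val: "root_action m p ?i e \<alpha> (Y s) ?i = s ^ nat (cell_weight ?i) + poly (Q + smult \<alpha> ?M) s" for s
    using Q(2) M[of s] by (simp add: root_action_upd)
  show ?thesis unfolding curves_def
  proof (intro CollectI conjI allI impI ballI)
    fix s k assume "k \<notin> {1..m}"
    then show "root_action m p ?i e \<alpha> (Y s) k = 0" using Y0 i(2) by (auto simp: root_action_upd)
  next
    fix s k assume "k \<in> {n<..m}"
    then show "root_action m p ?i e \<alpha> (Y s) k = 1" using Y1 i(1) by (auto simp: root_action_upd)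
  next
    fix j assume j: "j \<in> {1..n}"
    show "\<exists>Q. degree_le Q (cell_weight j - d) \<and> (\<forall>s. root_action m p ?i e \<alpha> (Y s) j = s ^ nat (cell_weight j) + poly Q s)"
    proof (cases "j = ?i")
      case True
      then show ?thesis using new val by blast
    next
      case False
      then show ?thesis using YQ[OF j] by (simp add: root_action_upd)
    qed
  qed
qed

lemma generated_preserves_curves:
  fixes g :: "('n, 'k::{alg_closed_field, field_char_0}) toric_map"
  assumes d: "0 \<le> d" and S: "S \<subseteq> triangular_roots" "\<And>e. e \<in> S \<Longrightarrow> d \<le> root_weight e"
    and g: "g \<in> generate (Aut \<Sigma>) {root_map e s | e s. e \<in> S}" and Y: "Y \<in> curves d"
  shows "\<exists>Y'\<in>curves d. \<forall>s. g (quot (Y s)) = quot (Y' s)"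
proof -
  interpret group "Aut \<Sigma> :: ('n, 'k) toric_map monoid" by (rule Aut_group)
  have gens: "{root_map e s | e (s :: 'k). e \<in> S} \<subseteq> carrier (Aut \<Sigma>)"
    using root_map_closed triangular_root_is_root S(1) by blast
  have root: "\<exists>Y'\<in>curves d. \<forall>s. root_map e u (quot (Y s)) = quot (Y' s)"
    if "e \<in> S" "Y \<in> curves d" for e and u :: 'k and Y
  proof -
    have eP: "e \<in> triangular_roots" using that S by blast
    have "(\<lambda>s. root_action m p (root_index e) e u (Y s)) \<in> curves d"
      by (rule root_action_curve[OF eP d S(2)[OF that(1)] that(2)])
    then show ?thesis using root_map_quot[OF triangular_root_is_root[OF eP]] curve_point(1)[OF that(2)]
      by (intro bexI[of _ "\<lambda>s. root_action m p (root_index e) e u (Y s)"]) auto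
  qed
  show ?thesis using g Y
  proof (induction arbitrary: Y rule: generate.induct)
    case one
    then show ?case using Aut_one_apply quot_in_variety curve_point(1) by blast
  next
    case (incl h)
    then show ?case using root by blast
  next
    case (inv h)
    then obtain e u where h: "h = root_map e u" "e \<in> S" by blast
    then have "inv\<^bsub>Aut \<Sigma>\<^esub> h = root_map e (- u)" using root_map_inverse triangular_root_is_root S(1) by blast
    then show ?case using root[OF h(2) inv.prems] by simp
  next
    case (eng h1 h2)
    obtain Y' where Y': "Y' \<in> curves d" "\<forall>s. h2 (quot (Y s)) = quot (Y' s)" using eng by blast
    obtain Y'' where Y'': "Y'' \<in> curves d" "\<forall>s. h1 (quot (Y' s)) = quot (Y'' s)" using eng Y'(1) by blast
    have "h1 \<in> carrier (Aut \<Sigma>)" "h2 \<in> carrier (Aut \<Sigma>)"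
      using generate_in_carrier[OF gens] eng.hyps by auto
    then have "(h1 \<otimes>\<^bsub>Aut \<Sigma>\<^esub> h2) (quot (Y s)) = quot (Y'' s)" for s
      using Aut_mult_apply quot_in_variety[OF curve_point(1)[OF eng.prems]] Y'(2) Y''(2) by metis
    then show ?case using Y''(1) by blast
  qed
qed

text \<open>Applied to the curve \<open>weight_curve\<close>, the root element produces the term \<open>c s ^ K\<close> in its coordinate, with \<open>K\<close>
  lower by exactly the weight of the root, which the other side cannot contain.\<close>

lemma root_map_independent:
  fixes c :: "'k::{alg_closed_field, field_char_0}"
  assumes e: "e \<in> triangular_roots"
    and gen: "root_map e c \<in> generate (Aut \<Sigma>) {root_map f u | f u. f \<in> triangular_roots \<and> root_weight e < root_weight f}"
  shows "c = 0"
proof -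
  let ?i = "root_index e" and ?d = "root_weight e + 1"
  let ?R = "root_action m p ?i e c"
  note i = triangular_root_index_props[OF e]
  have "root_map e c \<in> generate (Aut \<Sigma>) {root_map f u | f u. f \<in> {f \<in> triangular_roots. root_weight e < root_weight f}}" using gen by simp
  then obtain Y' where Y': "Y' \<in> curves ?d" "\<forall>s. root_map e c (quot (weight_curve s)) = quot (Y' s)"
    using generated_preserves_curves[of ?d "{f \<in> triangular_roots. root_weight e < root_weight f}" "root_map e c" weight_curve]
      weight_curve_in root_weight_pos[OF e] by fastforce
  have R: "(\<lambda>s. ?R (weight_curve s)) \<in> curves (root_weight e)"
    by (rule root_action_curve[OF e _ _ weight_curve_in]) (use root_weight_pos[OF e] in auto)
  have "quot (?R (weight_curve s)) = quot (Y' s)" for s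
    using root_map_quot[OF triangular_root_is_root[OF e] curve_point(1)[OF weight_curve_in]] Y'(2) by metis
  then have same: "?R (weight_curve s) ?i = Y' s ?i" for s
    using curve_point(3)[OF R i(1), of s] curve_point(3)[OF Y'(1) i(1), of s] by simp
  obtain Q where Q: "degree_le Q (cell_weight ?i - ?d)" "\<forall>s. Y' s ?i = s ^ nat (cell_weight ?i) + poly Q s"
    using Y'(1) i(1) unfolding curves_def by blast
  let ?K = "nat (\<Sum>l\<in>{1..n}-{?i}. cell_weight l * pairing e (p l))"
  have K: "int ?K = cell_weight ?i - root_weight e"
    using root_weight_root[OF i(1,3)] root_weight_sum_nonneg[OF i(1,3)] by simp
  have "poly (monom c ?K) s = poly Q s" for s
  proof -
    have "s ^ nat (cell_weight ?i) + c * s ^ ?K = s ^ nat (cell_weight ?i) + poly Q s"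
      using same[of s] Q(2) i(1) root_monomial_weight_curve[OF i(1,3), of s]
      by (simp add: root_action_upd weight_curve_def)
    then show ?thesis by (simp add: poly_monom)
  qed
  then have "monom c ?K = Q" by (simp add: poly_eq_poly_eq_iff[symmetric] fun_eq_iff)
  then have "c = coeff Q ?K" by (metis coeff_monom)
  also have "\<dots> = 0" using Q(1) K unfolding degree_le_def by auto
  finally show ?thesis .
qed

text \<open>For a root at \<open>i \<le> n\<close> involving some \<open>j < i\<close>, the degree of the coordinate \<open>i\<close> of \<open>weight_curve\<close> goes up. For a root at
  \<open>i > n\<close> the action moves the point with all coordinates \<open>1\<close> to a point with \<open>y i = 0\<close>, which leaves the
  open cell.\<close>

lemma root_map_not_in_triangular_group:
  assumes e: "e \<in> roots m p" "e \<notin> triangular_roots"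
  shows "\<exists>c :: 'k::{alg_closed_field, field_char_0}. root_map e c \<notin> generate (Aut \<Sigma>) {root_map f u | f u. f \<in> triangular_roots}"
proof -
  let ?i = "root_index e"
  have i: "?i \<in> {1..m}" "e \<in> roots_at m p ?i" using root_indexD[OF e(1)] by auto
  have "0 \<le> pairing e (p s)" if "s \<in> {1..m}" "s \<noteq> ?i" for s using i(2) that by (auto simp: roots_at_def)
  note nonneg = this
  have pres: "\<exists>Y'\<in>curves 1. \<forall>s. root_map e c (quot (weight_curve s)) = quot (Y' s)"
    if "root_map e c \<in> generate (Aut \<Sigma>) {root_map f u | f u. f \<in> triangular_roots}" for c :: 'k
    using generated_preserves_curves[of 1 triangular_roots, OF _ _ _ that weight_curve_in] root_weight_pos by fastforce
  note quot_R = root_map_quot[OF e(1) curve_point(1)[OF weight_curve_in]]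
  consider "?i \<in> {1..n}" | "?i \<in> {n<..m}" using indices_split[OF i(1)] by blast
  then show ?thesis
  proof cases
    case 1
    then obtain j where j: "j \<in> {1..<?i}" "pairing e (p j) \<noteq> 0" using e(2) i(2) unfolding triangular_roots_def by blast
    let ?K = "nat (\<Sum>l\<in>{1..n}-{?i}. cell_weight l * pairing e (p l))"
    have "cell_weight ?i < cell_weight j"
    proof -
      have "n - ?i < n - j" using j(1) 1 by auto
      then show ?thesis using weight_base_ge unfolding cell_weight_def by (intro power_strict_increasing) auto
    qed
    also have "cell_weight j \<le> cell_weight j * pairing e (p j)"
      using j nonneg[of j] 1 i(1) cell_weight_pos[of j] mult_left_mono[of 1 "pairing e (p j)" "cell_weight j"] by force
    also have "\<dots> \<le> (\<Sum>l\<in>{1..n}-{?i}. cell_weight l * pairing e (p l))"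
      using j 1 nonneg n_le_m cell_weight_pos
      by (intro member_le_sum) (auto simp: less_imp_le)
    finally have K: "cell_weight ?i < int ?K" by simp
    have "root_map e 1 \<notin> generate (Aut \<Sigma>) {root_map f (u :: 'k) | f u. f \<in> triangular_roots}"
    proof
      assume "root_map e 1 \<in> generate (Aut \<Sigma>) {root_map f (u :: 'k) | f u. f \<in> triangular_roots}"
      then obtain Y' where Y': "Y' \<in> curves 1" "\<forall>s. root_map e (1 :: 'k) (quot (weight_curve s)) = quot (Y' s)"
        using pres[of 1] by blast
      obtain Q where Q: "degree_le Q (cell_weight ?i - 1)" "\<forall>s. Y' s ?i = s ^ nat (cell_weight ?i) + poly Q s"
        using Y'(1) 1 unfolding curves_def by blast
      have "poly (monom 1 ?K) s = poly Q s" for s :: 'k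
      proof -
        let ?y = "root_action m p ?i e 1 (weight_curve s)"
        have "quot ?y = quot (Y' s)" using quot_R[of 1 s] Y'(2) by simp
        moreover have "snd (quot ?y) (q ?i) = ?y ?i"
          by (rule cell_coordinate(3)[OF _ _ 1]) (use 1 n_le_m in \<open>auto simp: root_action_upd weight_curve_def\<close>)
        ultimately have "?y ?i = Y' s ?i" using curve_point(3)[OF Y'(1) 1, of s] by simp
        then show ?thesis
          using Q(2) 1 root_monomial_weight_curve[OF 1 i(2), of s]
          by (simp add: root_action_upd weight_curve_def poly_monom)
      qed
      then have "monom 1 ?K = Q" by (simp add: poly_eq_poly_eq_iff[symmetric] fun_eq_iff)
      then have "coeff Q ?K = 1" by (metis coeff_monom)
      moreover have "coeff Q ?K = 0" using Q(1) K unfolding degree_le_def by auto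
      ultimately show False by simp
    qed
    then show ?thesis by blast
  next
    case 2
    have "root_map e (- 1) \<notin> generate (Aut \<Sigma>) {root_map f (u :: 'k) | f u. f \<in> triangular_roots}"
    proof
      assume "root_map e (- 1) \<in> generate (Aut \<Sigma>) {root_map f (u :: 'k) | f u. f \<in> triangular_roots}"
      then obtain Y' where Y': "Y' \<in> curves 1" "\<forall>s. root_map e (- 1 :: 'k) (quot (weight_curve s)) = quot (Y' s)"
        using pres[of "- 1"] by blast
      let ?y = "root_action m p ?i e (- 1) (weight_curve (1 :: 'k))"
      have "quot ?y = quot (Y' 1)" using quot_R[of "- 1" "1 :: 'k"] Y'(2) by simp
      then have cone: "cone_of ?y = cone_of (Y' 1)" using fst_quot by metis
      have one: "weight_curve (1 :: 'k) k = 1" if "k \<in> {1..m}" for k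
        using indices_split[OF that] by (auto simp: weight_curve_def)
      have "root_monomial ?i e (weight_curve (1 :: 'k)) = 1"
        unfolding root_monomial_def using one by (intro prod.neutral) auto
      then have "?i \<in> zeros ?y" using one[OF i(1)] i(1) by (simp add: zeros_def root_action_upd)
      then have "?i \<in> rays (cone_of (Y' 1))" using zeros_subset[of ?y] cone by auto
      moreover obtain \<sigma> where \<sigma>: "\<sigma> \<in> \<Sigma>" "rays \<sigma> = {1..n}" using basis_cone by blast
      moreover have "cone_of (Y' 1) \<subseteq> \<sigma>"
        using cone_of_subset_iff[OF curve_point(1)[OF Y'(1)] \<sigma>(1)] curve_point(2)[OF Y'(1)] \<sigma>(2) by simp
      ultimately have "?i \<in> {1..n}" by (auto simp: rays_def)
      then show False using 2 by auto
    qed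
    then show ?thesis by blast
  qed
qed

section \<open>Torus weights and the theorem\<close>

lemma torus_map_root_map:
  fixes s :: "'k::{alg_closed_field, field_char_0}"
  assumes t: "character_on UNIV t" and e: "e \<in> triangular_roots"
  shows "torus_map t \<otimes>\<^bsub>Aut \<Sigma>\<^esub> root_map e s \<otimes>\<^bsub>Aut \<Sigma>\<^esub> inv\<^bsub>Aut \<Sigma>\<^esub> (torus_map t) = root_map e (inverse (t e) * s)"
proof -
  interpret group "Aut \<Sigma> :: ('n, 'k) toric_map monoid" by (rule Aut_group)
  let ?i = "root_index e"
  note i = triangular_root_index_props[OF e]
  have er: "e \<in> roots m p" by (rule triangular_root_is_root[OF e])
  have tq: "\<And>u. t u \<noteq> 0" using t by (simp add: character_on_def)
  let ?A = "\<Prod>l\<in>{1..n}-{?i}. t (q l) ^ nat (pairing e (p l))"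
  have te: "t e = inverse (t (q ?i)) * ?A"
  proof -
    have "t e = (\<Prod>l\<in>{1..n}. t (q l) powi pairing e (p l))"
      using character_sum[OF t, of "\<lambda>l. pairing e (p l)" q "{1..n}"] lattice_expand[of e] by simp
    also have "\<dots> = t (q ?i) powi pairing e (p ?i) * (\<Prod>l\<in>{1..n}-{?i}. t (q l) powi pairing e (p l))"
      using i(1) by (subst prod.remove[of _ ?i]) auto
    also have "(\<Prod>l\<in>{1..n}-{?i}. t (q l) powi pairing e (p l)) = ?A"
      using i(3) n_le_m by (intro prod.cong) (auto simp: roots_at_def power_int_nonneg_exp)
    finally show ?thesis using i(3) by (simp add: roots_at_def power_int_minus)
  qed
  have mono: "root_monomial ?i e (torus_lift t y) = ?A * root_monomial ?i e y" for y :: "nat \<Rightarrow> 'k"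
  proof -
    have "root_monomial ?i e (torus_lift t y) =
        (\<Prod>l\<in>{1..m}-{?i}. (if l \<in> {1..n} then t (q l) ^ nat (pairing e (p l)) else 1) * y l ^ nat (pairing e (p l)))"
      unfolding root_monomial_def by (rule prod.cong) (auto simp: torus_lift_def power_mult_distrib)
    also have "\<dots> = (\<Prod>l\<in>{1..m}-{?i}. (if l \<in> {1..n} then t (q l) ^ nat (pairing e (p l)) else 1)) * root_monomial ?i e y"
      by (simp add: prod.distrib root_monomial_def)
    also have "(\<Prod>l\<in>{1..m}-{?i}. (if l \<in> {1..n} then t (q l) ^ nat (pairing e (p l)) else 1)) = ?A"
      using n_le_m by (intro prod.mono_neutral_cong_right) auto
    finally show ?thesis .
  qed
  have scal: "inverse (t e) * ?A = t (q ?i)"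
  proof -
    have "?A \<noteq> 0" using tq by simp
    then show ?thesis unfolding te using tq by (simp add: field_simps)
  qed
  have "torus_map t \<otimes>\<^bsub>Aut \<Sigma>\<^esub> root_map e s = root_map e (inverse (t e) * s) \<otimes>\<^bsub>Aut \<Sigma>\<^esub> torus_map t"
  proof (rule lifts_unique[OF lifts_mult[OF torus_map_lifts[OF t] root_map_lifts[OF er]]
      lifts_mult[OF root_map_lifts[OF er] torus_map_lifts[OF t]]])
    fix y :: "nat \<Rightarrow> 'k"
    have "inverse (t e) * s * (?A * root_monomial ?i e y) = t (q ?i) * (s * root_monomial ?i e y)"
      by (simp add: mult.assoc mult.left_commute flip: scal)
    then show "torus_lift t (root_action m p ?i e s y) = root_action m p ?i e (inverse (t e) * s) (torus_lift t y)"
      using i(1) unfolding root_action_upd mono by (auto simp: torus_lift_def fun_eq_iff algebra_simps)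
  qed
  then show ?thesis
    using torus_map_Aut[OF t] by (simp add: m_assoc root_map_closed[OF er])
qed

lemma root_weight_scale: "root_weight (k *s e) = k * root_weight e"
  by (simp add: root_weight_def pairing_scale_left sum_distrib_left algebra_simps)

text \<open>For every \<open>a\<close> the vector \<open>a + \<langle>e, a\<rangle> p i\<close> is orthogonal to \<open>e\<close>. If all of these were orthogonal to \<open>f\<close>, then
  \<open>f\<close> would be a multiple of \<open>e\<close>; comparing weights and the value \<open>-1\<close> on a ray, it would be \<open>e\<close>.\<close>

lemma separating_one_parameter_subgroup:
  assumes e: "e \<in> triangular_roots" and f: "f \<in> triangular_roots" and "e \<noteq> f"
  shows "\<exists>z. pairing e z = 0 \<and> pairing f z \<noteq> 0"
proof (rule ccontr)
  assume none: "\<not> ?thesis"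
  note i = triangular_root_index_props[OF e] and j = triangular_root_index_props[OF f]
  let ?i = "root_index e" and ?j = "root_index f" and ?k = "- pairing f (p (root_index e))"
  have "pairing f a = pairing (?k *s e) a" for a
  proof -
    have "pairing e (a + pairing e a *s p ?i) = 0"
      using i(3) by (simp add: pairing_add_right pairing_scale_right roots_at_def)
    then have "pairing f (a + pairing e a *s p ?i) = 0" using none by blast
    then show ?thesis by (simp add: pairing_add_right pairing_scale_right pairing_scale_left algebra_simps)
  qed
  then have fk: "f = ?k *s e" by (intro lattice_eqI) blast
  then have "root_weight f = ?k * root_weight e" using root_weight_scale by metis
  then have kpos: "0 < ?k" using root_weight_pos[OF e] root_weight_pos[OF f] by (metis zero_less_mult_pos2)
  have "?k * pairing e (p ?j) = -1" using j(3) fk pairing_scale_left[of ?k e "p ?j"] by (simp add: roots_at_def)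
  then have "?k dvd -1" by (metis dvd_triv_left)
  then have "?k = 1" using kpos by (simp add: zdvd_not_zless)
  then show False using fk assms(3) by simp
qed

lemma character_power:
  "c \<noteq> 0 \<Longrightarrow> character_on UNIV (\<lambda>u. (c :: 'k::field) powi pairing u z)"
  by (simp add: character_on_def pairing_add_left power_int_add)

lemma two_powi_eq_1: "(2 :: 'k::field_char_0) powi k = 1 \<Longrightarrow> k = 0"
proof (rule ccontr)
  assume k: "(2 :: 'k) powi k = 1" "k \<noteq> 0"
  have "(2 :: 'k) ^ nat \<bar>k\<bar> = 1"
  proof (cases "0 \<le> k")
    case True then show ?thesis using k by (simp add: power_int_nonneg_exp)
  next
    case False
    then have "(2 :: 'k) powi (- k) = 1" using k(1) by (simp add: power_int_minus)
    then show ?thesis using False by (simp add: power_int_nonneg_exp)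
  qed
  then have "of_nat (2 ^ nat \<bar>k\<bar>) = (of_nat 1 :: 'k)" by simp
  then have "(2 :: nat) ^ nat \<bar>k\<bar> = 1" by (simp only: of_nat_eq_iff)
  then show False using k(2) by simp
qed

definition torus_pairs :: "(('n, 'k::field) toric_map \<times> (int ^ 'n \<Rightarrow> 'k)) set" where
  "torus_pairs = {(torus_map t, \<lambda>e. inverse (t e)) | t. character_on UNIV t}"

lemma torus_pairsI: "character_on UNIV t \<Longrightarrow> (torus_map t, \<lambda>e. inverse (t e)) \<in> torus_pairs"
  unfolding torus_pairs_def by (intro CollectI exI[of _ t]) simp

lemma torus_root_group_Aut:
  "torus_root_group (Aut \<Sigma> :: ('n, 'k::{alg_closed_field, field_char_0}) toric_map monoid)
     triangular_roots root_weight root_map torus_pairs"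
proof -
  interpret group "Aut \<Sigma> :: ('n, 'k) toric_map monoid" by (rule Aut_group)
  show ?thesis
  proof unfold_locales
    fix e f :: "int ^ 'n" assume e: "e \<in> triangular_roots" and f: "f \<in> triangular_roots" and ne: "e \<noteq> f"
    obtain z where z: "pairing e z = 0" "pairing f z \<noteq> 0"
      using separating_one_parameter_subgroup[OF e f ne] by blast
    let ?t = "\<lambda>u. (2 :: 'k) powi pairing u z"
    have "(torus_map ?t, \<lambda>e. inverse (?t e)) \<in> torus_pairs" by (rule torus_pairsI, rule character_power) simp
    moreover have "inverse (?t e) = 1" using z by simp
    moreover have "inverse (?t f) \<noteq> 1" using two_powi_eq_1[where ?'k = 'k] z by (metis inverse_eq_1_iff)
    ultimately show "\<exists>(t, ch)\<in>torus_pairs. ch e = (1 :: 'k) \<and> ch f \<noteq> 1"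
      by (intro bexI[of _ "(torus_map ?t, \<lambda>e. inverse (?t e))"]) (simp_all only: prod.case simp_thms)
  next
    fix e :: "int ^ 'n" and c :: 'k assume e: "e \<in> triangular_roots" and c: "c \<noteq> 0"
    let ?t = "\<lambda>u. c powi pairing u (p (root_index e))"
    have "(torus_map ?t, \<lambda>e. inverse (?t e)) \<in> torus_pairs" by (rule torus_pairsI, rule character_power[OF c])
    moreover have "inverse (?t e) = c"
      using triangular_root_index_props(3)[OF e] by (simp add: roots_at_def power_int_minus)
    ultimately show "\<exists>(t, ch)\<in>torus_pairs. ch e = c"
      by (intro bexI[of _ "(torus_map ?t, \<lambda>e. inverse (?t e))"]) (simp_all only: prod.case)
  next
    fix t ch assume "(t, ch) \<in> (torus_pairs :: (('n, 'k) toric_map \<times> _) set)"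
    then obtain t' where t': "t = torus_map t'" "ch = (\<lambda>e. inverse (t' e))" "character_on UNIV t'"
      unfolding torus_pairs_def by auto
    show "t \<in> carrier (Aut \<Sigma>)" using torus_map_Aut t' by simp
    show "t \<otimes>\<^bsub>Aut \<Sigma>\<^esub> root_map e s \<otimes>\<^bsub>Aut \<Sigma>\<^esub> inv\<^bsub>Aut \<Sigma>\<^esub> t = root_map e (ch e * s)" if "e \<in> triangular_roots" for e s
      using torus_map_root_map[OF t'(3) that] t' by simp
  next
    show "finite triangular_roots" by (rule finite_triangular_roots)
    show "inj_on root_weight triangular_roots" by (rule root_weight_inj)
  next
    fix e f :: "int ^ 'n"
    show "root_weight (e + f) = root_weight e + root_weight f" by (rule root_weight_add)
  next
    fix e :: "int ^ 'n" assume e: "e \<in> triangular_roots"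
    show "0 < root_weight e" by (rule root_weight_pos[OF e])
    fix s t :: 'k
    show "root_map e s \<in> carrier (Aut \<Sigma>)" by (rule root_map_closed[OF triangular_root_is_root[OF e]])
    show "root_map e (s + t) = root_map e s \<otimes>\<^bsub>Aut \<Sigma>\<^esub> root_map e t" by (rule root_map_add[OF triangular_root_is_root[OF e]])
    show "s = 0" if "root_map e s \<in> generate (Aut \<Sigma>) {root_map g u | g u. g \<in> triangular_roots \<and> root_weight e < root_weight g}"
      by (rule root_map_independent[OF e that])
  next
    fix e f :: "int ^ 'n" assume ef: "e \<in> triangular_roots" "f \<in> triangular_roots"
    show "root_map e s \<otimes>\<^bsub>Aut \<Sigma>\<^esub> root_map f t = root_map f t \<otimes>\<^bsub>Aut \<Sigma>\<^esub> root_map e s"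
      if "e + f \<notin> triangular_roots" for s t :: 'k by (rule root_maps_commute[OF ef that])
    show "\<exists>\<kappa> :: 'k. \<kappa> \<noteq> 0 \<and>
      (\<forall>s t. \<exists>z\<in>generate (Aut \<Sigma>) {root_map g u | g u. g \<in> sums_above triangular_roots e f - {e + f}}.
        commutator (Aut \<Sigma>) (root_map e s) (root_map f t) = root_map (e + f) (\<kappa> * s * t) \<otimes>\<^bsub>Aut \<Sigma>\<^esub> z)"
      if "e + f \<in> triangular_roots" by (rule root_maps_commutator[OF ef that])
  qed
qed

theorem regular_unipotent_central_series:
  fixes U :: "('n, 'k::{alg_closed_field, field_char_0}) toric_map set"
  assumes reg: "regular_subgroup \<Sigma> U" and sub: "U \<subseteq> generated_by_roots \<Sigma> m p triangular_roots"
  defines "E \<equiv> roots_of_subgroup \<Sigma> m p U"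
  defines "l \<equiv> longest_path_length E"
  shows "lower_central (Aut \<Sigma>) U k = generated_by_roots \<Sigma> m p (up E k)"
    "upper_central (Aut \<Sigma>) U k = generated_by_roots \<Sigma> m p (down E k)"
    "lower_central (Aut \<Sigma>) U (nat (l + 1)) = {\<one>\<^bsub>Aut \<Sigma>\<^esub>}" "upper_central (Aut \<Sigma>) U (nat (l + 1)) = U"
    "int k \<le> l \<Longrightarrow> lower_central (Aut \<Sigma>) U k \<noteq> {\<one>\<^bsub>Aut \<Sigma>\<^esub>} \<and> upper_central (Aut \<Sigma>) U k \<noteq> U"
proof -
  interpret T: torus_root_group "Aut \<Sigma> :: ('n, 'k) toric_map monoid" triangular_roots root_weight root_map torus_pairs
    by (rule torus_root_group_Aut)
  have span: "generated_by_roots \<Sigma> m p S = T.root_span S" if "S \<subseteq> triangular_roots" for S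
  proof -
    have "(\<Union>e\<in>S. root_subgroup \<Sigma> m p e) = {root_map e s | e (s :: 'k). e \<in> S}"
      using root_subgroup_eq[where ?'k = 'k] triangular_root_is_root that by blast
    then show ?thesis by (simp add: generated_by_roots_def T.root_span_def)
  qed
  have U: "subgroup U (Aut \<Sigma>)" using reg by (simp add: regular_subgroup_def algebraic_subgroup_def)
  have UV: "U \<subseteq> T.root_span triangular_roots" using sub span[of triangular_roots] by simp
  have stable: "t \<otimes>\<^bsub>Aut \<Sigma>\<^esub> g \<otimes>\<^bsub>Aut \<Sigma>\<^esub> inv\<^bsub>Aut \<Sigma>\<^esub> t \<in> U" if "(t, ch) \<in> torus_pairs" "g \<in> U" for t ch g
  proof -
    have "t \<in> torus \<Sigma>" using that(1) unfolding torus_eq torus_pairs_def by blast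
    then have "(\<lambda>g. t \<otimes>\<^bsub>Aut \<Sigma>\<^esub> g \<otimes>\<^bsub>Aut \<Sigma>\<^esub> inv\<^bsub>Aut \<Sigma>\<^esub> t) ` U = U"
      using reg by (simp add: regular_subgroup_def)
    then show ?thesis using that(2) by blast
  qed
  have "e \<in> E \<longleftrightarrow> e \<in> triangular_roots \<and> (\<forall>s. root_map e s \<in> U)" for e
  proof
    assume "e \<in> E"
    then have e: "e \<in> roots m p" "root_subgroup \<Sigma> m p e \<subseteq> U" by (auto simp: E_def roots_of_subgroup_def)
    then have all: "\<And>s. root_map e s \<in> U" using root_subgroup_eq[OF e(1), where ?'k = 'k] by blast
    have "e \<in> triangular_roots"
    proof (rule ccontr)
      assume "e \<notin> triangular_roots"
      then obtain c :: 'k where "root_map e c \<notin> generate (Aut \<Sigma>) {root_map f u | f u. f \<in> triangular_roots}"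
        using root_map_not_in_triangular_group[OF e(1)] by blast
      then show False using all[of c] UV by (auto simp: T.root_span_def)
    qed
    then show "e \<in> triangular_roots \<and> (\<forall>s. root_map e s \<in> U)" using all by blast
  next
    assume e: "e \<in> triangular_roots \<and> (\<forall>s. root_map e s \<in> U)"
    then show "e \<in> E" using root_subgroup_eq[where ?'k = 'k] triangular_root_is_root by (auto simp: E_def roots_of_subgroup_def)
  qed
  then have E: "E = {e \<in> triangular_roots. \<forall>s. root_map e s \<in> U}" by blast
  then have EP: "E \<subseteq> triangular_roots" by blast
  have closed: "sum_closed triangular_roots E"
    unfolding E by (rule T.torus_stable_subgroup(1)[OF U UV]) (rule stable; assumption)
  have UE: "U = T.root_span E"
    unfolding E by (rule T.torus_stable_subgroup(2)[OF U UV]) (rule stable; assumption)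
  have ud: "up E k \<subseteq> triangular_roots" "down E k \<subseteq> triangular_roots" for k using up_subset[of E k] down_subset[of E k] EP by auto
  note series = T.central_series[OF closed, folded UE l_def]
  show "lower_central (Aut \<Sigma>) U k = generated_by_roots \<Sigma> m p (up E k)" using series(1) span[OF ud(1)] by simp
  show "upper_central (Aut \<Sigma>) U k = generated_by_roots \<Sigma> m p (down E k)" using series(2) span[OF ud(2)] by simp
  show "lower_central (Aut \<Sigma>) U (nat (l + 1)) = {\<one>\<^bsub>Aut \<Sigma>\<^esub>}" by (rule series(3))
  show "upper_central (Aut \<Sigma>) U (nat (l + 1)) = U" by (rule series(4))
  show "int k \<le> l \<Longrightarrow> lower_central (Aut \<Sigma>) U k \<noteq> {\<one>\<^bsub>Aut \<Sigma>\<^esub>} \<and> upper_central (Aut \<Sigma>) U k \<noteq> U"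
    by (rule series(5))
qed

end

theorem proposition5p5:
  fixes \<Sigma> :: "(real ^ 'n) set set"
    and n m r :: nat
    and p q :: "nat \<Rightarrow> int ^ 'n"
    and a :: "nat \<Rightarrow> nat \<Rightarrow> nat"
    and c :: "nat \<Rightarrow> nat"
    and v :: "int ^ 'n"
    and U :: "('n, 'k::{alg_closed_field, field_char_0}) toric_map set"
    and E :: "(int ^ 'n) set"
    and l :: int
  assumes "n = CARD('n)"
    and "complete_fan \<Sigma>"
    and "radiant TYPE('k) \<Sigma>"
    and "bilateral_numbering \<Sigma> n m p a"
    and "dual_basis n p q"
    and "ordered_classes n m a r c"
    and "\<forall>i\<in>{1..n}. \<forall>j\<in>{1..n}. i < j \<longrightarrow> pairing (q i) v < pairing (q j) v"
    and "\<forall>i\<in>{1..n}. pairing (q i) v < 0"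
    and "unipotent_subgroup \<Sigma> U"
    and "regular_subgroup \<Sigma> U"
    and "U \<subseteq> U_max \<Sigma> m p v"
    and "E = roots_of_subgroup \<Sigma> m p U"
    and "l = longest_path_length E"
  shows "(\<forall>k. int k \<le> l + 1 \<longrightarrow>
             lower_central (Aut \<Sigma>) U k = generated_by_roots \<Sigma> m p (up E k))
       \<and> (\<forall>k. int k \<le> l + 1 \<longrightarrow>
             upper_central (Aut \<Sigma>) U k = generated_by_roots \<Sigma> m p (down E k))
       \<and> lower_central (Aut \<Sigma>) U (nat (l + 1)) = {\<one>\<^bsub>Aut \<Sigma>\<^esub>}
       \<and> upper_central (Aut \<Sigma>) U (nat (l + 1)) = U
       \<and> (\<forall>k. int k \<le> l \<longrightarrow>
             lower_central (Aut \<Sigma>) U k \<noteq> {\<one>\<^bsub>Aut \<Sigma>\<^esub>} \<and> upper_central (Aut \<Sigma>) U k \<noteq> U)"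
proof -
  interpret bilateral_fan \<Sigma> m p n a q
    by unfold_locales (use assms(2,4,5) in \<open>simp_all add: bilateral_numbering_def\<close>)
  have "U \<subseteq> generated_by_roots \<Sigma> m p triangular_roots"
    using assms(11) positive_roots_eq[OF assms(6,7,8)] by (simp add: U_max_def)
  note series = regular_unipotent_central_series[OF assms(10) this, folded assms(12), folded assms(13)]
  show ?thesis using series by blast
qed

end
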